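(* Let $k\geq 2$ be a fixed integer. The following decision problem is NP-complete: given a graph $G$ and a subset $S$ of $V(G)$ (of arbitrary size), decide whether there are $k$ internally disjoint trees connecting $S$ in $G$, i.e., decide whether $\kappa(S)\geq k$.
   Context: All graphs are finite and simple. For a graph $G$ and a set $S\subseteq V(G)$, a tree connecting $S$ is a subtree of $G$ whose vertex set contains $S$. A collection $\{T_1,\ldots,T_\ell\}$ of trees in $G$ is an internally disjoint set of trees connecting $S$ if each $T_i$ is a tree connecting $S$, the trees are pairwise edge-disjoint, and $V(T_i)\cap V(T_j)=S$ for every pair of distinct $i,j$. $\kappa(S)$ denotes the maximum number $\ell$ of such internally disjoint trees connecting $S$. Here $k$ is fixed (not part of the input) while $G$ and $S$ are part of the input. *)

theory Defs
  imports Main "HOL-Computational_Algebra.Polynomial"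
begin

section \<open>Graphs and internally disjoint trees\<close>

type_synonym 'a graph = "'a set \<times> 'a set set"

abbreviation verts :: "'a graph \<Rightarrow> 'a set" where
  "verts \<equiv> fst"

abbreviation edges :: "'a graph \<Rightarrow> 'a set set" where
  "edges \<equiv> snd"

definition simple_graph :: "'a graph \<Rightarrow> bool" where
  "simple_graph G \<longleftrightarrow> finite (verts G) \<and> (\<forall>e\<in>edges G. e \<subseteq> verts G \<and> card e = 2)"

definition subgraph :: "'a graph \<Rightarrow> 'a graph \<Rightarrow> bool" where
  "subgraph H G \<longleftrightarrow> simple_graph H \<and> verts H \<subseteq> verts G \<and> edges H \<subseteq> edges G"

definition connected_graph :: "'a graph \<Rightarrow> bool" where
  "connected_graph G \<longleftrightarrow> verts G \<noteq> {} \<and>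
     (\<forall>u\<in>verts G. \<forall>v\<in>verts G. (u, v) \<in> {(a, b). {a, b} \<in> edges G}\<^sup>*)"

definition is_cycle :: "'a graph \<Rightarrow> 'a list \<Rightarrow> bool" where
  "is_cycle G xs \<longleftrightarrow> 3 \<le> length xs \<and> distinct xs \<and>
     (\<forall>i<length xs. {xs ! i, xs ! (Suc i mod length xs)} \<in> edges G)"

definition is_tree :: "'a graph \<Rightarrow> bool" where
  "is_tree G \<longleftrightarrow> simple_graph G \<and> connected_graph G \<and> (\<nexists>xs. is_cycle G xs)"

definition tree_connecting :: "'a graph \<Rightarrow> 'a set \<Rightarrow> 'a graph \<Rightarrow> bool" where
  "tree_connecting G S T \<longleftrightarrow> is_tree T \<and> subgraph T G \<and> S \<subseteq> verts T"

text \<open>The trees form a set, so they are pairwise distinct. This matters only if \<open>S\<close> is a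
  singleton: the one-vertex tree satisfies the disjointness conditions with itself, and counting
  it repeatedly would make \<open>kappa\<close> undefined.\<close>

definition internally_disjoint_trees :: "'a graph \<Rightarrow> 'a set \<Rightarrow> 'a graph set \<Rightarrow> bool" where
  "internally_disjoint_trees G S \<T> \<longleftrightarrow>
     (\<forall>T\<in>\<T>. tree_connecting G S T) \<and>
     (\<forall>T\<in>\<T>. \<forall>T'\<in>\<T>. T \<noteq> T' \<longrightarrow>
        edges T \<inter> edges T' = {} \<and> verts T \<inter> verts T' = S)"

definition kappa :: "'a graph \<Rightarrow> 'a set \<Rightarrow> nat" where
  "kappa G S = Max {card \<T> |\<T>. internally_disjoint_trees G S \<T>}"

lemma finite_edges:
  assumes "simple_graph G"
  shows "finite (edges G)"
proof (rule finite_subset)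
  show "edges G \<subseteq> Pow (verts G)" "finite (Pow (verts G))"
    using assms by (auto simp: simple_graph_def)
qed

lemma kappa_ge_iff:
  assumes "simple_graph G"
  shows "k \<le> kappa G S \<longleftrightarrow> (\<exists>\<T>. internally_disjoint_trees G S \<T> \<and> card \<T> = k)"
proof -
  define U where "U = Pow (verts G) \<times> Pow (edges G)"
  have finU: "finite U"
    using assms finite_edges[OF assms] by (simp add: U_def simple_graph_def)
  have sub: "\<T> \<subseteq> U" if "internally_disjoint_trees G S \<T>" for \<T>
  proof
    fix T assume "T \<in> \<T>"
    then have "subgraph T G"
      using that by (auto simp: internally_disjoint_trees_def tree_connecting_def)
    then show "T \<in> U"
      by (cases T) (auto simp: U_def subgraph_def)
  qed
  let ?C = "{card \<T> |\<T>. internally_disjoint_trees G S \<T>}"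
  have "?C \<subseteq> card ` Pow U"
    using sub by blast
  then have finC: "finite ?C"
    using finU by (meson finite_Pow_iff finite_imageI finite_subset)
  have "internally_disjoint_trees G S {}"
    by (simp add: internally_disjoint_trees_def)
  then have neC: "?C \<noteq> {}"
    by blast
  show ?thesis
  proof
    assume le: "k \<le> kappa G S"
    have "kappa G S \<in> ?C"
      unfolding kappa_def by (rule Max_in[OF finC neC])
    then obtain \<T> where T: "internally_disjoint_trees G S \<T>" "card \<T> = kappa G S"
      by auto
    then obtain \<T>' where T': "\<T>' \<subseteq> \<T>" "card \<T>' = k"
      using le by (metis obtain_subset_with_card_n)
    then have "internally_disjoint_trees G S \<T>'"
      using T(1) unfolding internally_disjoint_trees_def by blast
    then show "\<exists>\<T>. internally_disjoint_trees G S \<T> \<and> card \<T> = k"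
      using T'(2) by blast
  next
    assume "\<exists>\<T>. internally_disjoint_trees G S \<T> \<and> card \<T> = k"
    then have "k \<in> ?C"
      by blast
    then show "k \<le> kappa G S"
      unfolding kappa_def by (rule Max_ge[OF finC])
  qed
qed

section \<open>Instances as bit strings\<close>

text \<open>An instance is a graph with vertex set \<open>{..<n}\<close> together with a set \<open>S\<close> of vertices. It is
  encoded by \<open>n\<close> in unary, the adjacency matrix of the graph (row by row), and the
  characteristic vector of \<open>S\<close>.\<close>

definition instance_of :: "nat graph \<Rightarrow> nat set \<Rightarrow> bool" where
  "instance_of G S \<longleftrightarrow> simple_graph G \<and> (\<exists>n. verts G = {..<n}) \<and> S \<subseteq> verts G"

definition encode :: "nat graph \<Rightarrow> nat set \<Rightarrow> bool list" where
  "encode G S = (let n = card (verts G) in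
     replicate n True @ [False] @
     concat (map (\<lambda>i. map (\<lambda>j. {i, j} \<in> edges G) [0..<n]) [0..<n]) @
     map (\<lambda>i. i \<in> S) [0..<n])"

lemma unary_prefix_inject:
  assumes "replicate m True @ False # xs = replicate n True @ False # ys"
  shows "m = n \<and> xs = ys"
  using assms
proof (induction m arbitrary: n)
  case 0
  then show ?case by (cases n) auto
next
  case (Suc m)
  then show ?case by (cases n) auto
qed

lemma encode_inject:
  assumes 1: "instance_of G S" and 2: "instance_of G' S'" and eq: "encode G S = encode G' S'"
  shows "G = G' \<and> S = S'"
proof -
  obtain n where n: "verts G = {..<n}"
    using 1 by (auto simp: instance_of_def)
  obtain n' where n': "verts G' = {..<n'}"
    using 2 by (auto simp: instance_of_def)
  let ?rows = "\<lambda>G. map (\<lambda>i. map (\<lambda>j. {i, j} \<in> edges G) [0..<n]) [0..<n]"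
  let ?vec = "\<lambda>S. map (\<lambda>i. i \<in> S) [0..<n]"
  have eq': "replicate n True @ False # concat (?rows G) @ ?vec S =
      replicate n' True @ False # concat (map (\<lambda>i. map (\<lambda>j. {i, j} \<in> edges G') [0..<n']) [0..<n'])
        @ map (\<lambda>i. i \<in> S') [0..<n']"
    using eq by (simp add: encode_def n n' Let_def)
  have nn: "n = n'"
    using unary_prefix_inject[OF eq'] by (rule conjunct1)
  have body: "concat (?rows G) @ ?vec S = concat (?rows G') @ ?vec S'"
    using unary_prefix_inject[OF eq'] unfolding nn by (rule conjunct2)
  have len: "length (concat (?rows G)) = length (concat (?rows G'))"
    by (simp add: length_concat comp_def)
  have "concat (?rows G) = concat (?rows G') \<and> ?vec S = ?vec S'"
    by (rule append_eq_append_conv[OF disjI1[OF len], THEN iffD1]) (rule body)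
  then have conc: "concat (?rows G) = concat (?rows G')" and vec: "?vec S = ?vec S'"
    by (rule conjunct1, rule conjunct2)
  have "?rows G = ?rows G'"
    by (rule concat_injective[OF conc]) (auto simp: in_set_zip)
  then have adj: "{i, j} \<in> edges G \<longleftrightarrow> {i, j} \<in> edges G'" if "i < n" "j < n" for i j
    using that by simp
  have edge: "e \<in> edges G \<longleftrightarrow> e \<in> edges G'" if "e \<subseteq> {..<n}" "card e = 2" for e
  proof -
    obtain i j where "e = {i, j}"
      using \<open>card e = 2\<close> by (auto simp: card_2_iff)
    then show ?thesis
      using adj[of i j] \<open>e \<subseteq> {..<n}\<close> by simp
  qed
  have "e \<subseteq> {..<n} \<and> card e = 2" if "e \<in> edges G \<or> e \<in> edges G'" for e
    using that 1 2 n n' nn by (auto simp: instance_of_def simple_graph_def)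
  then have "edges G = edges G'"
    using edge by blast
  moreover have "i \<in> S \<longleftrightarrow> i \<in> S'" if "i < n" for i
    using vec that by simp
  then have "S = S'"
  proof -
    have "S \<subseteq> {..<n}" "S' \<subseteq> {..<n}"
      using 1 2 n n' nn by (simp_all add: instance_of_def)
    then show ?thesis
      using \<open>\<And>i. i < n \<Longrightarrow> i \<in> S \<longleftrightarrow> i \<in> S'\<close> by (meson lessThan_iff subset_antisym subsetD subsetI)
  qed
  ultimately show ?thesis
    using n n' nn by (simp add: prod_eq_iff)
qed

section \<open>Polynomial time on deterministic multitape Turing machines\<close>

text \<open>The working states are \<open>{..<num_states M}\<close>, the start state is \<open>0\<close>, and the halting state is
  \<open>num_states M\<close>. The tape alphabet is \<open>{..<num_syms M}\<close>, where \<open>0\<close> is the blank and \<open>1\<close>, \<open>2\<close>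
  represent the bits \<open>False\<close>, \<open>True\<close>. Tapes are infinite in both directions.\<close>

datatype move = Left | Stay | Right

record tm =
  num_tapes :: nat
  num_states :: nat
  num_syms :: nat
  delta :: "nat \<Rightarrow> nat list \<Rightarrow> nat \<times> (nat \<times> move) list"

definition turing_machine :: "tm \<Rightarrow> bool" where
  "turing_machine M \<longleftrightarrow> 1 \<le> num_tapes M \<and> 3 \<le> num_syms M \<and>
     (\<forall>q as. q < num_states M \<longrightarrow> length as = num_tapes M \<longrightarrow> set as \<subseteq> {..<num_syms M} \<longrightarrow>
        (case delta M q as of (q', acts) \<Rightarrow>
           q' \<le> num_states M \<and> length acts = num_tapes M \<and> fst ` set acts \<subseteq> {..<num_syms M}))"

text \<open>A tape is given by its contents and its head position, a configuration by the state and the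
  list of tapes.\<close>

type_synonym tape = "(int \<Rightarrow> nat) \<times> int"
type_synonym config = "nat \<times> tape list"

fun read :: "tape \<Rightarrow> nat" where
  "read (f, h) = f h"

fun offset :: "move \<Rightarrow> int" where
  "offset Left = -1"
| "offset Stay = 0"
| "offset Right = 1"

fun act :: "nat \<times> move \<Rightarrow> tape \<Rightarrow> tape" where
  "act (a, m) (f, h) = (f(h := a), h + offset m)"

definition step :: "tm \<Rightarrow> config \<Rightarrow> config" where
  "step M c = (case c of (q, ts) \<Rightarrow>
     if q < num_states M
     then (case delta M q (map read ts) of (q', acts) \<Rightarrow> (q', map2 act acts ts))
     else (q, ts))"

definition bit_sym :: "bool \<Rightarrow> nat" where
  "bit_sym b = (if b then 2 else 1)"

definition blank_tape :: tape where
  "blank_tape = (\<lambda>_. 0, 0)"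

definition input_tape :: "bool list \<Rightarrow> tape" where
  "input_tape xs =
     (\<lambda>i. if 0 \<le> i \<and> i < int (length xs) then bit_sym (xs ! nat i) else 0, 0)"

definition init_config :: "tm \<Rightarrow> bool list \<Rightarrow> config" where
  "init_config M xs = (0, input_tape xs # replicate (num_tapes M - 1) blank_tape)"

text \<open>The output is the word on the last tape that starts in cell \<open>0\<close> and ends before the first
  blank.\<close>

definition output_is :: "tape \<Rightarrow> bool list \<Rightarrow> bool" where
  "output_is t ys \<longleftrightarrow>
     (\<forall>i<length ys. fst t (int i) = bit_sym (ys ! i)) \<and> fst t (int (length ys)) = 0"

text \<open>Halting configurations are fixed points of \<open>step\<close>, so the following means that \<open>M\<close> halts
  after at most \<open>t\<close> steps.\<close>

definition computes_within :: "tm \<Rightarrow> bool list \<Rightarrow> bool list \<Rightarrow> nat \<Rightarrow> bool" where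
  "computes_within M xs ys t \<longleftrightarrow>
     (case (step M ^^ t) (init_config M xs) of (q, ts) \<Rightarrow>
        q = num_states M \<and> output_is (last ts) ys)"

definition poly_time_computable :: "(bool list \<Rightarrow> bool list) \<Rightarrow> bool" where
  "poly_time_computable f \<longleftrightarrow>
     (\<exists>M. turing_machine M \<and>
       (\<exists>p :: nat poly. \<forall>xs. computes_within M xs (f xs) (poly p (length xs))))"

section \<open>NP-completeness\<close>

definition class_P :: "bool list set set" where
  "class_P = {L. poly_time_computable (\<lambda>xs. [xs \<in> L])}"

text \<open>Each bit of \<open>xs\<close> is preceded by \<open>True\<close>; the first \<open>False\<close> in an even position marks the
  beginning of \<open>ys\<close>.\<close>

definition pair_word :: "bool list \<Rightarrow> bool list \<Rightarrow> bool list" where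
  "pair_word xs ys = concat (map (\<lambda>b. [True, b]) xs) @ False # ys"

lemma pair_word_inject:
  assumes "pair_word xs ys = pair_word xs' ys'"
  shows "xs = xs' \<and> ys = ys'"
  using assms
proof (induction xs arbitrary: xs')
  case Nil
  then show ?case by (cases xs') (auto simp: pair_word_def)
next
  case (Cons b xs)
  then show ?case by (cases xs') (auto simp: pair_word_def)
qed

definition class_NP :: "bool list set set" where
  "class_NP = {L. \<exists>R\<in>class_P. \<exists>p :: nat poly. \<forall>xs.
     xs \<in> L \<longleftrightarrow> (\<exists>ys. length ys \<le> poly p (length xs) \<and> pair_word xs ys \<in> R)}"

definition poly_reducible :: "bool list set \<Rightarrow> bool list set \<Rightarrow> bool" where
  "poly_reducible L L' \<longleftrightarrow>
     (\<exists>f. poly_time_computable f \<and> (\<forall>xs. xs \<in> L \<longleftrightarrow> f xs \<in> L'))"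

definition NP_complete :: "bool list set \<Rightarrow> bool" where
  "NP_complete L \<longleftrightarrow> L \<in> class_NP \<and> (\<forall>L'\<in>class_NP. poly_reducible L' L)"

end

theory Submission
  imports Defs "HOL-Library.Countable"
begin

text \<open>
  Membership in NP and hardness both rest on one class of efficient computations: predicates on words
  that are defined by bounded first-order formulas with addition, multiplication and access to the
  bits of the word. Such formulas are evaluated in polynomial time by counter programs, whose
  registers become head positions on the tapes of a Turing machine.

  If \<open>S\<close> is independent and the remaining vertices form a clique, then a subset of the remaining
  vertices connects \<open>S\<close> as soon as it meets the neighbourhood of each terminal. Hence \<open>k\<close> internally
  disjoint trees exist iff the non-terminals have a \<open>k\<close>-colouring in which every terminal sees all
  colours. For \<open>k = 2\<close> this is two-colourability of hypergraphs, which expresses satisfiability of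
  clauses; \<open>k - 2\<close> non-terminals adjacent to all terminals take care of larger \<open>k\<close>. The computation of
  a verifier with an unknown certificate is described by implications between positive facts, so
  that the facts of the real run hold in every satisfying assignment.

  For membership, a certificate lists the edges of \<open>k\<close> connected subgraphs and, for each vertex, its
  distance bounds from a root; spanning trees of these subgraphs are the required trees.
\<close>

section \<open>Counter programs and their compilation to Turing machines\<close>

text \<open>Bounded formulas are cheap to evaluate because all values of terms stay polynomial in
  the length of the word: unary registers and arithmetic by counting loops then cost only polynomial
  time. Hardness starts from the definition of \<open>class_NP\<close>, so clauses are needed for an
  arbitrary verifier. They come from a fixed finite list of schemas in three numeric variables
  (time, cell, auxiliary number), and the word enters only through the guards; this is what makes
  adjacency in the resulting graph expressible by a formula. A vertex is a number coding a schema or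
  a kind of literal together with its parameters. All numbers below a bound are vertices: those that
  code nothing become non-terminals without terminal neighbours, so the meaningful numbers need not
  be listed or renumbered. Three variables cannot name the heads of all tapes at once; therefore the
  scanned symbol of each tape is a fact of its own. No colour has a meaning beforehand, since
  constraints on colourings are invariant under permuting the colours; the vertex for
  \<open>False\<close> breaks this symmetry.\<close>

datatype test = NZ nat | Bit_True | Nonblank

datatype com = Inc nat | Dec nat | Out bool | Seq com com | If_Else test com com | While test com

type_synonym store = "(nat \<Rightarrow> nat) \<times> bool list"

fun holds :: "bool list \<Rightarrow> test \<Rightarrow> store \<Rightarrow> bool" where
  "holds w (NZ r) s = (fst s r \<noteq> 0)"
| "holds w Bit_True s = (fst s 0 < length w \<and> w ! fst s 0)"
| "holds w Nonblank s = (fst s 0 < length w)"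

text \<open>The time is the exact number of steps of the compiled code. Each test costs one step;
  leaving the first branch, or returning to the test of a loop, costs one more for a jump.\<close>

inductive exec :: "bool list \<Rightarrow> com \<Rightarrow> store \<Rightarrow> nat \<Rightarrow> store \<Rightarrow> bool" for w where
  Inc: "exec w (Inc r) (e, out) 1 (e(r := Suc (e r)), out)"
| Dec: "exec w (Dec r) (e, out) 1 (e(r := e r - 1), out)"
| Out: "exec w (Out b) (e, out) 1 (e, out @ [b])"
| Seq: "exec w c1 s t1 s1 \<Longrightarrow> exec w c2 s1 t2 s2 \<Longrightarrow> exec w (Seq c1 c2) s (t1 + t2) s2"
| If_True: "holds w b s \<Longrightarrow> exec w c1 s t s' \<Longrightarrow> exec w (If_Else b c1 c2) s (Suc t + 1) s'"
| If_False: "\<not> holds w b s \<Longrightarrow> exec w c2 s t s' \<Longrightarrow> exec w (If_Else b c1 c2) s (Suc t) s'"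
| While_False: "\<not> holds w b s \<Longrightarrow> exec w (While b c) s 1 s"
| While_True: "holds w b s \<Longrightarrow> exec w c s t1 s1 \<Longrightarrow> exec w (While b c) s1 t2 s2 \<Longrightarrow>
    exec w (While b c) s (Suc t1 + 1 + t2) s2"

fun test_regs :: "test \<Rightarrow> nat" where
  "test_regs (NZ r) = Suc r"
| "test_regs _ = 1"

fun regs :: "com \<Rightarrow> nat" where
  "regs (Inc r) = Suc r"
| "regs (Dec r) = Suc r"
| "regs (Out b) = 0"
| "regs (Seq c1 c2) = max (regs c1) (regs c2)"
| "regs (If_Else b c1 c2) = max (test_regs b) (max (regs c1) (regs c2))"
| "regs (While b c) = max (test_regs b) (regs c)"

section \<open>Compilation of programs to machine code\<close>

text \<open>\<open>compile\<close> never produces \<open>Mark\<close>. It is placed before the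
  compiled code and writes the marker on cell 0 of every register tape.\<close>

datatype instr = Mark | Up nat | Down nat | Emit bool | Branch test nat | Goto nat

fun code_size :: "com \<Rightarrow> nat" where
  "code_size (Inc r) = 1"
| "code_size (Dec r) = 1"
| "code_size (Out b) = 1"
| "code_size (Seq c1 c2) = code_size c1 + code_size c2"
| "code_size (If_Else b c1 c2) = code_size c1 + code_size c2 + 2"
| "code_size (While b c) = code_size c + 2"

text \<open>Jump targets are absolute; \<open>i\<close> is the address of the first instruction of
  the code.\<close>

fun compile :: "com \<Rightarrow> nat \<Rightarrow> instr list" where
  "compile (Inc r) i = [Up r]"
| "compile (Dec r) i = [Down r]"
| "compile (Out b) i = [Emit b]"
| "compile (Seq c1 c2) i = compile c1 i @ compile c2 (i + code_size c1)"
| "compile (If_Else b c1 c2) i = Branch b (i + code_size c1 + 2) # compile c1 (i + 1) @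
     Goto (i + code_size c1 + code_size c2 + 2) # compile c2 (i + code_size c1 + 2)"
| "compile (While b c) i = Branch b (i + code_size c + 2) # compile c (i + 1) @ [Goto i]"

lemma length_compile [simp]: "length (compile c i) = code_size c"
  by (induction c arbitrary: i) auto

text \<open>Tape \<open>0\<close> is the input tape, tape \<open>Suc r\<close> represents register \<open>r\<close> by its head position, with
  the symbol \<open>1\<close> marking cell \<open>0\<close>, and tape \<open>Suc m\<close> is the output tape. The head of tape \<open>0\<close> moves
  together with the head of tape \<open>1\<close>, so register \<open>0\<close> points into the input.\<close>

fun sees :: "test \<Rightarrow> nat list \<Rightarrow> bool" where
  "sees (NZ r) as = (as ! Suc r \<noteq> 1)"
| "sees Bit_True as = (as ! 0 = 2)"
| "sees Nonblank as = (as ! 0 \<noteq> 0)"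

fun action :: "nat \<Rightarrow> nat list \<Rightarrow> instr \<Rightarrow> nat \<Rightarrow> nat \<times> move" where
  "action m as Mark i = (if 0 < i \<and> i \<le> m then 1 else as ! i, Stay)"
| "action m as (Up r) i = (as ! i, if i = Suc r \<or> i = 0 \<and> r = 0 then Right else Stay)"
| "action m as (Down r) i =
     (as ! i, if (i = Suc r \<or> i = 0 \<and> r = 0) \<and> as ! Suc r \<noteq> 1 then Left else Stay)"
| "action m as (Emit b) i = (if i = Suc m then (bit_sym b, Right) else (as ! i, Stay))"
| "action m as _ i = (as ! i, Stay)"

fun successor :: "nat list \<Rightarrow> nat \<Rightarrow> instr \<Rightarrow> nat" where
  "successor as q (Branch b n) = (if sees b as then Suc q else n)"
| "successor as q (Goto n) = n"
| "successor as q _ = Suc q"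

text \<open>Cutting the successor off at \<open>length P\<close>, the halting state, turns every
  instruction list into a Turing machine. The jump targets of compiled code lie within this range
  anyway.\<close>

definition machine :: "nat \<Rightarrow> instr list \<Rightarrow> tm" where
  "machine m P = \<lparr>num_tapes = m + 2, num_states = length P, num_syms = 3,
     delta = \<lambda>q as. (min (length P) (successor as q (P ! q)), map (action m as (P ! q)) [0..<m + 2])\<rparr>"

lemma fst_action_less: "i < length as \<Longrightarrow> set as \<subseteq> {..<3} \<Longrightarrow> fst (action m as I i) < 3"
proof -
  assume "i < length as" "set as \<subseteq> {..<3}"
  then have "as ! i < 3" "fst (as ! i, x) < 3" for x :: move
    using subsetD[OF _ nth_mem, of as "{..<3}" i] by simp_all
  then show ?thesis
    by (cases I) (auto simp: bit_sym_def)
qed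

lemma turing_machine_machine: "turing_machine (machine m P)"
  by (auto simp: turing_machine_def machine_def fst_action_less simp del: upt_Suc)

definition marked :: "int \<Rightarrow> nat" where
  "marked i = (if i = 0 then 1 else 0)"

definition tape_at :: "bool list \<Rightarrow> nat \<Rightarrow> store \<Rightarrow> nat \<Rightarrow> tape" where
  "tape_at w m s i = (if i = 0 then (fst (input_tape w), int (fst s 0))
     else if i \<le> m then (marked, int (fst s (i - 1)))
     else (fst (input_tape (snd s)), int (length (snd s))))"

definition tapes :: "bool list \<Rightarrow> nat \<Rightarrow> store \<Rightarrow> tape list" where
  "tapes w m s = map (tape_at w m s) [0..<m + 2]"

lemma sees_iff_holds:
  assumes "test_regs b \<le> m"
  shows "sees b (map read (tapes w m s)) \<longleftrightarrow> holds w b s"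
  using assms
  by (cases b) (auto simp: tapes_def tape_at_def marked_def input_tape_def bit_sym_def nth_append)

lemma map2_act_map:
  "map2 act (map f xs) (map g xs) = map (\<lambda>x. act (f x) (g x)) xs"
  by (induction xs) auto

lemma step_machine:
  assumes "q < length P"
    and "\<And>i. i < m + 2 \<Longrightarrow>
      act (action m (map read (tapes w m s)) (P ! q) i) (tape_at w m s i) = tape_at w m s' i"
    and "successor (map read (tapes w m s)) q (P ! q) = q'" and "q' \<le> length P"
  shows "step (machine m P) (q, tapes w m s) = (q', tapes w m s')"
proof -
  have "map2 act (map (action m (map read (tapes w m s)) (P ! q)) [0..<m + 2]) (tapes w m s) = tapes w m s'"
    using assms(2) by (simp only: tapes_def map2_act_map) auto
  then show ?thesis
    using assms(1,3,4) by (simp add: step_def machine_def)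
qed

lemma read_tapes: "i < m + 2 \<Longrightarrow> map read (tapes w m s) ! i = read (tape_at w m s i)"
  by (simp add: tapes_def del: upt_Suc)

lemma act_id: "act (read t, Stay) t = t"
  by (cases t) simp

lemma step_test:
  assumes "q < length P" "P ! q = Branch b n" "test_regs b \<le> m" "n \<le> length P"
  shows "step (machine m P) (q, tapes w m s) = (if holds w b s then Suc q else n, tapes w m s)"
  by (rule step_machine) (use assms in \<open>auto simp: read_tapes act_id sees_iff_holds\<close>)

lemma step_goto:
  assumes "q < length P" "P ! q = Goto n" "n \<le> length P"
  shows "step (machine m P) (q, tapes w m s) = (n, tapes w m s)"
  by (rule step_machine) (use assms in \<open>auto simp: read_tapes act_id\<close>)

lemma step_up:
  assumes "q < length P" "P ! q = Up r" "r < m"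
  shows "step (machine m P) (q, tapes w m (e, out)) = (Suc q, tapes w m (e(r := Suc (e r)), out))"
  by (rule step_machine) (use assms in \<open>auto simp: read_tapes tape_at_def\<close>)

lemma step_down:
  assumes "q < length P" "P ! q = Down r" "r < m"
  shows "step (machine m P) (q, tapes w m (e, out)) = (Suc q, tapes w m (e(r := e r - 1), out))"
  by (rule step_machine) (use assms in \<open>auto simp: read_tapes tape_at_def marked_def\<close>)

lemma step_emit:
  assumes "q < length P" "P ! q = Emit b"
  shows "step (machine m P) (q, tapes w m (e, out)) = (Suc q, tapes w m (e, out @ [b]))"
  by (rule step_machine)
    (use assms in \<open>auto simp: read_tapes tape_at_def input_tape_def nth_append fun_eq_iff\<close>)

lemma step_mark:
  assumes "P \<noteq> []" "P ! 0 = Mark"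
  shows "step (machine m P) (init_config (machine m P) w) = (1, tapes w m (\<lambda>_. 0, []))"
proof -
  let ?f = "\<lambda>i. if i = 0 then input_tape w else blank_tape"
  have ic: "init_config (machine m P) w = (0, map ?f [0..<m + 2])"
    by (auto simp: init_config_def machine_def nth_Cons' intro!: nth_equalityI simp del: upt_Suc)
  have "act (action m (map read (map ?f [0..<m + 2])) Mark i) (?f i) = tape_at w m (\<lambda>_. 0, []) i"
    if "i < m + 2" for i
    using that
    by (auto simp: tape_at_def blank_tape_def input_tape_def marked_def fun_eq_iff simp del: upt_Suc)
  then have "map2 act (map (action m (map read (map ?f [0..<m + 2])) Mark) [0..<m + 2])
      (map ?f [0..<m + 2]) = tapes w m (\<lambda>_. 0, [])"
    unfolding tapes_def map2_act_map by (intro map_cong refl) (simp del: upt_Suc)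
  then show ?thesis
    using assms unfolding ic by (simp add: step_def machine_def Suc_le_eq del: upt_Suc)
qed

text \<open>The surrounding instructions \<open>pre\<close> and \<open>post\<close> are arbitrary
  because the induction passes to subprograms that sit at other addresses of the same list
  \<open>P\<close>. The step count is exact, so that consecutive runs can be joined.\<close>

lemma exec_compile:
  assumes "exec w c s t s'" "regs c \<le> m" "P = pre @ compile c (length pre) @ post"
  shows "(step (machine m P) ^^ t) (length pre, tapes w m s) =
    (length pre + code_size c, tapes w m s')"
  using assms
proof (induction arbitrary: pre post rule: exec.induct)
  case (Inc r e out)
  then show ?case by (simp add: step_up)
next
  case (Dec r e out)
  then show ?case by (simp add: step_down)
next
  case (Out b e out)
  then show ?case by (simp add: step_emit)
next
  case (Seq c1 s t1 s1 c2 t2 s2)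
  have 1: "(step (machine m P) ^^ t1) (length pre, tapes w m s) =
      (length pre + code_size c1, tapes w m s1)"
    using Seq.prems by (intro Seq.IH(1)) auto
  have 2: "(step (machine m P) ^^ t2) (length (pre @ compile c1 (length pre)), tapes w m s1) =
      (length (pre @ compile c1 (length pre)) + code_size c2, tapes w m s2)"
    using Seq.prems by (intro Seq.IH(2)) auto
  show ?case
    using 1 2 by (simp add: add.commute[of t1] funpow_add add.assoc)
next
  case (If_True b s c1 t s' c2)
  let ?pre = "pre @ [Branch b (length pre + code_size c1 + 2)]"
  have 1: "step (machine m P) (length pre, tapes w m s) = (Suc (length pre), tapes w m s)"
    using If_True.prems If_True.hyps by (subst step_test) (auto simp: nth_append)
  have 2: "(step (machine m P) ^^ t) (length ?pre, tapes w m s) =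
      (length ?pre + code_size c1, tapes w m s')"
    using If_True.prems by (intro If_True.IH) auto
  have 3: "step (machine m P) (length ?pre + code_size c1, tapes w m s') =
      (length pre + code_size (If_Else b c1 c2), tapes w m s')"
    using If_True.prems by (subst step_goto) (auto simp: nth_append)
  show ?case
    using 1 2 3 by (simp add: funpow_swap1)
next
  case (If_False b s c2 t s' c1)
  let ?pre = "pre @ Branch b (length pre + code_size c1 + 2) # compile c1 (Suc (length pre)) @
     [Goto (length pre + code_size c1 + code_size c2 + 2)]"
  have 1: "step (machine m P) (length pre, tapes w m s) = (length ?pre, tapes w m s)"
    using If_False.prems If_False.hyps by (subst step_test) (auto simp: nth_append)
  have 2: "(step (machine m P) ^^ t) (length ?pre, tapes w m s) =
      (length ?pre + code_size c2, tapes w m s')"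
    using If_False.prems by (intro If_False.IH) auto
  show ?case
    using 1 2 by (simp add: funpow_swap1)
next
  case (While_False b s c)
  then show ?case by (simp add: step_test nth_append)
next
  case (While_True b s c t1 s1 t2 s2)
  let ?pre = "pre @ [Branch b (length pre + code_size c + 2)]"
  have 1: "step (machine m P) (length pre, tapes w m s) = (Suc (length pre), tapes w m s)"
    using While_True.prems While_True.hyps by (subst step_test) (auto simp: nth_append)
  have 2: "(step (machine m P) ^^ t1) (length ?pre, tapes w m s) =
      (length ?pre + code_size c, tapes w m s1)"
    using While_True.prems by (intro While_True.IH(1)) auto
  have 3: "step (machine m P) (length ?pre + code_size c, tapes w m s1) = (length pre, tapes w m s1)"
    using While_True.prems by (subst step_goto) (auto simp: nth_append)
  have 4: "(step (machine m P) ^^ t2) (length pre, tapes w m s1) =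
      (length pre + code_size (While b c), tapes w m s2)"
    using While_True.prems by (intro While_True.IH(2)) auto
  have "(step (machine m P) ^^ (Suc t1 + 1)) (length pre, tapes w m s) = (length pre, tapes w m s1)"
    using 1 2 3 by (simp add: funpow_swap1)
  then show ?case
    using 4 by (simp only: add.commute[of _ t2] funpow_add o_apply)
qed

lemma step_halted: "step M (num_states M, ts) = (num_states M, ts)"
  by (simp add: step_def)

lemma funpow_step_halted: "(step M ^^ t) (num_states M, ts) = (num_states M, ts)"
  by (induction t) (auto simp: step_halted)

lemma funpow_step_halted_mono:
  assumes "(step M ^^ t) c = (num_states M, ts)" "t \<le> t'"
  shows "(step M ^^ t') c = (num_states M, ts)"
proof -
  have "(step M ^^ t') c = (step M ^^ (t' - t)) ((step M ^^ t) c)"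
    using assms(2) by (metis funpow_add o_apply le_add_diff_inverse2)
  then show ?thesis
    using assms(1) by (simp add: funpow_step_halted)
qed

lemma poly_time_computable_exec:
  fixes p :: "nat poly"
  assumes "\<And>w. \<exists>t e. t \<le> poly p (length w) \<and> exec w c (\<lambda>_. 0, []) t (e, f w)"
  shows "poly_time_computable f"
proof -
  define m where "m = regs c"
  define P where "P = Mark # compile c 1"
  let ?M = "machine m P"
  have ns: "num_states ?M = Suc (code_size c)"
    by (simp add: machine_def P_def)
  \<comment> \<open>The additional step executes \<open>Mark\<close>. The bound may exceed the
    actual time, since halting configurations are fixed points.\<close>
  have "computes_within ?M w (f w) (poly (p + 1) (length w))" for w
  proof -
    obtain t e where t: "t \<le> poly p (length w)" and ex: "exec w c (\<lambda>_. 0, []) t (e, f w)"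
      using assms by blast
    have 1: "step ?M (init_config ?M w) = (1, tapes w m (\<lambda>_. 0, []))"
      by (rule step_mark) (simp_all add: P_def)
    have 2: "(step ?M ^^ t) (length [Mark], tapes w m (\<lambda>_. 0, [])) =
        (length [Mark] + code_size c, tapes w m (e, f w))"
      by (rule exec_compile[OF ex, where post = "[]"]) (simp_all add: m_def P_def)
    have "(step ?M ^^ Suc t) (init_config ?M w) = (num_states ?M, tapes w m (e, f w))"
      using 1 2 by (simp add: ns funpow_swap1)
    then have "(step ?M ^^ (poly (p + 1) (length w))) (init_config ?M w) = (num_states ?M, tapes w m (e, f w))"
      using t by (elim funpow_step_halted_mono) simp
    then show ?thesis
      by (auto simp: computes_within_def output_is_def tapes_def tape_at_def input_tape_def)
  qed
  then show ?thesis
    unfolding poly_time_computable_def using turing_machine_machine by blast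
qed

section \<open>Bounded first-order formulas\<close>

datatype trm = Var nat | Const nat | Add trm trm | Mult trm trm

datatype fml = Less trm trm | Bit trm | Neg fml | Conj fml fml | Ex nat trm fml

fun val :: "trm \<Rightarrow> (nat \<Rightarrow> nat) \<Rightarrow> nat" where
  "val (Var i) e = e i"
| "val (Const c) e = c"
| "val (Add t u) e = val t e + val u e"
| "val (Mult t u) e = val t e * val u e"

fun eval :: "fml \<Rightarrow> bool list \<Rightarrow> (nat \<Rightarrow> nat) \<Rightarrow> bool" where
  "eval (Less t u) w e = (val t e < val u e)"
| "eval (Bit t) w e = (val t e < length w \<and> w ! val t e)"
| "eval (Neg \<phi>) w e = (\<not> eval \<phi> w e)"
| "eval (Conj \<phi> \<psi>) w e = (eval \<phi> w e \<and> eval \<psi> w e)"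
| "eval (Ex x t \<phi>) w e = (\<exists>v<val t e. eval \<phi> w (e(x := v)))"

fun below :: "nat \<Rightarrow> trm \<Rightarrow> bool" where
  "below d (Var i) = (i < d)"
| "below d (Const c) = True"
| "below d (Add t u) = (below d t \<and> below d u)"
| "below d (Mult t u) = (below d t \<and> below d u)"

fun scoped :: "nat \<Rightarrow> fml \<Rightarrow> bool" where
  "scoped d (Less t u) = (below d t \<and> below d u)"
| "scoped d (Bit t) = below d t"
| "scoped d (Neg \<phi>) = scoped d \<phi>"
| "scoped d (Conj \<phi> \<psi>) = (scoped d \<phi> \<and> scoped d \<psi>)"
| "scoped d (Ex x t \<phi>) = (d \<le> x \<and> below d t \<and> scoped (Suc x) \<phi>)"

lemma val_cong: "below d t \<Longrightarrow> (\<And>i. i < d \<Longrightarrow> e i = e' i) \<Longrightarrow> val t e = val t e'"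
  by (induction t) auto

lemma below_mono: "below d t \<Longrightarrow> d \<le> d' \<Longrightarrow> below d' t"
  by (induction t) auto

text \<open>Registers \<open>0\<close> and \<open>1\<close> are the input head and the flag that receives truth values. Variables
  are registers from \<open>2\<close> on; all registers from \<open>d\<close> on are scratch space and contain \<open>0\<close>.\<close>

definition runs :: "bool list \<Rightarrow> com \<Rightarrow> store \<Rightarrow> store \<Rightarrow> nat \<Rightarrow> bool" where
  "runs w c s s' T \<longleftrightarrow> (\<exists>t\<le>T. exec w c s t s')"

lemma runs_mono: "runs w c s s' T \<Longrightarrow> T \<le> T' \<Longrightarrow> runs w c s s' T'"
  by (auto simp: runs_def intro: order_trans)

lemma runs_Inc: "s' = (e(r := Suc (e r)), out) \<Longrightarrow> 1 \<le> T \<Longrightarrow> runs w (Inc r) (e, out) s' T"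
  using exec.Inc by (auto simp: runs_def)

lemma runs_Dec: "s' = (e(r := e r - 1), out) \<Longrightarrow> 1 \<le> T \<Longrightarrow> runs w (Dec r) (e, out) s' T"
  using exec.Dec by (auto simp: runs_def)

lemma runs_Out: "s' = (e, out @ [b]) \<Longrightarrow> 1 \<le> T \<Longrightarrow> runs w (Out b) (e, out) s' T"
  using exec.Out by (auto simp: runs_def)

lemma runs_Seq:
  "runs w c1 s s1 T1 \<Longrightarrow> runs w c2 s1 s2 T2 \<Longrightarrow> T1 + T2 \<le> T \<Longrightarrow> runs w (Seq c1 c2) s s2 T"
  unfolding runs_def by (meson exec.Seq add_mono order_trans)

lemma runs_If:
  assumes "holds w b s \<Longrightarrow> runs w c1 s s' T" "\<not> holds w b s \<Longrightarrow> runs w c2 s s' T" "T + 2 \<le> T'"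
  shows "runs w (If_Else b c1 c2) s s' T'"
proof (cases "holds w b s")
  case True
  then obtain t where "t \<le> T" "exec w c1 s t s'" using assms(1) by (auto simp: runs_def)
  then show ?thesis
    using exec.If_True[OF True, of c1 t s' c2] assms(3) by (auto simp: runs_def intro!: exI[of _ "Suc t + 1"])
next
  case False
  then obtain t where "t \<le> T" "exec w c2 s t s'" using assms(2) by (auto simp: runs_def)
  then show ?thesis
    using exec.If_False[OF False, of c2 t s' c1] assms(3) by (auto simp: runs_def intro!: exI[of _ "Suc t"])
qed

lemma runs_While_False: "\<not> holds w b s \<Longrightarrow> 1 \<le> T \<Longrightarrow> runs w (While b c) s s T"
  using exec.While_False[of w b s c] by (auto simp: runs_def)

lemma runs_While_True:
  assumes "holds w b s" "runs w c s s1 T1" "runs w (While b c) s1 s2 T2" "T1 + 2 + T2 \<le> T"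
  shows "runs w (While b c) s s2 T"
proof -
  obtain t1 t2 where "t1 \<le> T1" "exec w c s t1 s1" "t2 \<le> T2" "exec w (While b c) s1 t2 s2"
    using assms(2,3) by (auto simp: runs_def)
  then show ?thesis
    using exec.While_True[OF assms(1), of c t1 s1 t2 s2] assms(4)
    by (auto simp: runs_def intro!: exI[of _ "Suc t1 + 1 + t2"])
qed

text \<open>\<open>\<sigma> i\<close> is the store when \<open>i\<close> rounds remain. Giving it
  explicitly replaces an invariant. Each round costs two steps besides the body, for the test and
  for the jump back.\<close>

lemma runs_loop:
  assumes "\<And>i. i < n \<Longrightarrow> runs w c (\<sigma> (Suc i)) (\<sigma> i) T"
    and "\<And>i. i \<le> n \<Longrightarrow> holds w b (\<sigma> i) \<longleftrightarrow> i \<noteq> 0"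
  shows "runs w (While b c) (\<sigma> n) (\<sigma> 0) (n * (T + 2) + 1)"
  using assms
proof (induction n)
  case 0
  then show ?case by (intro runs_While_False) auto
next
  case (Suc n)
  show ?case
    by (rule runs_While_True[OF _ Suc.prems(1) Suc.IH]) (use Suc.prems in auto)
qed

section \<open>Arithmetic by counting loops\<close>

definition clear :: "nat \<Rightarrow> com" where
  "clear a = While (NZ a) (Dec a)"

definition transfer :: "nat \<Rightarrow> nat \<Rightarrow> com" where
  "transfer a b = While (NZ a) (Seq (Dec a) (Inc b))"

text \<open>Reading a register by counting it down destroys it, so a second copy is built in
  register \<open>Suc d\<close> and moved back.\<close>

definition copy :: "nat \<Rightarrow> nat \<Rightarrow> com" where
  "copy a d = Seq (While (NZ a) (Seq (Dec a) (Seq (Inc d) (Inc (Suc d))))) (transfer (Suc d) a)"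

lemma runs_clear:
  assumes "s' = (e(a := 0), out)" "3 * e a + 1 \<le> T"
  shows "runs w (clear a) (e, out) s' T"
proof -
  have "runs w (clear a) (e(a := e a), out) (e(a := 0), out) (e a * (1 + 2) + 1)"
    unfolding clear_def by (rule runs_loop[where \<sigma> = "\<lambda>i. (e(a := i), out)"]) (auto intro!: runs_Dec)
  then show ?thesis
    using assms by (auto elim: runs_mono)
qed

lemma runs_transfer:
  assumes "a \<noteq> b" "s' = (e(a := 0, b := e b + e a), out)" "4 * e a + 1 \<le> T"
  shows "runs w (transfer a b) (e, out) s' T"
proof -
  let ?s = "\<lambda>i. (e(a := i, b := e b + (e a - i)), out)"
  have "runs w (transfer a b) (?s (e a)) (?s 0) (e a * (2 + 2) + 1)"
    unfolding transfer_def
    by (rule runs_loop[where \<sigma> = ?s])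
      (use assms(1) in \<open>auto intro!: runs_Dec runs_Inc runs_Seq[where ?T1.0 = 1 and ?T2.0 = 1] simp: fun_eq_iff\<close>)
  then show ?thesis
    using assms by (auto elim: runs_mono)
qed

lemma runs_copy:
  assumes "a < d" "e (Suc d) = 0" "s' = (e(d := e d + e a), out)" "9 * e a + 2 \<le> T"
  shows "runs w (copy a d) (e, out) s' T"
proof -
  let ?s = "\<lambda>i. (e(a := i, d := e d + (e a - i), Suc d := e a - i), out)"
  have 1: "runs w (While (NZ a) (Seq (Dec a) (Seq (Inc d) (Inc (Suc d))))) (?s (e a)) (?s 0) (e a * (3 + 2) + 1)"
    by (rule runs_loop[where \<sigma> = ?s])
      (use assms(1) in \<open>auto simp: fun_eq_iff intro!: runs_Seq[OF runs_Dec[OF refl order_refl]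
         runs_Seq[OF runs_Inc[OF refl order_refl] runs_Inc[OF _ order_refl] order_refl]]\<close>)
  have 2: "runs w (transfer (Suc d) a) (?s 0) (e(d := e d + e a), out) (4 * e a + 1)"
    by (rule runs_transfer) (use assms(1,2) in \<open>auto simp: fun_eq_iff\<close>)
  have "?s (e a) = (e, out)"
    using assms(1,2) by (auto simp: fun_eq_iff)
  then show ?thesis
    unfolding copy_def using runs_Seq[OF 1 2 order_refl] assms(3,4) by (auto elim: runs_mono)
qed

section \<open>Polynomial time bounds\<close>

definition poly_bounded :: "(nat \<Rightarrow> nat) \<Rightarrow> bool" where
  "poly_bounded f \<longleftrightarrow> mono f \<and> (\<exists>p :: nat poly. \<forall>n. f n \<le> poly p n)"

lemma poly_nat_mono: "m \<le> n \<Longrightarrow> poly p m \<le> poly p n" for p :: "nat poly"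
  by (induction p) (auto intro: mult_mono)

lemma poly_bounded_const: "poly_bounded (\<lambda>n. c)"
  by (auto simp: poly_bounded_def mono_def intro!: exI[of _ "[:c:]"])

lemma poly_bounded_id: "poly_bounded (\<lambda>n. n)"
  by (auto simp: poly_bounded_def mono_def intro!: exI[of _ "[:0, 1:]"])

lemma poly_bounded_add:
  assumes "poly_bounded f" "poly_bounded g"
  shows "poly_bounded (\<lambda>n. f n + g n)"
proof -
  obtain p q :: "nat poly" where "\<forall>n. f n \<le> poly p n" "\<forall>n. g n \<le> poly q n"
    using assms by (auto simp: poly_bounded_def)
  then show ?thesis
    using assms by (auto simp: poly_bounded_def mono_def add_mono intro!: exI[of _ "p + q"])
qed

lemma poly_bounded_mult:
  assumes "poly_bounded f" "poly_bounded g"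
  shows "poly_bounded (\<lambda>n. f n * g n)"
proof -
  obtain p q :: "nat poly" where "\<forall>n. f n \<le> poly p n" "\<forall>n. g n \<le> poly q n"
    using assms by (auto simp: poly_bounded_def)
  then show ?thesis
    using assms by (auto simp: poly_bounded_def mono_def mult_mono intro!: exI[of _ "p * q"])
qed

lemma poly_bounded_compose:
  assumes "poly_bounded f" "poly_bounded g"
  shows "poly_bounded (\<lambda>n. f (g n))"
proof -
  obtain p q :: "nat poly" where pq: "\<forall>n. f n \<le> poly p n" "\<forall>n. g n \<le> poly q n"
    using assms by (auto simp: poly_bounded_def)
  have "f (g n) \<le> poly (pcompose p q) n" for n
  proof -
    have "f (g n) \<le> poly p (g n)" using pq by blast
    also have "\<dots> \<le> poly p (poly q n)" using pq by (intro poly_nat_mono) blast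
    finally show ?thesis by (simp add: poly_pcompose)
  qed
  then show ?thesis
    using assms by (auto simp: poly_bounded_def mono_def)
qed

lemmas poly_bounded_intros = poly_bounded_const poly_bounded_id poly_bounded_add poly_bounded_mult

lemma val_poly_bounded:
  "\<exists>V. poly_bounded V \<and> (\<forall>e M. (\<forall>r. e r \<le> M) \<longrightarrow> val t e \<le> V M)"
proof (induction t)
  case (Var i)
  then show ?case by (auto intro!: exI[of _ "\<lambda>n. n"] poly_bounded_intros)
next
  case (Const c)
  then show ?case by (auto intro!: exI[of _ "\<lambda>n. c"] poly_bounded_intros)
next
  case (Add t u)
  then obtain V W where "poly_bounded V" "poly_bounded W" "\<forall>e M. (\<forall>r. e r \<le> M) \<longrightarrow> val t e \<le> V M"
    "\<forall>e M. (\<forall>r. e r \<le> M) \<longrightarrow> val u e \<le> W M" by blast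
  then show ?case
    by (intro exI[of _ "\<lambda>n. V n + W n"]) (auto intro!: poly_bounded_intros add_mono)
next
  case (Mult t u)
  then obtain V W where "poly_bounded V" "poly_bounded W" "\<forall>e M. (\<forall>r. e r \<le> M) \<longrightarrow> val t e \<le> V M"
    "\<forall>e M. (\<forall>r. e r \<le> M) \<longrightarrow> val u e \<le> W M" by blast
  then show ?case
    by (intro exI[of _ "\<lambda>n. V n * W n"]) (auto intro!: poly_bounded_intros mult_mono)
qed

section \<open>Evaluation of terms\<close>

text \<open>The base case clears a register that is 0 already: it stands for a command without
  effect.\<close>

fun add_const :: "nat \<Rightarrow> nat \<Rightarrow> com" where
  "add_const d 0 = clear (Suc d)"
| "add_const d (Suc c) = Seq (add_const d c) (Inc d)"

lemma runs_add_const: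
  "e (Suc d) = 0 \<Longrightarrow> runs w (add_const d c) (e, out) (e(d := e d + c), out) (c + 1)"
proof (induction c)
  case 0
  then show ?case by (auto intro!: runs_clear simp: fun_eq_iff)
next
  case (Suc c)
  have "runs w (Inc d) (e(d := e d + c), out) (e(d := e d + Suc c), out) 1"
    by (rule runs_Inc) auto
  then show ?case
    unfolding add_const.simps by (rule runs_Seq[OF Suc.IH[OF Suc.prems]]) simp
qed

text \<open>The value is left in register \<open>d\<close>. In a product, \<open>d\<close> counts
  the rounds, each of which adds register \<open>Suc d\<close> to register
  \<open>Suc (Suc d)\<close>.\<close>

fun term_code :: "nat \<Rightarrow> trm \<Rightarrow> com" where
  "term_code d (Var i) = copy i d"
| "term_code d (Const c) = add_const d c"
| "term_code d (Add t u) = Seq (term_code d t) (Seq (term_code (Suc d) u) (transfer (Suc d) d))"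
| "term_code d (Mult t u) = Seq (term_code d t) (Seq (term_code (Suc d) u)
     (Seq (While (NZ d) (Seq (Dec d) (copy (Suc d) (Suc (Suc d)))))
       (Seq (clear (Suc d)) (transfer (Suc (Suc d)) d))))"

text \<open>The bound depends only on the largest register content \<open>M\<close>. This form
  survives nesting: code that runs after a value has been computed is charged at
  \<open>M + V M\<close>, where \<open>V M\<close> bounds that value.\<close>

definition term_time :: "nat \<Rightarrow> com \<Rightarrow> ((nat \<Rightarrow> nat) \<Rightarrow> nat) \<Rightarrow> (nat \<Rightarrow> nat) \<Rightarrow> bool" where
  "term_time d c f T \<longleftrightarrow> poly_bounded T \<and> (\<forall>w e out M. (\<forall>r\<ge>d. e r = 0) \<longrightarrow> (\<forall>r. e r \<le> M) \<longrightarrow>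
     runs w c (e, out) (e(d := f e), out) (T M))"

lemma term_timeI:
  assumes "\<And>w e out M. \<forall>r\<ge>d. e r = 0 \<Longrightarrow> \<forall>r. e r \<le> M \<Longrightarrow>
      runs w c (e, out) (e(d := f e), out) (T M)"
    and "poly_bounded T"
  shows "\<exists>T. term_time d c f T"
  using assms unfolding term_time_def by blast

lemma term_timeD:
  assumes "term_time d c f T"
  shows "poly_bounded T"
    and "\<And>w e out M. \<forall>r\<ge>d. e r = 0 \<Longrightarrow> \<forall>r. e r \<le> M \<Longrightarrow>
      runs w c (e, out) (e(d := f e), out) (T M)"
  using assms unfolding term_time_def by blast+

lemma runs_term_code:
  assumes "below d t"
  shows "\<exists>T. term_time d (term_code d t) (val t) T"
  using assms
proof (induction t arbitrary: d)
  case (Var i)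
  have "poly_bounded (\<lambda>n. 9 * n + 2)"
    by (intro poly_bounded_intros)
  with Var show ?case
    by (intro term_timeI[where T = "\<lambda>n. 9 * n + 2"]) (auto intro!: runs_copy)
next
  case (Const c)
  have "runs w (term_code d (Const c)) (e, out) (e(d := val (Const c) e), out) (c + 1)"
    if "\<forall>r\<ge>d. e r = 0" for w e out
    using runs_add_const[of e d w c out] that by simp
  then show ?case
    by (rule term_timeI[where T = "\<lambda>_. c + 1"]) (auto intro: poly_bounded_const)
next
  case (Add t u)
  obtain T1 where "term_time d (term_code d t) (val t) T1"
    using Add.IH(1)[of d] Add.prems by auto
  note T1 = term_timeD[OF this]
  obtain T2 where "term_time (Suc d) (term_code (Suc d) u) (val u) T2"
    using Add.IH(2)[of "Suc d"] Add.prems below_mono[of d u "Suc d"] by auto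
  note T2 = term_timeD[OF this]
  obtain V where V: "poly_bounded V" "\<And>e M. \<forall>r. e r \<le> M \<Longrightarrow> val t e \<le> V M"
    using val_poly_bounded by blast
  obtain W where W: "poly_bounded W" "\<And>e M. \<forall>r. e r \<le> M \<Longrightarrow> val u e \<le> W M"
    using val_poly_bounded by blast
  let ?T = "\<lambda>M. T1 M + (T2 (M + V M) + (4 * W M + 1))"
  have "runs w (term_code d (Add t u)) (e, out) (e(d := val (Add t u) e), out) (?T M)"
    if e: "\<forall>r\<ge>d. e r = 0" "\<forall>r. e r \<le> M" for w e out M
  proof -
    have u: "val u (e(d := val t e)) = val u e"
      using Add.prems by (intro val_cong[where d = d]) auto
    have "runs w (term_code (Suc d) u) (e(d := val t e), out)
        (e(d := val t e, Suc d := val u e), out) (T2 (M + V M))"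
      using T2(2)[of "e(d := val t e)" "M + V M" w out] e V(2)[OF e(2)] u
      by (auto simp: trans_le_add1 trans_le_add2)
    moreover have "runs w (transfer (Suc d) d) (e(d := val t e, Suc d := val u e), out)
        (e(d := val (Add t u) e), out) (4 * W M + 1)"
      using e W(2)[OF e(2)] by (intro runs_transfer) (auto simp: fun_eq_iff)
    ultimately show ?thesis
      unfolding term_code.simps by (intro runs_Seq[OF T1(2)] runs_Seq) (use e in auto)
  qed
  moreover have "poly_bounded ?T"
    by (intro poly_bounded_intros poly_bounded_compose[OF T2(1), where g = "\<lambda>M. M + V M"] T1(1) V(1) W(1))
  ultimately show ?case by (rule term_timeI)
next
  case (Mult t u)
  obtain T1 where "term_time d (term_code d t) (val t) T1"
    using Mult.IH(1)[of d] Mult.prems by auto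
  note T1 = term_timeD[OF this]
  obtain T2 where "term_time (Suc d) (term_code (Suc d) u) (val u) T2"
    using Mult.IH(2)[of "Suc d"] Mult.prems below_mono[of d u "Suc d"] by auto
  note T2 = term_timeD[OF this]
  obtain V where V: "poly_bounded V" "\<And>e M. \<forall>r. e r \<le> M \<Longrightarrow> val t e \<le> V M"
    using val_poly_bounded by blast
  obtain W where W: "poly_bounded W" "\<And>e M. \<forall>r. e r \<le> M \<Longrightarrow> val u e \<le> W M"
    using val_poly_bounded by blast
  let ?T = "\<lambda>M. T1 M + (T2 (M + V M) + (V M * (1 + (9 * W M + 2) + 2) + 1 +
    ((3 * W M + 1) + (4 * (V M * W M) + 1))))"
  have "runs w (term_code d (Mult t u)) (e, out) (e(d := val (Mult t u) e), out) (?T M)"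
    if e: "\<forall>r\<ge>d. e r = 0" "\<forall>r. e r \<le> M" for w e out M
  proof -
    have u: "val u (e(d := val t e)) = val u e"
      using Mult.prems by (intro val_cong[where d = d]) auto
    have vt: "val t e \<le> V M" and vu: "val u e \<le> W M"
      using V(2)[OF e(2)] W(2)[OF e(2)] .
    have 2: "runs w (term_code (Suc d) u) (e(d := val t e), out)
        (e(d := val t e, Suc d := val u e), out) (T2 (M + V M))"
      using T2(2)[of "e(d := val t e)" "M + V M" w out] e vt u
      by (auto simp: trans_le_add1 trans_le_add2)
    let ?s = "\<lambda>i. (e(d := i, Suc d := val u e, Suc (Suc d) := (val t e - i) * val u e), out)"
    have "runs w (While (NZ d) (Seq (Dec d) (copy (Suc d) (Suc (Suc d))))) (?s (val t e)) (?s 0)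
        (val t e * (1 + (9 * W M + 2) + 2) + 1)"
    proof (rule runs_loop)
      fix i assume i: "i < val t e"
      show "runs w (Seq (Dec d) (copy (Suc d) (Suc (Suc d)))) (?s (Suc i)) (?s i) (1 + (9 * W M + 2))"
      proof (rule runs_Seq[OF runs_Dec runs_copy order_refl])
        have "(val t e - i) * val u e = (val t e - Suc i) * val u e + val u e"
          using i by (metis Suc_diff_Suc add.commute mult_Suc)
        then show "?s i = ((e(d := Suc i, Suc d := val u e, Suc (Suc d) := (val t e - Suc i) * val u e, d := i))
          (Suc (Suc d) := (e(d := Suc i, Suc d := val u e, Suc (Suc d) := (val t e - Suc i) * val u e, d := i)) (Suc (Suc d))
           + (e(d := Suc i, Suc d := val u e, Suc (Suc d) := (val t e - Suc i) * val u e, d := i)) (Suc d)), out)"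
          by (auto simp: fun_eq_iff)
      qed (use e vu in \<open>auto simp: fun_eq_iff\<close>)
    qed auto
    moreover have "?s (val t e) = (e(d := val t e, Suc d := val u e), out)"
      using e by (auto simp: fun_eq_iff)
    moreover have "val t e * (1 + (9 * W M + 2) + 2) + 1 \<le> V M * (1 + (9 * W M + 2) + 2) + 1"
      using vt by (intro add_mono mult_le_mono1 order_refl)
    ultimately have 3: "runs w (While (NZ d) (Seq (Dec d) (copy (Suc d) (Suc (Suc d)))))
        (e(d := val t e, Suc d := val u e), out) (?s 0) (V M * (1 + (9 * W M + 2) + 2) + 1)"
      by (simp only: runs_mono)
    have 4: "runs w (clear (Suc d)) (?s 0) (e(d := 0, Suc (Suc d) := val t e * val u e), out) (3 * W M + 1)"
      using vu e by (intro runs_clear) (auto simp: fun_eq_iff)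
    have 5: "runs w (transfer (Suc (Suc d)) d) (e(d := 0, Suc (Suc d) := val t e * val u e), out)
        (e(d := val (Mult t u) e), out) (4 * (V M * W M) + 1)"
      using e vt vu by (intro runs_transfer) (auto simp: fun_eq_iff mult_le_mono)
    show ?thesis
      unfolding term_code.simps
      by (intro runs_Seq[OF T1(2)] runs_Seq[OF 2] runs_Seq[OF 3] runs_Seq[OF 4 5]) (use e in auto)
  qed
  moreover have "poly_bounded ?T"
    by (intro poly_bounded_intros poly_bounded_compose[OF T2(1), where g = "\<lambda>M. M + V M"] T1(1) V(1) W(1))
  ultimately show ?case by (rule term_timeI)
qed

section \<open>Evaluation of formulas\<close>

text \<open>\<open>Less t u\<close> holds iff truncated subtraction of \<open>t\<close> from
  \<open>u\<close> leaves something in register \<open>d\<close>. For \<open>Bit\<close>, the value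
  is moved to register 0, which moves the input head, and register 0 is reset afterwards. The loop
  of \<open>Ex\<close> counts down and is ended by clearing its counter once a witness is found; its
  \<open>clear 1\<close> acts on a flag that is 0 and does nothing.\<close>

fun fml_code :: "nat \<Rightarrow> fml \<Rightarrow> com" where
  "fml_code d (Less t u) = Seq (term_code d u) (Seq (term_code (Suc d) t)
     (Seq (While (NZ (Suc d)) (Seq (Dec (Suc d)) (Dec d)))
       (If_Else (NZ d) (Seq (Inc 1) (clear d)) (clear d))))"
| "fml_code d (Bit t) = Seq (term_code d t) (Seq (transfer d 0)
     (Seq (If_Else Bit_True (Inc 1) (clear 1)) (clear 0)))"
| "fml_code d (Neg \<phi>) = Seq (fml_code d \<phi>) (If_Else (NZ 1) (Dec 1) (Inc 1))"
| "fml_code d (Conj \<phi> \<psi>) = Seq (fml_code d \<phi>)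
     (If_Else (NZ 1) (Seq (Dec 1) (fml_code d \<psi>)) (clear 1))"
| "fml_code d (Ex x t \<phi>) = Seq (term_code x t)
     (While (NZ x) (Seq (Dec x) (Seq (fml_code (Suc x) \<phi>) (If_Else (NZ 1) (clear x) (clear 1)))))"

definition fml_time ::
    "nat \<Rightarrow> com \<Rightarrow> (bool list \<Rightarrow> (nat \<Rightarrow> nat) \<Rightarrow> bool) \<Rightarrow> (nat \<Rightarrow> nat) \<Rightarrow> bool" where
  "fml_time d c P T \<longleftrightarrow> poly_bounded T \<and> (\<forall>w e out M. (\<forall>r\<ge>d. e r = 0) \<longrightarrow> e 0 = 0 \<longrightarrow> e 1 = 0 \<longrightarrow>
     (\<forall>r. e r \<le> M) \<longrightarrow> runs w c (e, out) (e(1 := of_bool (P w e)), out) (T M))"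

lemma fml_timeI:
  assumes "\<And>w e out M. \<forall>r\<ge>d. e r = 0 \<Longrightarrow> e 0 = 0 \<Longrightarrow> e 1 = 0 \<Longrightarrow> \<forall>r. e r \<le> M \<Longrightarrow>
      runs w c (e, out) (e(1 := of_bool (P w e)), out) (T M)"
    and "poly_bounded T"
  shows "\<exists>T. fml_time d c P T"
  using assms unfolding fml_time_def by blast

lemma fml_timeD:
  assumes "fml_time d c P T"
  shows "poly_bounded T"
    and "\<And>w e out M. \<forall>r\<ge>d. e r = 0 \<Longrightarrow> e 0 = 0 \<Longrightarrow> e 1 = 0 \<Longrightarrow> \<forall>r. e r \<le> M \<Longrightarrow>
      runs w c (e, out) (e(1 := of_bool (P w e)), out) (T M)"
  using assms unfolding fml_time_def by blast+

lemma runs_fml_code: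
  assumes "scoped d \<phi>" "2 \<le> d"
  shows "\<exists>T. fml_time d (fml_code d \<phi>) (eval \<phi>) T"
  using assms
proof (induction \<phi> arbitrary: d)
  case (Less t u)
  obtain T1 where "term_time d (term_code d u) (val u) T1"
    using runs_term_code[of d u] Less.prems by auto
  note T1 = term_timeD[OF this]
  obtain T2 where "term_time (Suc d) (term_code (Suc d) t) (val t) T2"
    using runs_term_code[of "Suc d" t] Less.prems below_mono[of d t "Suc d"] by auto
  note T2 = term_timeD[OF this]
  obtain V where V: "poly_bounded V" "\<And>e M. \<forall>r. e r \<le> M \<Longrightarrow> val t e \<le> V M"
    using val_poly_bounded by blast
  obtain W where W: "poly_bounded W" "\<And>e M. \<forall>r. e r \<le> M \<Longrightarrow> val u e \<le> W M"
    using val_poly_bounded by blast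
  let ?T = "\<lambda>M. T1 M + (T2 (M + W M) + ((V M * (2 + 2) + 1) + (3 * W M + 4)))"
  have "runs w (fml_code d (Less t u)) (e, out) (e(1 := of_bool (eval (Less t u) w e)), out) (?T M)"
    if e: "\<forall>r\<ge>d. e r = 0" "e 0 = 0" "e 1 = 0" "\<forall>r. e r \<le> M" for w e out M
  proof -
    have t: "val t (e(d := val u e)) = val t e"
      using Less.prems by (intro val_cong[where d = d]) auto
    have vt: "val t e \<le> V M" and vu: "val u e \<le> W M"
      using V(2)[OF e(4)] W(2)[OF e(4)] .
    have 2: "runs w (term_code (Suc d) t) (e(d := val u e), out)
        (e(d := val u e, Suc d := val t e), out) (T2 (M + W M))"
      using T2(2)[of "e(d := val u e)" "M + W M" w out] e vu t
      by (auto simp: trans_le_add1 trans_le_add2)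
    let ?s = "\<lambda>i. (e(d := val u e - (val t e - i), Suc d := i), out)"
    have "runs w (While (NZ (Suc d)) (Seq (Dec (Suc d)) (Dec d))) (?s (val t e)) (?s 0) (val t e * (2 + 2) + 1)"
      by (rule runs_loop)
        (auto intro!: runs_Dec runs_Seq[where ?T1.0 = 1 and ?T2.0 = 1] simp: fun_eq_iff)
    then have 3: "runs w (While (NZ (Suc d)) (Seq (Dec (Suc d)) (Dec d)))
        (e(d := val u e, Suc d := val t e), out) (?s 0) (V M * (2 + 2) + 1)"
      using vt by (auto elim!: runs_mono intro: mult_le_mono1)
    have 4: "runs w (If_Else (NZ d) (Seq (Inc 1) (clear d)) (clear d)) (?s 0)
        (e(1 := of_bool (eval (Less t u) w e)), out) (3 * W M + 4)"
      using vu e Less.prems(2)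
      by (intro runs_If[where T = "3 * W M + 2"] runs_clear runs_Seq[OF runs_Inc[OF refl order_refl] runs_clear[OF _ order_refl]])
         (auto simp: fun_eq_iff)
    show ?thesis
      unfolding fml_code.simps
      by (intro runs_Seq[OF T1(2)] runs_Seq[OF 2] runs_Seq[OF 3 4]) (use e in auto)
  qed
  moreover have "poly_bounded ?T"
    by (intro poly_bounded_intros poly_bounded_compose[OF T2(1), where g = "\<lambda>M. M + W M"] T1(1) V(1) W(1))
  ultimately show ?case by (rule fml_timeI)
next
  case (Bit t)
  obtain T1 where "term_time d (term_code d t) (val t) T1"
    using runs_term_code[of d t] Bit.prems by auto
  note T1 = term_timeD[OF this]
  obtain V where V: "poly_bounded V" "\<And>e M. \<forall>r. e r \<le> M \<Longrightarrow> val t e \<le> V M"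
    using val_poly_bounded by blast
  let ?T = "\<lambda>M. T1 M + ((4 * V M + 1) + (3 + (3 * V M + 1)))"
  have "runs w (fml_code d (Bit t)) (e, out) (e(1 := of_bool (eval (Bit t) w e)), out) (?T M)"
    if e: "\<forall>r\<ge>d. e r = 0" "e 0 = 0" "e 1 = 0" "\<forall>r. e r \<le> M" for w e out M
  proof -
    have vt: "val t e \<le> V M"
      using V(2)[OF e(4)] .
    have 2: "runs w (transfer d 0) (e(d := val t e), out) (e(0 := val t e), out) (4 * V M + 1)"
      using vt e Bit.prems(2) by (intro runs_transfer) (auto simp: fun_eq_iff)
    have 3: "runs w (If_Else Bit_True (Inc 1) (clear 1)) (e(0 := val t e), out)
        (e(0 := val t e, 1 := of_bool (eval (Bit t) w e)), out) 3"
      using e by (intro runs_If[where T = 1] runs_Inc runs_clear) (auto simp: fun_eq_iff)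
    have 4: "runs w (clear 0) (e(0 := val t e, 1 := of_bool (eval (Bit t) w e)), out)
        (e(1 := of_bool (eval (Bit t) w e)), out) (3 * V M + 1)"
      using e vt by (intro runs_clear) (auto simp: fun_eq_iff)
    show ?thesis
      unfolding fml_code.simps
      by (intro runs_Seq[OF T1(2)] runs_Seq[OF 2] runs_Seq[OF 3 4]) (use e in auto)
  qed
  moreover have "poly_bounded ?T"
    by (intro poly_bounded_intros T1(1) V(1))
  ultimately show ?case by (rule fml_timeI)
next
  case (Neg \<phi>)
  obtain T1 where "fml_time d (fml_code d \<phi>) (eval \<phi>) T1"
    using Neg.IH[of d] Neg.prems by auto
  note T1 = fml_timeD[OF this]
  have "runs w (fml_code d (Neg \<phi>)) (e, out) (e(1 := of_bool (eval (Neg \<phi>) w e)), out) (T1 M + 3)"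
    if e: "\<forall>r\<ge>d. e r = 0" "e 0 = 0" "e 1 = 0" "\<forall>r. e r \<le> M" for w e out M
    unfolding fml_code.simps
    by (intro runs_Seq[OF T1(2)[OF e]] runs_If[where T = 1] runs_Dec runs_Inc) (auto simp: fun_eq_iff)
  moreover have "poly_bounded (\<lambda>M. T1 M + 3)"
    by (intro poly_bounded_intros T1(1))
  ultimately show ?case by (rule fml_timeI)
next
  case (Conj \<phi> \<psi>)
  obtain T1 where "fml_time d (fml_code d \<phi>) (eval \<phi>) T1"
    using Conj.IH(1)[of d] Conj.prems by auto
  note T1 = fml_timeD[OF this]
  obtain T2 where "fml_time d (fml_code d \<psi>) (eval \<psi>) T2"
    using Conj.IH(2)[of d] Conj.prems by auto
  note T2 = fml_timeD[OF this]
  have "runs w (fml_code d (Conj \<phi> \<psi>)) (e, out) (e(1 := of_bool (eval (Conj \<phi> \<psi>) w e)), out)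
      (T1 M + (T2 M + 3))"
    if e: "\<forall>r\<ge>d. e r = 0" "e 0 = 0" "e 1 = 0" "\<forall>r. e r \<le> M" for w e out M
  proof -
    have "runs w (If_Else (NZ 1) (Seq (Dec 1) (fml_code d \<psi>)) (clear 1))
        (e(1 := of_bool (eval \<phi> w e)), out) (e(1 := of_bool (eval (Conj \<phi> \<psi>) w e)), out) (T2 M + 3)"
    proof (rule runs_If)
      assume h: "holds w (NZ 1) (e(1 := of_bool (eval \<phi> w e)), out)"
      have "runs w (Dec 1) (e(1 := of_bool (eval \<phi> w e)), out) (e, out) 1"
        by (rule runs_Dec) (use h e in \<open>auto simp: fun_eq_iff\<close>)
      then show "runs w (Seq (Dec 1) (fml_code d \<psi>)) (e(1 := of_bool (eval \<phi> w e)), out)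
          (e(1 := of_bool (eval (Conj \<phi> \<psi>) w e)), out) (T2 M + 1)"
        using runs_Seq[OF _ T2(2)[OF e]] h by (auto split: if_splits)
    next
      assume "\<not> holds w (NZ 1) (e(1 := of_bool (eval \<phi> w e)), out)"
      then show "runs w (clear 1) (e(1 := of_bool (eval \<phi> w e)), out)
          (e(1 := of_bool (eval (Conj \<phi> \<psi>) w e)), out) (T2 M + 1)"
        by (intro runs_clear) (auto simp: fun_eq_iff)
    qed simp
    then show ?thesis
      unfolding fml_code.simps using runs_Seq[OF T1(2)[OF e]] by blast
  qed
  moreover have "poly_bounded (\<lambda>M. T1 M + (T2 M + 3))"
    by (intro poly_bounded_intros T1(1) T2(1))
  ultimately show ?case by (rule fml_timeI)
next
  case (Ex x t \<phi>)
  have x: "2 \<le> x" "d \<le> x" "below x t" "scoped (Suc x) \<phi>"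
    using Ex.prems by (auto intro: below_mono)
  obtain T1 where "term_time x (term_code x t) (val t) T1"
    using runs_term_code[OF x(3)] by auto
  note T1 = term_timeD[OF this]
  obtain T2 where "fml_time (Suc x) (fml_code (Suc x) \<phi>) (eval \<phi>) T2"
    using Ex.IH[OF x(4)] x(1) by auto
  note T2 = fml_timeD[OF this]
  obtain V where V: "poly_bounded V" "\<And>e M. \<forall>r. e r \<le> M \<Longrightarrow> val t e \<le> V M"
    using val_poly_bounded by blast
  let ?T = "\<lambda>M. T1 M + (V M * (T2 (M + V M) + 10) + 1)"
  let ?c = "Seq (Dec x) (Seq (fml_code (Suc x) \<phi>) (If_Else (NZ 1) (clear x) (clear 1)))"
  have "runs w (fml_code d (Ex x t \<phi>)) (e, out) (e(1 := of_bool (eval (Ex x t \<phi>) w e)), out) (?T M)"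
    if e: "\<forall>r\<ge>d. e r = 0" "e 0 = 0" "e 1 = 0" "\<forall>r. e r \<le> M" for w e out M
  proof -
    have vt: "val t e \<le> V M"
      using V(2)[OF e(4)] .
    have loop: "runs w (While (NZ x) ?c) (e(x := n), out)
        (e(1 := of_bool (\<exists>v<n. eval \<phi> w (e(x := v)))), out) (n * (T2 (M + V M) + 10) + 1)"
      if "n \<le> V M" for n
      using that
    proof (induction n)
      case 0
      have "e(x := 0) = e" "e(1 := 0) = e"
        using e x by (auto simp: fun_eq_iff)
      then show ?case
        using x e by (auto intro!: runs_While_False)
    next
      case (Suc n)
      let ?b = "eval \<phi> w (e(x := n))"
      have 1: "runs w (Dec x) (e(x := Suc n), out) (e(x := n), out) 1"
        by (rule runs_Dec) auto
      have 2: "runs w (fml_code (Suc x) \<phi>) (e(x := n), out) (e(x := n, 1 := of_bool ?b), out) (T2 (M + V M))"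
        using e x Suc.prems by (intro T2(2)) (auto simp: trans_le_add1 trans_le_add2)
      show ?case
      proof (cases ?b)
        case True
        \<comment> \<open>Clearing the counter takes \<open>3 * n + 1\<close> steps; the time
          allotted to the \<open>n\<close> rounds that are now skipped pays for this.\<close>
        have 3: "runs w (If_Else (NZ 1) (clear x) (clear 1)) (e(x := n, 1 := of_bool ?b), out)
            (e(1 := 1), out) (3 * n + 3)"
          using True e x by (intro runs_If[where T = "3 * n + 1"] runs_clear) (auto simp: fun_eq_iff)
        have "runs w (While (NZ x) ?c) (e(1 := 1), out) (e(1 := 1), out) 1"
          using e x by (intro runs_While_False) auto
        then have "runs w (While (NZ x) ?c) (e(x := Suc n), out) (e(1 := 1), out)
            (Suc n * (T2 (M + V M) + 10) + 1)"
          by (intro runs_While_True[OF _ runs_Seq[OF 1 runs_Seq[OF 2 3 order_refl] order_refl]]) (auto simp: distrib_left)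
        moreover have "of_bool (\<exists>v<Suc n. eval \<phi> w (e(x := v))) = (1 :: nat)"
          using True by auto
        ultimately show ?thesis by (simp only:)
      next
        case False
        have 3: "runs w (If_Else (NZ 1) (clear x) (clear 1)) (e(x := n, 1 := of_bool ?b), out)
            (e(x := n), out) 3"
          using False e x by (intro runs_If[where T = 1] runs_clear) (auto simp: fun_eq_iff)
        have "runs w (While (NZ x) ?c) (e(x := Suc n), out)
            (e(1 := of_bool (\<exists>v<n. eval \<phi> w (e(x := v)))), out) (Suc n * (T2 (M + V M) + 10) + 1)"
          using Suc by (intro runs_While_True[OF _ runs_Seq[OF 1 runs_Seq[OF 2 3 order_refl] order_refl] Suc.IH]) auto
        moreover have "(\<exists>v<Suc n. eval \<phi> w (e(x := v))) \<longleftrightarrow> (\<exists>v<n. eval \<phi> w (e(x := v)))"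
          using False by (auto simp: less_Suc_eq)
        ultimately show ?thesis by (simp only:)
      qed
    qed
    show ?thesis
      unfolding fml_code.simps eval.simps
      using vt by (intro runs_Seq[OF T1(2) loop[OF vt]]) (use e x in auto)
  qed
  moreover have "poly_bounded ?T"
    by (intro poly_bounded_intros poly_bounded_compose[OF T2(1), where g = "\<lambda>M. M + V M"] T1(1) V(1))
  ultimately show ?case by (rule fml_timeI)
qed


section \<open>Polynomial-time output of definable bits\<close>

text \<open>Before any quantifier or output loop, the only variable with a value is 2, the length of
  the word. All other quantities of a formula have to be introduced by bounded loops.\<close>

definition input_env :: "bool list \<Rightarrow> nat \<Rightarrow> nat" where
  "input_env w = (\<lambda>_. 0)(2 := length w)"

definition measure_input :: com where
  "measure_input = Seq (While Nonblank (Seq (Inc 0) (Inc 2))) (clear 0)"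

lemma runs_measure_input:
  "runs w measure_input (\<lambda>_. 0, out) (input_env w, out) (7 * length w + 2)"
proof -
  let ?s = "\<lambda>i. ((\<lambda>_. 0)(0 := length w - i, 2 := length w - i), out)"
  have 1: "runs w (While Nonblank (Seq (Inc 0) (Inc 2))) (?s (length w)) (?s 0) (length w * (2 + 2) + 1)"
    by (rule runs_loop) (auto simp: fun_eq_iff
        intro!: runs_Seq[OF runs_Inc[OF refl order_refl] runs_Inc[OF _ order_refl]])
  have s: "?s (length w) = (\<lambda>_. 0, out)"
    by (auto simp: fun_eq_iff)
  have 2: "runs w (clear 0) (?s 0) (input_env w, out) (3 * length w + 1)"
    by (rule runs_clear) (auto simp: input_env_def fun_eq_iff)
  show ?thesis
    unfolding measure_input_def by (rule runs_Seq[OF 1[unfolded s] 2]) simp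
qed

lemma poly_time_computableI:
  assumes "poly_bounded T"
    and "\<And>w. \<exists>e. runs w c (input_env w, []) (e, f w) (T (length w))"
  shows "poly_time_computable f"
proof -
  obtain p :: "nat poly" where p: "\<And>n. T n \<le> poly p n"
    using assms(1) by (auto simp: poly_bounded_def)
  show ?thesis
  proof (rule poly_time_computable_exec[where c = "Seq measure_input c" and p = "[:2, 7:] + p"])
    fix w
    obtain e where "runs w c (input_env w, []) (e, f w) (T (length w))"
      using assms(2) by blast
    then have "runs w (Seq measure_input c) (\<lambda>_. 0, []) (e, f w) (7 * length w + 2 + T (length w))"
      by (rule runs_Seq[OF runs_measure_input]) simp
    then obtain t where "t \<le> 7 * length w + 2 + T (length w)"
        "exec w (Seq measure_input c) (\<lambda>_. 0, []) t (e, f w)"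
      by (auto simp: runs_def)
    then show "\<exists>t e. t \<le> poly ([:2, 7:] + p) (length w) \<and>
        exec w (Seq measure_input c) (\<lambda>_. 0, []) t (e, f w)"
      using p[of "length w"] by (intro exI[of _ t] exI[of _ e]) (auto simp: mult.commute)
  qed
qed

definition emit :: "nat \<Rightarrow> fml \<Rightarrow> com" where
  "emit d \<phi> = Seq (fml_code d \<phi>) (If_Else (NZ 1) (Seq (Dec 1) (Out True)) (Out False))"

definition out_time :: "nat \<Rightarrow> com \<Rightarrow> (bool list \<Rightarrow> (nat \<Rightarrow> nat) \<Rightarrow> bool list) \<Rightarrow> (nat \<Rightarrow> nat) \<Rightarrow> bool" where
  "out_time d c g T \<longleftrightarrow> poly_bounded T \<and> (\<forall>w e out M. (\<forall>r\<ge>d. e r = 0) \<longrightarrow> e 0 = 0 \<longrightarrow> e 1 = 0 \<longrightarrow>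
     (\<forall>r. e r \<le> M) \<longrightarrow> runs w c (e, out) (e, out @ g w e) (T M))"

lemma out_timeI:
  assumes "\<And>w e out M. \<forall>r\<ge>d. e r = 0 \<Longrightarrow> e 0 = 0 \<Longrightarrow> e 1 = 0 \<Longrightarrow> \<forall>r. e r \<le> M \<Longrightarrow>
      runs w c (e, out) (e, out @ g w e) (T M)"
    and "poly_bounded T"
  shows "\<exists>T. out_time d c g T"
  using assms unfolding out_time_def by blast

lemma out_timeD:
  assumes "out_time d c g T"
  shows "poly_bounded T"
    and "\<And>w e out M. \<forall>r\<ge>d. e r = 0 \<Longrightarrow> e 0 = 0 \<Longrightarrow> e 1 = 0 \<Longrightarrow> \<forall>r. e r \<le> M \<Longrightarrow>
      runs w c (e, out) (e, out @ g w e) (T M)"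
  using assms unfolding out_time_def by blast+

lemma out_time_Out: "\<exists>T. out_time d (Out b) (\<lambda>_ _. [b]) T"
  by (rule out_timeI[where T = "\<lambda>_. 1"]) (auto intro: runs_Out poly_bounded_const)

lemma out_time_Seq:
  assumes "\<exists>T. out_time d c1 g1 T" "\<exists>T. out_time d c2 g2 T"
  shows "\<exists>T. out_time d (Seq c1 c2) (\<lambda>w e. g1 w e @ g2 w e) T"
proof -
  obtain T1 where "out_time d c1 g1 T1" using assms(1) by blast
  note T1 = out_timeD[OF this]
  obtain T2 where "out_time d c2 g2 T2" using assms(2) by blast
  note T2 = out_timeD[OF this]
  show ?thesis
  proof (rule out_timeI[where T = "\<lambda>M. T1 M + T2 M"])
    show "runs w (Seq c1 c2) (e, out) (e, out @ g1 w e @ g2 w e) (T1 M + T2 M)"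
      if "\<forall>r\<ge>d. e r = 0" "e 0 = 0" "e 1 = 0" "\<forall>r. e r \<le> M" for w e out M
      using runs_Seq[OF T1(2)[OF that] T2(2)[OF that] order_refl] by simp
  qed (intro poly_bounded_intros T1(1) T2(1))
qed

lemma out_time_emit:
  assumes "scoped d \<phi>" "2 \<le> d"
  shows "\<exists>T. out_time d (emit d \<phi>) (\<lambda>w e. [eval \<phi> w e]) T"
proof -
  obtain T where "fml_time d (fml_code d \<phi>) (eval \<phi>) T"
    using runs_fml_code[OF assms] by blast
  note T = fml_timeD[OF this]
  show ?thesis
  proof (rule out_timeI[where T = "\<lambda>M. T M + 4"])
    show "runs w (emit d \<phi>) (e, out) (e, out @ [eval \<phi> w e]) (T M + 4)"
      if e: "\<forall>r\<ge>d. e r = 0" "e 0 = 0" "e 1 = 0" "\<forall>r. e r \<le> M" for w e out M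
      unfolding emit_def
      by (intro runs_Seq[OF T(2)[OF e]] runs_If[where T = 2] runs_Out
          runs_Seq[OF runs_Dec[OF refl order_refl] runs_Out[OF _ order_refl]])
        (use e(3) in \<open>auto simp: fun_eq_iff split: if_splits\<close>)
  qed (intro poly_bounded_intros T(1))
qed

text \<open>Since the counter runs downwards, the output appears in descending order of the index.
  The reduction compensates for this by numbering the vertices backwards.\<close>

definition for_down :: "nat \<Rightarrow> trm \<Rightarrow> com \<Rightarrow> com" where
  "for_down d t c = Seq (term_code d t) (While (NZ d) (Seq (Dec d) c))"

lemma out_time_for_down:
  assumes "below d t" "2 \<le> d" "\<exists>T. out_time (Suc d) c g T"
  shows "\<exists>T. out_time d (for_down d t c)
    (\<lambda>w e. concat (map (\<lambda>v. g w (e(d := v))) (rev [0..<val t e]))) T"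
proof -
  obtain T1 where "term_time d (term_code d t) (val t) T1"
    using runs_term_code[OF assms(1)] by blast
  note T1 = term_timeD[OF this]
  obtain T2 where "out_time (Suc d) c g T2" using assms(3) by blast
  note T2 = out_timeD[OF this]
  obtain V where V: "poly_bounded V" "\<And>e M. \<forall>r. e r \<le> M \<Longrightarrow> val t e \<le> V M"
    using val_poly_bounded by blast
  let ?T = "\<lambda>M. T1 M + (V M * (1 + T2 (M + V M) + 2) + 1)"
  show ?thesis
  proof (rule out_timeI[where T = ?T])
    fix w out M and e :: "nat \<Rightarrow> nat"
    assume e: "\<forall>r\<ge>d. e r = 0" "e 0 = 0" "e 1 = 0" "\<forall>r. e r \<le> M"
    have vt: "val t e \<le> V M"
      using V(2)[OF e(4)] .
    let ?s = "\<lambda>i. (e(d := i), out @ concat (map (\<lambda>v. g w (e(d := v))) (rev [i..<val t e])))"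
    have "runs w (While (NZ d) (Seq (Dec d) c)) (?s (val t e)) (?s 0) (val t e * (1 + T2 (M + V M) + 2) + 1)"
    proof (rule runs_loop)
      fix i assume i: "i < val t e"
      have 1: "runs w (Dec d) (?s (Suc i)) (e(d := i), snd (?s (Suc i))) 1"
        by (rule runs_Dec) auto
      have 2: "runs w c (e(d := i), snd (?s (Suc i))) (e(d := i), snd (?s (Suc i)) @ g w (e(d := i)))
          (T2 (M + V M))"
        using e i vt assms(2) by (intro T2(2)) (auto simp: trans_le_add1 trans_le_add2)
      have "[i..<val t e] = i # [Suc i..<val t e]"
        using i by (simp add: upt_rec)
      then have "?s i = (e(d := i), snd (?s (Suc i)) @ g w (e(d := i)))"
        by simp
      then show "runs w (Seq (Dec d) c) (?s (Suc i)) (?s i) (1 + T2 (M + V M))"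
        using runs_Seq[OF 1 2 order_refl] by simp
    qed auto
    moreover have "val t e * (1 + T2 (M + V M) + 2) + 1 \<le> V M * (1 + T2 (M + V M) + 2) + 1"
      using vt by (intro add_mono mult_le_mono1 order_refl)
    ultimately have 3: "runs w (While (NZ d) (Seq (Dec d) c)) (?s (val t e)) (?s 0)
        (V M * (1 + T2 (M + V M) + 2) + 1)"
      by (rule runs_mono)
    have "runs w (for_down d t c) (e, out) (?s 0) (?T M)"
      unfolding for_down_def by (rule runs_Seq[OF T1(2)[OF e(1,4)] _ order_refl]) (use 3 in simp)
    moreover have "e(d := 0) = e"
      using e(1) by (auto simp: fun_eq_iff)
    ultimately show "runs w (for_down d t c) (e, out)
        (e, out @ concat (map (\<lambda>v. g w (e(d := v))) (rev [0..<val t e]))) (?T M)"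
      by simp
  qed (intro poly_bounded_intros poly_bounded_compose[OF T2(1), where g = "\<lambda>M. M + V M"] T1(1) V(1))
qed

lemma poly_time_computable_out_time:
  assumes "\<exists>T. out_time 3 c g T"
  shows "poly_time_computable (\<lambda>w. g w (input_env w))"
proof -
  obtain T where "out_time 3 c g T"
    using assms by blast
  note T = out_timeD[OF this]
  have "runs w c (input_env w, []) (input_env w, [] @ g w (input_env w)) (T (length w))" for w
    by (rule T(2)) (auto simp: input_env_def)
  then show ?thesis
    by (intro poly_time_computableI[OF T(1)]) auto
qed

lemma definable_in_P:
  assumes "scoped 3 \<phi>"
  shows "{w. eval \<phi> w (input_env w)} \<in> class_P"
  using poly_time_computable_out_time[OF out_time_emit[OF assms]] by (simp add: class_P_def)

lemma concat_replicate_singleton: "concat (map (\<lambda>v. [c]) xs) = replicate (length xs) c"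
  by (induction xs) auto

lemma concat_map_singleton': "concat (map (\<lambda>v. [f v]) xs) = map f xs"
  by (induction xs) auto

text \<open>The output has the shape of \<open>encode\<close>, with rows, columns and the
  characteristic vector traversed in descending order. Variables 3 and 4 hold the row and the
  column.\<close>

lemma poly_time_computable_graph_code:
  assumes "below 3 N" "scoped 5 \<phi>" "scoped 4 \<psi>"
  shows "poly_time_computable (\<lambda>w. let e = input_env w; n = val N e in
    replicate n True @ [False] @
    concat (map (\<lambda>i. map (\<lambda>j. eval \<phi> w (e(3 := i, 4 := j))) (rev [0..<n])) (rev [0..<n])) @
    map (\<lambda>i. eval \<psi> w (e(3 := i))) (rev [0..<n]))"
proof -
  have N: "val N (e(3 := i)) = val N e" for e :: "nat \<Rightarrow> nat" and i
    using assms(1) by (rule val_cong) simp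
  have "below 4 N"
    using assms(1) by (rule below_mono) simp
  have "\<exists>T. out_time 4 (for_down 4 N (emit 5 \<phi>))
      (\<lambda>w e. concat (map (\<lambda>j. [eval \<phi> w (e(4 := j))]) (rev [0..<val N e]))) T"
    by (rule out_time_for_down) (use \<open>below 4 N\<close> assms(2) out_time_emit[of 5 \<phi>] in simp_all)
  then have 1: "\<exists>T. out_time 3 (for_down 3 N (for_down 4 N (emit 5 \<phi>)))
      (\<lambda>w e. concat (map (\<lambda>i. concat (map (\<lambda>j. [eval \<phi> w (e(3 := i, 4 := j))])
         (rev [0..<val N (e(3 := i))]))) (rev [0..<val N e]))) T"
    using out_time_for_down[of 3 N "for_down 4 N (emit 5 \<phi>)"] assms(1) by simp
  have 2: "\<exists>T. out_time 3 (for_down 3 N (emit 4 \<psi>))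
      (\<lambda>w e. concat (map (\<lambda>i. [eval \<psi> w (e(3 := i))]) (rev [0..<val N e]))) T"
    by (rule out_time_for_down) (use assms out_time_emit[of 4 \<psi>] in simp_all)
  have 3: "\<exists>T. out_time 3 (for_down 3 N (Out True))
      (\<lambda>w e. concat (map (\<lambda>v. [True]) (rev [0..<val N e]))) T"
    by (rule out_time_for_down) (use assms out_time_Out in simp_all)
  have "\<exists>T. out_time 3
      (Seq (for_down 3 N (Out True)) (Seq (Out False)
        (Seq (for_down 3 N (for_down 4 N (emit 5 \<phi>))) (for_down 3 N (emit 4 \<psi>)))))
      (\<lambda>w e. concat (map (\<lambda>v. [True]) (rev [0..<val N e])) @ [False] @
        concat (map (\<lambda>i. concat (map (\<lambda>j. [eval \<phi> w (e(3 := i, 4 := j))]) (rev [0..<val N (e(3 := i))])))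
          (rev [0..<val N e])) @
        concat (map (\<lambda>i. [eval \<psi> w (e(3 := i))]) (rev [0..<val N e]))) T"
    by (intro out_time_Seq out_time_Out 1 2 3)
  from poly_time_computable_out_time[OF this] show ?thesis
    by (simp only: concat_replicate_singleton concat_map_singleton' N Let_def length_rev length_upt diff_zero)
qed

section \<open>Disjoint trees, colourings and certificates\<close>

abbreviation adj :: "'a set set \<Rightarrow> ('a \<times> 'a) set" where
  "adj E \<equiv> {(a, b). {a, b} \<in> E}"

lemma sym_adj: "sym (adj E)"
  by (auto simp: sym_def insert_commute)

lemma rtrancl_adj_sym: "(a, b) \<in> (adj E)\<^sup>* \<Longrightarrow> (b, a) \<in> (adj E)\<^sup>*"
  by (erule symD[OF sym_rtrancl[OF sym_adj]])

lemma connected_graphI: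
  assumes "h \<in> V" "\<And>v. v \<in> V \<Longrightarrow> (h, v) \<in> (adj E)\<^sup>*"
  shows "connected_graph (V, E)"
  using assms unfolding connected_graph_def
  by (auto intro: rtrancl_trans[OF rtrancl_adj_sym])

text \<open>The rest of the cycle still joins the two ends of the removed edge.\<close>

lemma connected_remove_cycle_edge:
  assumes "connected_graph (V, E)" "is_cycle (V, E) xs"
  shows "connected_graph (V, E - {{xs ! 0, xs ! 1}})"
proof -
  let ?e = "{xs ! 0, xs ! 1}"
  let ?A = "adj (E - {?e})"
  have len: "3 \<le> length xs" and dist: "distinct xs"
    and edge: "\<And>i. i < length xs \<Longrightarrow> {xs ! i, xs ! (Suc i mod length xs)} \<in> E"
    using assms(2) by (auto simp: is_cycle_def)
  have path: "(xs ! 1, xs ! Suc i) \<in> ?A\<^sup>*" if "Suc i < length xs" for i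
    using that
  proof (induction i)
    case (Suc i)
    have "{xs ! Suc i, xs ! Suc (Suc i)} \<in> E"
      using edge[of "Suc i"] Suc.prems by simp
    moreover have "xs ! 0 \<notin> {xs ! Suc i, xs ! Suc (Suc i)}"
      using Suc.prems nth_eq_iff_index_eq[OF dist, of 0 "Suc i"]
        nth_eq_iff_index_eq[OF dist, of 0 "Suc (Suc i)"] by (cases xs) auto
    ultimately have "(xs ! Suc i, xs ! Suc (Suc i)) \<in> ?A"
      by auto
    then show ?case
      using Suc by (auto intro: rtrancl_into_rtrancl)
  qed simp
  define l where "l = length xs - 1"
  have l: "l < length xs" "2 \<le> l" "Suc l = length xs"
    using len by (auto simp: l_def)
  have "{xs ! l, xs ! 0} \<in> E"
    using edge[of l] l by simp
  \<comment> \<open>The closing edge of the cycle differs from the removed one because a cycle has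
    at least three vertices.\<close>
  moreover have "xs ! 1 \<notin> {xs ! l, xs ! 0}"
    using l nth_eq_iff_index_eq[OF dist, of 1 l] nth_eq_iff_index_eq[OF dist, of 1 0] by fastforce
  ultimately have "(xs ! l, xs ! 0) \<in> ?A"
    by auto
  moreover have "(xs ! 1, xs ! l) \<in> ?A\<^sup>*"
    using path[of "l - 1"] l by simp
  ultimately have 10: "(xs ! 1, xs ! 0) \<in> ?A\<^sup>*"
    by (rule rtrancl_into_rtrancl[rotated])
  have "adj E \<subseteq> ?A\<^sup>*"
  proof
    fix p assume "p \<in> adj E"
    then obtain a b where p: "p = (a, b)" "{a, b} \<in> E" by auto
    show "p \<in> ?A\<^sup>*"
    proof (cases "{a, b} = ?e")
      case True
      then show ?thesis
        using 10 rtrancl_adj_sym[OF 10] p by (auto simp: doubleton_eq_iff)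
    qed (use p in auto)
  qed
  then have "(adj E)\<^sup>* \<subseteq> ?A\<^sup>*"
    by (rule rtrancl_subset_rtrancl)
  then show ?thesis
    using assms(1) by (auto simp: connected_graph_def)
qed

lemma spanning_tree:
  assumes "simple_graph (V, E)" "connected_graph (V, E)"
  shows "\<exists>E'\<subseteq>E. is_tree (V, E')"
proof -
  have "finite E"
    using finite_edges[OF assms(1)] by simp
  then show ?thesis
    using assms
  proof (induction E rule: finite_psubset_induct)
    case (psubset E)
    show ?case
    proof (cases "\<exists>xs. is_cycle (V, E) xs")
      case True
      then obtain xs where xs: "is_cycle (V, E) xs" by blast
      let ?E = "E - {{xs ! 0, xs ! 1}}"
      have len: "Suc 0 < length xs"
        and edge: "\<And>i. i < length xs \<Longrightarrow> {xs ! i, xs ! (Suc i mod length xs)} \<in> E"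
        using xs by (auto simp: is_cycle_def)
      have "Suc 0 mod length xs = 1"
        using len by simp
      then have "{xs ! 0, xs ! 1} \<in> E"
        using edge[of 0] len by (simp only: neq0_conv)
      then have "?E \<subset> E" by blast
      moreover have "simple_graph (V, ?E)"
        using psubset.prems(1) by (auto simp: simple_graph_def)
      moreover have "connected_graph (V, ?E)"
        using psubset.prems(2) xs by (rule connected_remove_cycle_edge)
      ultimately show ?thesis
        using psubset.IH[of ?E] by blast
    next
      case False
      then show ?thesis
        using psubset.prems by (auto simp: is_tree_def)
    qed
  qed
qed

text \<open>Spanning trees of the given subgraphs form the family. The assumption
  \<open>distinct\<close> makes their number \<open>k\<close>: if two vertex sets coincide, they
  contain two vertices, so both trees have an edge, and edge-disjoint trees with an edge are
  different.\<close>

lemma disjoint_trees_of_connected: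
  assumes G: "simple_graph G"
    and W: "\<And>c. c < k \<Longrightarrow> S \<subseteq> W c \<and> W c \<subseteq> verts G"
    and F: "\<And>c. c < k \<Longrightarrow> F c \<subseteq> edges G \<and> (\<forall>e\<in>F c. e \<subseteq> W c)"
    and conn: "\<And>c. c < k \<Longrightarrow> connected_graph (W c, F c)"
    and disj: "\<And>c d. c < k \<Longrightarrow> d < k \<Longrightarrow> c \<noteq> d \<Longrightarrow> F c \<inter> F d = {} \<and> W c \<inter> W d = S"
    and distinct: "\<And>c d. c < k \<Longrightarrow> d < k \<Longrightarrow> c \<noteq> d \<Longrightarrow>
      W c \<noteq> W d \<or> (\<exists>u\<in>W c. \<exists>v\<in>W c. u \<noteq> v)"
  shows "\<exists>\<T>. internally_disjoint_trees G S \<T> \<and> card \<T> = k"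
proof -
  have simple: "simple_graph (W c, F c)" if "c < k" for c
    using G W[OF that] F[OF that] finite_subset[of "W c" "verts G"] by (auto simp: simple_graph_def)
  have "\<forall>c. \<exists>E'. c < k \<longrightarrow> E' \<subseteq> F c \<and> is_tree (W c, E')"
    using spanning_tree[OF simple conn] by blast
  then obtain E' where E': "\<And>c. c < k \<Longrightarrow> E' c \<subseteq> F c" "\<And>c. c < k \<Longrightarrow> is_tree (W c, E' c)"
    by metis
  define T where "T c = (W c, E' c)" for c
  have neq: "T c \<noteq> T d" if "c < k" "d < k" "c \<noteq> d" for c d
  proof
    assume eq: "T c = T d"
    have "W c \<noteq> W d \<or> (\<exists>u\<in>W c. \<exists>v\<in>W c. u \<noteq> v)"
      using that by (rule distinct)
    then obtain u v where uv: "u \<in> W c" "v \<in> W c" "u \<noteq> v"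
      using eq by (auto simp: T_def)
    have "(u, v) \<in> (adj (E' c))\<^sup>*"
      using E'(2)[OF that(1)] uv by (auto simp: is_tree_def connected_graph_def)
    then have "E' c \<noteq> {}"
      using uv(3) by auto
    then show False
      using eq E'(1)[OF that(1)] E'(1)[OF that(2)] disj[OF that] by (auto simp: T_def)
  qed
  have "inj_on T {..<k}"
    using neq by (auto intro!: inj_onI)
  then have "card (T ` {..<k}) = k"
    by (simp add: card_image)
  moreover have "tree_connecting G S (T c)" if "c < k" for c
    using E'[OF that] W[OF that] F[OF that]
    by (auto simp: tree_connecting_def T_def subgraph_def is_tree_def)
  moreover have "edges (T c) \<inter> edges (T d) = {} \<and> verts (T c) \<inter> verts (T d) = S"
    if "c < k" "d < k" "T c \<noteq> T d" for c d
    using disj[of c d] that E'(1)[OF that(1)] E'(1)[OF that(2)] unfolding T_def by auto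
  ultimately show ?thesis
    by (intro exI[of _ "T ` {..<k}"]) (auto simp: internally_disjoint_trees_def)
qed

lemma obtain_indexed_trees:
  assumes "internally_disjoint_trees G S \<T>" "card \<T> = k" "0 < k"
  obtains T where "\<And>c. c < k \<Longrightarrow> tree_connecting G S (T c)"
    "\<And>c d. c < k \<Longrightarrow> d < k \<Longrightarrow> c \<noteq> d \<Longrightarrow>
      T c \<noteq> T d \<and> edges (T c) \<inter> edges (T d) = {} \<and> verts (T c) \<inter> verts (T d) = S"
proof -
  \<comment> \<open>An infinite set would have cardinality 0, which \<open>0 < k\<close>
    excludes.\<close>
  have "finite \<T>"
    using assms(2,3) card_ge_0_finite by blast
  then obtain T where T: "bij_betw T {0..<k} \<T>"
    using ex_bij_betw_nat_finite assms(2) by blast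
  have "T c \<in> \<T>" if "c < k" for c
    using T that by (auto simp: bij_betw_def)
  moreover have "T c \<noteq> T d" if "c < k" "d < k" "c \<noteq> d" for c d
    using T that by (auto simp: bij_betw_def inj_on_def)
  ultimately show ?thesis
    using assms(1) by (intro that[of T]) (auto simp: internally_disjoint_trees_def)
qed

section \<open>Disjoint trees as colourings\<close>

lemma adj_rtrancl_verts:
  assumes "simple_graph T" "(x, v) \<in> (adj (edges T))\<^sup>*" "x \<in> verts T"
  shows "v \<in> verts T"
  using assms(2)
proof (induction rule: rtrancl_induct)
  case (step y z)
  then show ?case
    using assms(1) by (auto simp: simple_graph_def)
qed (rule assms(3))

text \<open>From trees to colourings, the index of a tree is the colour of its non-terminals. A tree
  containing two terminals has an edge at each terminal, and its other end is a non-terminal by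
  independence; hence the assumption of two terminals. Conversely, one vertex of colour
  \<open>c\<close> is adjacent to all others of that colour and serves as the root of the
  \<open>c\<close>-th subgraph. Independence also keeps the subgraphs edge-disjoint, as a common
  edge would lie inside \<open>S\<close>.\<close>

lemma disjoint_trees_iff_coloring:
  assumes G: "simple_graph G" and S: "S \<subseteq> verts G" and s12: "s1 \<in> S" "s2 \<in> S" "s1 \<noteq> s2"
    and indep: "\<And>e. e \<in> edges G \<Longrightarrow> \<not> e \<subseteq> S"
    and clique: "\<And>u v. u \<in> verts G - S \<Longrightarrow> v \<in> verts G - S \<Longrightarrow> u \<noteq> v \<Longrightarrow> {u, v} \<in> edges G"
    and k: "0 < k"
  shows "(\<exists>\<T>. internally_disjoint_trees G S \<T> \<and> card \<T> = k) \<longleftrightarrow>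
    (\<exists>col. \<forall>s\<in>S. \<forall>c<k. \<exists>v\<in>verts G - S. {s, v} \<in> edges G \<and> col v = c)"
proof
  assume "\<exists>\<T>. internally_disjoint_trees G S \<T> \<and> card \<T> = k"
  then obtain \<T> where "internally_disjoint_trees G S \<T>" "card \<T> = k" by blast
  then obtain T where T: "\<And>c. c < k \<Longrightarrow> tree_connecting G S (T c)"
    and T_disj: "\<And>c d. c < k \<Longrightarrow> d < k \<Longrightarrow> c \<noteq> d \<Longrightarrow>
      T c \<noteq> T d \<and> edges (T c) \<inter> edges (T d) = {} \<and> verts (T c) \<inter> verts (T d) = S"
    using obtain_indexed_trees[OF _ _ k] by metis
  \<comment> \<open>A non-terminal lies in at most one tree, so the choice is forced for the
    vertices that matter; vertices outside all trees get an arbitrary colour.\<close>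
  define col where "col v = (SOME c. c < k \<and> v \<in> verts (T c))" for v
  have "\<exists>v\<in>verts G - S. {s, v} \<in> edges G \<and> col v = c" if s: "s \<in> S" and c: "c < k" for s c
  proof -
    obtain s' where s': "s' \<in> S" "s' \<noteq> s"
      using s12 by metis
    have "s \<in> verts (T c)" "s' \<in> verts (T c)"
      using T[OF c] s s' by (auto simp: tree_connecting_def)
    then have "(s, s') \<in> (adj (edges (T c)))\<^sup>*"
      using T[OF c] by (auto simp: tree_connecting_def is_tree_def connected_graph_def)
    then obtain v where "(s, v) \<in> adj (edges (T c))"
      using s' by (metis converse_rtranclE)
    then have v: "{s, v} \<in> edges (T c)" by simp
    then have vT: "v \<in> verts (T c)" "{s, v} \<in> edges G"
      using T[OF c] by (auto simp: tree_connecting_def is_tree_def simple_graph_def subgraph_def)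
    then have vG: "v \<in> verts G"
      using G by (auto simp: simple_graph_def)
    have vS: "v \<notin> S"
      using indep[OF vT(2)] s by auto
    have "col v < k \<and> v \<in> verts (T (col v))"
      unfolding col_def by (rule someI[of _ c]) (use c vT in auto)
    then have "col v = c"
      using T_disj[of "col v" c] c vT vS by blast
    then show ?thesis
      using vT vS vG by blast
  qed
  then show "\<exists>col. \<forall>s\<in>S. \<forall>c<k. \<exists>v\<in>verts G - S. {s, v} \<in> edges G \<and> col v = c"
    by blast
next
  assume "\<exists>col. \<forall>s\<in>S. \<forall>c<k. \<exists>v\<in>verts G - S. {s, v} \<in> edges G \<and> col v = c"
  then obtain col :: "'a \<Rightarrow> nat" where
    col: "\<And>s c. s \<in> S \<Longrightarrow> c < k \<Longrightarrow> \<exists>v\<in>verts G - S. {s, v} \<in> edges G \<and> col v = c"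
    by blast
  define W where "W c = S \<union> {v \<in> verts G - S. col v = c}" for c
  define F where "F c = {e \<in> edges G. e \<subseteq> W c}" for c
  have disj: "F c \<inter> F d = {} \<and> W c \<inter> W d = S" if "c \<noteq> d" for c d
  proof -
    have "W c \<inter> W d = S"
      using that by (auto simp: W_def)
    then show ?thesis
      using indep by (auto simp: F_def)
  qed
  show "\<exists>\<T>. internally_disjoint_trees G S \<T> \<and> card \<T> = k"
  proof (rule disjoint_trees_of_connected[where W = W and F = F])
    fix c assume c: "c < k"
    obtain h where h: "h \<in> verts G - S" "col h = c"
      using col[OF s12(1) c] by blast
    have hub: "(h, v) \<in> (adj (F c))\<^sup>*" if "v \<in> verts G - S" "col v = c" for v
      using clique[OF h(1) that(1)] h that by (cases "h = v") (auto simp: F_def W_def)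
    show "connected_graph (W c, F c)"
    proof (rule connected_graphI)
      show "h \<in> W c"
        using h by (auto simp: W_def)
    next
      fix v assume v: "v \<in> W c"
      show "(h, v) \<in> (adj (F c))\<^sup>*"
      proof (cases "v \<in> S")
        case True
        then obtain u where u: "u \<in> verts G - S" "{v, u} \<in> edges G" "col u = c"
          using col c by blast
        then have "(u, v) \<in> adj (F c)"
          using True by (auto simp: F_def W_def insert_commute)
        then show ?thesis
          using hub[OF u(1,3)] by (rule rtrancl_into_rtrancl[rotated])
      next
        case False
        then show ?thesis
          using v hub by (auto simp: W_def)
      qed
    qed
  qed (use G S s12 disj in \<open>auto simp: W_def F_def\<close>)
qed

text \<open>\<open>E c\<close> is the edge relation of the \<open>c\<close>-th subgraph, and \<open>R c v r\<close> means that its vertex \<open>v\<close> is at distance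
  at most \<open>r\<close> from its root. Two of the subgraphs must cover at least two vertices together:
  otherwise \<open>S\<close> could be a singleton and both of them equal to the one-vertex tree.\<close>

definition certificate :: "nat \<Rightarrow> nat \<Rightarrow> (nat \<Rightarrow> nat \<Rightarrow> bool) \<Rightarrow> (nat \<Rightarrow> bool) \<Rightarrow>
    (nat \<Rightarrow> nat \<Rightarrow> nat \<Rightarrow> bool) \<Rightarrow> (nat \<Rightarrow> nat \<Rightarrow> nat \<Rightarrow> bool) \<Rightarrow> bool" where
  "certificate k n A S E R \<longleftrightarrow>
     (\<forall>c<k. (\<forall>u<n. \<forall>v<n. E c u v \<longrightarrow> A u v \<and> E c v u \<and> (\<exists>r<Suc (n * n). R c u r)) \<and>
        (\<forall>v<n. S v \<longrightarrow> (\<exists>r<Suc (n * n). R c v r)) \<and>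
        (\<exists>x<n. \<forall>v<n. R c v 0 \<longleftrightarrow> v = x) \<and>
        (\<forall>v<n. \<forall>r<n * n. R c v (Suc r) \<longrightarrow> R c v r \<or> (\<exists>u<n. R c u r \<and> E c u v)) \<and>
        (\<forall>d<k. c \<noteq> d \<longrightarrow> (\<forall>u<n. \<forall>v<n. \<not> (E c u v \<and> E d u v)) \<and>
           (\<forall>v<n. (\<exists>r<Suc (n * n). R c v r) \<and> (\<exists>r<Suc (n * n). R d v r) \<longrightarrow> S v) \<and>
           (\<exists>u<n. \<exists>v<n. u \<noteq> v \<and> (\<exists>r<Suc (n * n). R c u r \<or> R d u r) \<and>
              (\<exists>r<Suc (n * n). R c v r \<or> R d v r))))"

text \<open>Going back from rank \<open>Suc r\<close> one either stays at the vertex or moves along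
  an edge of the subgraph, and only the root has rank 0. Hence every ranked vertex is connected to
  the root.\<close>

lemma certificate_imp_trees:
  assumes G: "simple_graph G" "verts G = {..<n}" "S \<subseteq> verts G"
    and cert: "certificate k n (\<lambda>u v. {u, v} \<in> edges G) (\<lambda>v. v \<in> S) E R"
  shows "\<exists>\<T>. internally_disjoint_trees G S \<T> \<and> card \<T> = k"
proof -
  define W where "W c = {v. v < n \<and> (\<exists>r<Suc (n * n). R c v r)}" for c
  define F where "F c = {{u, v} |u v. u < n \<and> v < n \<and> E c u v}" for c
  note cert = cert[unfolded certificate_def, THEN spec, THEN mp]
  note c1 = cert[THEN conjunct1, rule_format]
  note c2 = cert[THEN conjunct2, THEN conjunct1, rule_format]
  note c3 = cert[THEN conjunct2, THEN conjunct2, THEN conjunct1]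
  note c4 = cert[THEN conjunct2, THEN conjunct2, THEN conjunct2, THEN conjunct1, rule_format]
  note c5 = cert[THEN conjunct2, THEN conjunct2, THEN conjunct2, THEN conjunct2, THEN spec, THEN mp, THEN mp]
  note c6 = c5[THEN conjunct1, rule_format]
  note c7 = c5[THEN conjunct2, THEN conjunct1, rule_format]
  note c8 = c5[THEN conjunct2, THEN conjunct2]
  have E: "{u, v} \<in> edges G" "E c v u" "u \<in> W c" if "c < k" "u < n" "v < n" "E c u v" for c u v
    using c1[OF that] that by (auto simp: W_def)
  show ?thesis
  proof (rule disjoint_trees_of_connected[where W = W and F = F])
    fix c assume c: "c < k"
    show "S \<subseteq> W c \<and> W c \<subseteq> verts G"
      using c2[OF c] G by (auto simp: W_def)
    show "F c \<subseteq> edges G \<and> (\<forall>e\<in>F c. e \<subseteq> W c)"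
      using E[OF c] by (auto simp: F_def)
    obtain x where x: "x < n" "\<And>v. v < n \<Longrightarrow> R c v 0 \<longleftrightarrow> v = x"
      using c3[OF c] by blast
    have reach: "(x, v) \<in> (adj (F c))\<^sup>*" if "R c v r" "v < n" "r < Suc (n * n)" for v r
      using that
    proof (induction r arbitrary: v)
      case 0
      then show ?case using x by auto
    next
      case (Suc r)
      then consider "R c v r" | u where "u < n" "R c u r" "E c u v"
        using c4[OF c, of v r] by auto
      then show ?case
      proof cases
        case 1
        then show ?thesis using Suc by simp
      next
        case 2
        then have "(u, v) \<in> adj (F c)"
          using Suc.prems by (auto simp: F_def)
        moreover have "(x, u) \<in> (adj (F c))\<^sup>*"
          using 2 Suc by simp
        ultimately show ?thesis by (rule rtrancl_into_rtrancl[rotated])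
      qed
    qed
    show "connected_graph (W c, F c)"
    proof (rule connected_graphI)
      show "x \<in> W c"
        using x by (auto simp: W_def)
    qed (auto simp: W_def intro: reach)
  next
    fix c d assume cd: "c < k" "d < k" "c \<noteq> d"
    have "F c \<inter> F d = {}"
    proof (rule equals0I)
      fix e assume "e \<in> F c \<inter> F d"
      then obtain u v u' v' where e: "u < n" "v < n" "E c u v" "e = {u, v}" "E d u' v'" "e = {u', v'}"
        unfolding F_def by blast
      then have "E c u' v'"
        using E(2)[OF cd(1), of u v] by (auto simp: doubleton_eq_iff)
      moreover have "u' < n" "v' < n"
        using e by (auto simp: doubleton_eq_iff)
      ultimately show False
        using c6[OF cd, of u' v'] e by blast
    qed
    moreover have "W c \<inter> W d \<subseteq> S"
      using c7[OF cd] by (auto simp: W_def)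
    moreover have "S \<subseteq> W c" "S \<subseteq> W d"
      using c2[OF cd(1)] c2[OF cd(2)] G by (auto simp: W_def)
    ultimately show "F c \<inter> F d = {} \<and> W c \<inter> W d = S"
      by blast
    obtain u v where "u \<in> W c \<union> W d" "v \<in> W c \<union> W d" "u \<noteq> v"
      using c8[OF cd] unfolding W_def by blast
    then show "W c \<noteq> W d \<or> (\<exists>u\<in>W c. \<exists>v\<in>W c. u \<noteq> v)"
      by blast
  qed (rule G)
qed

lemma trees_imp_certificate:
  assumes G: "simple_graph G" "verts G = {..<n}"
    and trees: "internally_disjoint_trees G S \<T>" "card \<T> = k" "0 < k"
  shows "\<exists>E R. certificate k n (\<lambda>u v. {u, v} \<in> edges G) (\<lambda>v. v \<in> S) E R"
proof -
  obtain T where T: "\<And>c. c < k \<Longrightarrow> tree_connecting G S (T c)"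
    and T_disj: "\<And>c d. c < k \<Longrightarrow> d < k \<Longrightarrow> c \<noteq> d \<Longrightarrow>
      T c \<noteq> T d \<and> edges (T c) \<inter> edges (T d) = {} \<and> verts (T c) \<inter> verts (T d) = S"
    using obtain_indexed_trees[OF trees] by metis
  have simple: "simple_graph (T c)" if "c < k" for c
    using T[OF that] by (auto simp: tree_connecting_def is_tree_def)
  have sub: "verts (T c) \<subseteq> {..<n}" "edges (T c) \<subseteq> edges G" "S \<subseteq> verts (T c)" if "c < k" for c
    using T[OF that] G by (auto simp: tree_connecting_def subgraph_def)
  have vert: "u \<in> verts (T c)" "v \<in> verts (T c)" if "c < k" "{u, v} \<in> edges (T c)" for c u v
    using simple[OF that(1)] that(2) by (auto simp: simple_graph_def)
  have conn: "connected_graph (T c)" if "c < k" for c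
    using T[OF that] by (auto simp: tree_connecting_def is_tree_def)
  define x where "x c = (SOME v. v \<in> verts (T c))" for c
  have x: "x c \<in> verts (T c)" if "c < k" for c
    unfolding x_def using conn[OF that] by (auto simp: connected_graph_def some_in_eq)
  define E where "E c u v \<longleftrightarrow> {u, v} \<in> edges (T c)" for c u v
  define R where "R c v r \<longleftrightarrow> (\<exists>i\<le>r. (x c, v) \<in> adj (edges (T c)) ^^ i)" for c v r
  have W: "(\<exists>r<Suc (n * n). R c v r) \<longleftrightarrow> v \<in> verts (T c)" if c: "c < k" for c v
  proof
    assume "\<exists>r<Suc (n * n). R c v r"
    then obtain i where "(x c, v) \<in> adj (edges (T c)) ^^ i"
      by (auto simp: R_def)
    then have "(x c, v) \<in> (adj (edges (T c)))\<^sup>*"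
      by (rule relpow_imp_rtrancl)
    then show "v \<in> verts (T c)"
      using adj_rtrancl_verts[OF simple[OF c]] x[OF c] by blast
  next
    assume v: "v \<in> verts (T c)"
    have "adj (edges (T c)) \<subseteq> verts (T c) \<times> verts (T c)"
      using vert[OF c] by auto
    also have "\<dots> \<subseteq> {..<n} \<times> {..<n}"
      using sub(1)[OF c] by blast
    finally have "adj (edges (T c)) \<subseteq> {..<n} \<times> {..<n}" .
    \<comment> \<open>A vertex is reached by a path with no more steps than there are adjacent
      ordered pairs. This is the origin of the maximal rank \<open>n * n\<close>.\<close>
    then have "finite (adj (edges (T c)))" "card (adj (edges (T c))) \<le> n * n"
      using card_mono[of "{..<n} \<times> {..<n}"] by (auto intro: finite_subset simp: card_cartesian_product)
    moreover have "(x c, v) \<in> (adj (edges (T c)))\<^sup>*"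
      using conn[OF c] x[OF c] v by (auto simp: connected_graph_def)
    ultimately obtain i where "i \<le> n * n" "(x c, v) \<in> adj (edges (T c)) ^^ i"
      using rtrancl_finite_eq_relpow[of "adj (edges (T c))"] by (auto dest: order_trans)
    then have "R c v (n * n)"
      by (auto simp: R_def)
    then show "\<exists>r<Suc (n * n). R c v r"
      by blast
  qed
  have step: "R c v r \<or> (\<exists>u<n. R c u r \<and> E c u v)" if c: "c < k" and Rv: "R c v (Suc r)" for c v r
  proof -
    obtain i where i: "i \<le> Suc r" "(x c, v) \<in> adj (edges (T c)) ^^ i"
      using Rv by (auto simp: R_def)
    show ?thesis
    proof (cases "i = Suc r")
      case True
      then obtain u where u: "(x c, u) \<in> adj (edges (T c)) ^^ r" "{u, v} \<in> edges (T c)"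
        using i(2) relpow_Suc_E[of "x c" v r "adj (edges (T c))"] by blast
      moreover have "u < n"
        using vert[OF c u(2)] sub(1)[OF c] by auto
      ultimately show ?thesis
        by (auto simp: R_def E_def)
    next
      case False
      then show ?thesis
        using i by (auto simp: R_def)
    qed
  qed
  have zero: "R c v 0 \<longleftrightarrow> v = x c" for c v
    by (auto simp: R_def)
  \<comment> \<open>If two trees covered a single vertex together, both would be the graph with this
    vertex and no edge, hence equal.\<close>
  have dist: "\<exists>u<n. \<exists>v<n. u \<noteq> v \<and> (u \<in> verts (T c) \<or> u \<in> verts (T d)) \<and>
      (v \<in> verts (T c) \<or> v \<in> verts (T d))"
    if cd: "c < k" "d < k" "c \<noteq> d" for c d
  proof (rule ccontr)
    assume neg: "\<not> ?thesis"
    have less: "u < n" if "u \<in> verts (T c) \<or> u \<in> verts (T d)" for u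
      using sub(1)[OF cd(1)] sub(1)[OF cd(2)] that by auto
    have only: "u = x c" if "u \<in> verts (T c) \<or> u \<in> verts (T d)" for u
      using neg that x[OF cd(1)] less[of u] less[of "x c"] by metis
    have "x d = x c"
      using only x[OF cd(2)] by simp
    then have one: "verts (T c) = {x c}" "verts (T d) = {x c}"
      using only x[OF cd(1)] x[OF cd(2)] by (intro subset_antisym subsetI; simp)+
    have "edges (T i) = {}" if i: "i < k" "verts (T i) = {x c}" for i
    proof -
      have "e \<subseteq> {x c} \<and> card e = 2" if "e \<in> edges (T i)" for e
        using simple[OF i(1)] i(2) that by (auto simp: simple_graph_def)
      moreover have "card e \<noteq> 2" if "e \<subseteq> {x c}" for e
        using card_mono[OF _ that] by simp
      ultimately show ?thesis
        by (metis equals0I)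
    qed
    then have "T c = T d"
      using one cd by (simp add: prod_eq_iff)
    then show False
      using T_disj[OF cd] by blast
  qed
  have dist': "\<exists>u<n. \<exists>v<n. u \<noteq> v \<and> (\<exists>r<Suc (n * n). R c u r \<or> R d u r) \<and>
      (\<exists>r<Suc (n * n). R c v r \<or> R d v r)"
    if cd: "c < k" "d < k" "c \<noteq> d" for c d
  proof -
    have "(\<exists>r<Suc (n * n). R c u r \<or> R d u r) \<longleftrightarrow> u \<in> verts (T c) \<or> u \<in> verts (T d)" for u
      unfolding W[OF cd(1), symmetric] W[OF cd(2), symmetric] by blast
    then show ?thesis
      using dist[OF cd] by simp
  qed
  have "certificate k n (\<lambda>u v. {u, v} \<in> edges G) (\<lambda>v. v \<in> S) E R"
    unfolding certificate_def
  proof (intro allI impI conjI)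
    fix c u v assume "c < k" "E c u v"
    then show "{u, v} \<in> edges G" "E c v u" "\<exists>r<Suc (n * n). R c u r"
      using sub(2)[of c] W[of c u] vert(1)[of c u v] by (auto simp: E_def insert_commute)
  next
    fix c v assume "c < k" "v \<in> S"
    then show "\<exists>r<Suc (n * n). R c v r"
      using sub(3)[of c] W[of c v] by auto
  next
    fix c assume "c < k"
    then show "\<exists>xa<n. \<forall>v<n. R c v 0 \<longleftrightarrow> v = xa"
      using x[of c] sub(1)[of c] zero by (intro exI[of _ "x c"]) auto
  next
    fix c v r assume "c < k" "R c v (Suc r)"
    then show "R c v r \<or> (\<exists>u<n. R c u r \<and> E c u v)"
      by (rule step)
  next
    fix c d u v assume "c < k" "d < k" "c \<noteq> d"
    then show "\<not> (E c u v \<and> E d u v)"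
      using T_disj[of c d] by (auto simp: E_def)
  next
    fix c d v assume "c < k" "d < k" "c \<noteq> d"
      "(\<exists>r<Suc (n * n). R c v r) \<and> (\<exists>r<Suc (n * n). R d v r)"
    then show "v \<in> S"
      using T_disj[of c d] W[of c v] W[of d v] by blast
  qed (rule dist')
  then show ?thesis by blast
qed

section \<open>From colourings and clauses to graphs\<close>

text \<open>By \<open>kappa_ge_iff\<close> the condition on an instance is
  \<open>k \<le> kappa G S\<close>.\<close>

abbreviation disjoint_trees_problem :: "nat \<Rightarrow> bool list set" where
  "disjoint_trees_problem k \<equiv> {encode G S |G S. instance_of G S \<and>
     (\<exists>\<T>. internally_disjoint_trees G S \<T> \<and> card \<T> = k)}"

lemma encode_in_language_iff:
  assumes "instance_of G S"
  shows "encode G S \<in> {encode G S |G S. instance_of G S \<and> P G S} \<longleftrightarrow> P G S"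
  using encode_inject[OF assms] assms by blast

lemma map_rev_upt: "map g (rev [0..<n]) = map (\<lambda>i. g (n - Suc i)) [0..<n]"
  by (rule nth_equalityI) (auto simp: rev_nth)

text \<open>Here logic meets graphs: \<open>ter\<close> selects the terminals among the numbers
  below \<open>n w\<close>, and \<open>inc\<close> says which non-terminals a terminal sees. The
  condition expressed by \<open>\<phi>\<close> adds the clique on the non-terminals and makes
  \<open>inc\<close> symmetric, as the adjacency matrix demands. The assumption \<open>two\<close>
  is the one of \<open>disjoint_trees_iff_coloring\<close>.\<close>

lemma reducible_of_coloring:
  fixes N :: trm and \<phi> \<psi> :: fml and ter :: "bool list \<Rightarrow> nat \<Rightarrow> bool"
    and inc :: "bool list \<Rightarrow> nat \<Rightarrow> nat \<Rightarrow> bool"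
  defines "n \<equiv> \<lambda>w. val N (input_env w)"
  assumes N: "below 3 N" and \<phi>: "scoped 5 \<phi>" and \<psi>: "scoped 4 \<psi>" and k: "0 < k"
    and eval_\<phi>: "\<And>w i j. i < n w \<Longrightarrow> j < n w \<Longrightarrow> eval \<phi> w ((input_env w)(3 := i, 4 := j)) \<longleftrightarrow>
      i \<noteq> j \<and> (\<not> ter w i \<and> \<not> ter w j \<or> ter w i \<and> \<not> ter w j \<and> inc w i j \<or> ter w j \<and> \<not> ter w i \<and> inc w j i)"
    and eval_\<psi>: "\<And>w i. i < n w \<Longrightarrow> eval \<psi> w ((input_env w)(3 := i)) \<longleftrightarrow> ter w i"
    and two: "\<And>w. \<exists>i<n w. \<exists>j<n w. i \<noteq> j \<and> ter w i \<and> ter w j"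
    and L: "\<And>w. w \<in> L \<longleftrightarrow> (\<exists>col :: nat \<Rightarrow> nat. \<forall>i<n w. ter w i \<longrightarrow>
      (\<forall>c<k. \<exists>j<n w. \<not> ter w j \<and> inc w i j \<and> col j = c))"
  shows "poly_reducible L (disjoint_trees_problem k)"
proof -
  define f where "f w = (let e = input_env w; n = val N e in
    replicate n True @ [False] @
    concat (map (\<lambda>i. map (\<lambda>j. eval \<phi> w (e(3 := i, 4 := j))) (rev [0..<n])) (rev [0..<n])) @
    map (\<lambda>i. eval \<psi> w (e(3 := i))) (rev [0..<n]))" for w
  have "poly_time_computable f"
    unfolding f_def by (rule poly_time_computable_graph_code[OF N \<phi> \<psi>])
  moreover have "w \<in> L \<longleftrightarrow> f w \<in> disjoint_trees_problem k" for w
  proof -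
    define m where "m = n w"
    \<comment> \<open>The output loops run downwards, so vertex \<open>i\<close> of the graph is the
      number \<open>m - Suc i\<close> of the description. This renumbering is its own
      inverse.\<close>
    define r where "r i = m - Suc i" for i
    have r: "r i < m" "r (r i) = i" if "i < m" for i
      using that by (auto simp: r_def)
    define adjacent where "adjacent i j \<longleftrightarrow> i \<noteq> j \<and> (\<not> ter w i \<and> \<not> ter w j \<or>
      ter w i \<and> \<not> ter w j \<and> inc w i j \<or> ter w j \<and> \<not> ter w i \<and> inc w j i)" for i j
    define G where "G = ({..<m}, {{i, j} |i j. i < m \<and> j < m \<and> adjacent (r i) (r j)})"
    define S where "S = {i. i < m \<and> ter w (r i)}"
    have sym: "adjacent i j \<longleftrightarrow> adjacent j i" for i j
      by (auto simp: adjacent_def)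
    have edge: "{i, j} \<in> edges G \<longleftrightarrow> adjacent (r i) (r j)" if "i < m" "j < m" for i j
      using that sym by (auto simp: G_def doubleton_eq_iff)
    have "r i \<noteq> r j \<Longrightarrow> card {i, j} = 2" for i j
      by (cases "i = j") auto
    then have inst: "instance_of G S"
      by (auto simp: instance_of_def simple_graph_def G_def S_def adjacent_def)
    have "f w = encode G S"
    proof -
      have "map (\<lambda>i. map (\<lambda>j. eval \<phi> w ((input_env w)(3 := i, 4 := j))) (rev [0..<m])) (rev [0..<m]) =
          map (\<lambda>i. map (\<lambda>j. {i, j} \<in> edges G) [0..<m]) [0..<m]"
        unfolding map_rev_upt
        by (intro map_cong refl) (use eval_\<phi>[of _ w] edge in \<open>simp add: m_def r_def adjacent_def\<close>)
      moreover have "map (\<lambda>i. eval \<psi> w ((input_env w)(3 := i))) (rev [0..<m]) = map (\<lambda>i. i \<in> S) [0..<m]"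
        unfolding map_rev_upt
        by (intro map_cong refl) (use eval_\<psi>[of _ w] in \<open>simp add: m_def S_def r_def\<close>)
      moreover have "card (verts G) = m"
        by (simp add: G_def)
      ultimately show ?thesis
        by (simp add: f_def encode_def Let_def m_def n_def)
    qed
    then have "f w \<in> disjoint_trees_problem k \<longleftrightarrow>
        (\<exists>\<T>. internally_disjoint_trees G S \<T> \<and> card \<T> = k)"
      using encode_in_language_iff[OF inst] by simp
    also have "\<dots> \<longleftrightarrow> (\<exists>col. \<forall>s\<in>S. \<forall>c<k. \<exists>v\<in>verts G - S. {s, v} \<in> edges G \<and> col v = c)"
    proof -
      obtain i j where ij: "i < m" "j < m" "i \<noteq> j" "ter w i" "ter w j"
        using two[of w] by (auto simp: m_def)
      show ?thesis
      proof (rule disjoint_trees_iff_coloring[where ?s1.0 = "r i" and ?s2.0 = "r j"])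
        show "simple_graph G" "S \<subseteq> verts G"
          using inst by (auto simp: instance_of_def)
        show "r i \<in> S" "r j \<in> S" "r i \<noteq> r j"
          using ij r[of i] r[of j] by (auto simp: S_def)
        show "\<not> e \<subseteq> S" if "e \<in> edges G" for e
          using that by (auto simp: G_def S_def adjacent_def)
        show "{u, v} \<in> edges G" if "u \<in> verts G - S" "v \<in> verts G - S" "u \<noteq> v" for u v
        proof -
          have "u < m" "v < m" "\<not> ter w (r u)" "\<not> ter w (r v)"
            using that by (auto simp: G_def S_def)
          moreover have "r u \<noteq> r v"
            using that(3) r(2)[of u] r(2)[of v] calculation by metis
          ultimately show ?thesis
            using edge by (simp add: adjacent_def)
        qed
      qed (rule k)
    qed
    also have "\<dots> \<longleftrightarrow> w \<in> L"
    proof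
      assume "\<exists>col. \<forall>s\<in>S. \<forall>c<k. \<exists>v\<in>verts G - S. {s, v} \<in> edges G \<and> col v = c"
      then obtain col :: "nat \<Rightarrow> nat" where
        col: "\<And>s c. s \<in> S \<Longrightarrow> c < k \<Longrightarrow> \<exists>v\<in>verts G - S. {s, v} \<in> edges G \<and> col v = c" by blast
      have "\<exists>j<m. \<not> ter w j \<and> inc w i j \<and> col (r j) = c" if "i < m" "ter w i" "c < k" for i c
      proof -
        have "r i \<in> S"
          using that r by (simp add: S_def)
        then obtain v where v: "v \<in> verts G - S" "{r i, v} \<in> edges G" "col v = c"
          using col \<open>c < k\<close> by blast
        then have "v < m" "\<not> ter w (r v)"
          by (auto simp: G_def S_def)
        moreover have "adjacent i (r v)"
          using v(2) edge[of "r i" v] r that calculation by simp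
        ultimately show ?thesis
          using v(3) r[of v] \<open>ter w i\<close> by (intro exI[of _ "r v"]) (auto simp: adjacent_def)
      qed
      then show "w \<in> L"
        unfolding L m_def[symmetric] by (intro exI[of _ "\<lambda>j. col (r j)"]) blast
    next
      assume "w \<in> L"
      then obtain col :: "nat \<Rightarrow> nat" where
        col: "\<And>i c. i < m \<Longrightarrow> ter w i \<Longrightarrow> c < k \<Longrightarrow> \<exists>j<m. \<not> ter w j \<and> inc w i j \<and> col j = c"
        unfolding L m_def by blast
      have "\<exists>v\<in>verts G - S. {s, v} \<in> edges G \<and> col (r v) = c"
        if sS: "s \<in> S" and ck: "c < k" for s c
      proof -
        have s: "s < m" "ter w (r s)"
          using sS by (auto simp: S_def)
        then obtain j where j: "j < m" "\<not> ter w j" "inc w (r s) j" "col j = c"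
          using col[of "r s" c] r ck by auto
        then have "adjacent (r s) (r (r j))"
          using s r by (auto simp: adjacent_def)
        then have "{s, r j} \<in> edges G"
          using edge s r j by blast
        then show ?thesis
          using j r by (intro bexI[of _ "r j"]) (auto simp: G_def S_def)
      qed
      then show "\<exists>col. \<forall>s\<in>S. \<forall>c<k. \<exists>v\<in>verts G - S. {s, v} \<in> edges G \<and> col v = c"
        by (intro exI[of _ "\<lambda>v. col (r v)"]) blast
    qed
    finally show ?thesis by simp
  qed
  ultimately show ?thesis
    unfolding poly_reducible_def by blast
qed

section \<open>Free variables and derived formulas\<close>

text \<open>Exact sets of variables are needed besides the upper bounds of \<open>below\<close>: a
  guard must not depend on variables 3 and 4, which hold the two vertices under consideration,
  although it may use 5, 6 and 7.\<close>

fun term_vars :: "trm \<Rightarrow> nat set" where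
  "term_vars (Var i) = {i}"
| "term_vars (Const c) = {}"
| "term_vars (Add t u) = term_vars t \<union> term_vars u"
| "term_vars (Mult t u) = term_vars t \<union> term_vars u"

fun free_vars :: "fml \<Rightarrow> nat set" where
  "free_vars (Less t u) = term_vars t \<union> term_vars u"
| "free_vars (Bit t) = term_vars t"
| "free_vars (Neg \<phi>) = free_vars \<phi>"
| "free_vars (Conj \<phi> \<psi>) = free_vars \<phi> \<union> free_vars \<psi>"
| "free_vars (Ex x t \<phi>) = term_vars t \<union> (free_vars \<phi> - {x})"

lemma val_cong_vars: "(\<And>i. i \<in> term_vars t \<Longrightarrow> e i = e' i) \<Longrightarrow> val t e = val t e'"
  by (induction t) auto

lemma eval_cong_vars: "(\<And>i. i \<in> free_vars \<phi> \<Longrightarrow> e i = e' i) \<Longrightarrow> eval \<phi> w e = eval \<phi> w e'"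
proof (induction \<phi> arbitrary: e e')
  case (Less t u)
  then show ?case using val_cong_vars[of t e e'] val_cong_vars[of u e e'] by simp
next
  case (Bit t)
  then show ?case using val_cong_vars[of t e e'] by simp
next
  case (Neg \<phi>)
  have "eval \<phi> w e = eval \<phi> w e'"
    using Neg.prems by (intro Neg.IH) simp
  then show ?case by simp
next
  case (Conj \<phi> \<psi>)
  have "eval \<phi> w e = eval \<phi> w e'" "eval \<psi> w e = eval \<psi> w e'"
    using Conj.prems by (intro Conj.IH; simp)+
  then show ?case by simp
next
  case (Ex x t \<phi>)
  have "eval \<phi> w (e(x := v)) = eval \<phi> w (e'(x := v))" for v
    using Ex.prems by (intro Ex.IH) auto
  moreover have "val t e = val t e'"
    using Ex.prems by (intro val_cong_vars) auto
  ultimately show ?case by simp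
qed

lemma below_if_vars: "term_vars t \<subseteq> {..<d} \<Longrightarrow> below d t"
  by (induction t) auto

definition Eq :: "trm \<Rightarrow> trm \<Rightarrow> fml" where
  "Eq t u = Conj (Neg (Less t u)) (Neg (Less u t))"

definition Or :: "fml \<Rightarrow> fml \<Rightarrow> fml" where
  "Or \<phi> \<psi> = Neg (Conj (Neg \<phi>) (Neg \<psi>))"

definition Truth :: fml where
  "Truth = Less (Const 0) (Const 1)"

definition Disj :: "fml list \<Rightarrow> fml" where
  "Disj \<phi>s = foldr Or \<phi>s (Neg Truth)"

lemma eval_Eq [simp]: "eval (Eq t u) w e \<longleftrightarrow> val t e = val u e"
  by (auto simp: Eq_def)

lemma eval_Or [simp]: "eval (Or \<phi> \<psi>) w e \<longleftrightarrow> eval \<phi> w e \<or> eval \<psi> w e"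
  by (simp add: Or_def)

lemma eval_Truth [simp]: "eval Truth w e"
  by (simp add: Truth_def)

lemma eval_Disj [simp]: "eval (Disj \<phi>s) w e \<longleftrightarrow> (\<exists>\<phi>\<in>set \<phi>s. eval \<phi> w e)"
  by (induction \<phi>s) (auto simp: Disj_def)

lemma scoped_derived [simp]:
  "scoped d (Eq t u) \<longleftrightarrow> below d t \<and> below d u"
  "scoped d (Or \<phi> \<psi>) \<longleftrightarrow> scoped d \<phi> \<and> scoped d \<psi>"
  "scoped d Truth"
  "scoped d (Disj \<phi>s) \<longleftrightarrow> (\<forall>\<phi>\<in>set \<phi>s. scoped d \<phi>)"
proof -
  show "scoped d (Disj \<phi>s) \<longleftrightarrow> (\<forall>\<phi>\<in>set \<phi>s. scoped d \<phi>)"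
    by (induction \<phi>s) (auto simp: Disj_def Or_def Truth_def)
qed (auto simp: Eq_def Or_def Truth_def)

lemma free_vars_derived [simp]:
  "free_vars (Eq t u) = term_vars t \<union> term_vars u"
  "free_vars (Or \<phi> \<psi>) = free_vars \<phi> \<union> free_vars \<psi>"
  "free_vars Truth = {}"
  by (auto simp: Eq_def Or_def Truth_def)

section \<open>Vertices as numbers\<close>

text \<open>These are digits in base \<open>B\<close>. The leading one may exceed \<open>B\<close>,
  so it takes the number of the schema or of the kind of vertex, whose range is unrelated to
  \<open>B\<close>.\<close>

definition code :: "nat \<Rightarrow> nat \<Rightarrow> nat \<Rightarrow> nat \<Rightarrow> nat \<Rightarrow> nat" where
  "code B r a b c = ((r * B + a) * B + b) * B + c"

definition Code :: "trm \<Rightarrow> trm \<Rightarrow> trm \<Rightarrow> trm \<Rightarrow> trm \<Rightarrow> trm" where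
  "Code B r a b c = Add (Mult (Add (Mult (Add (Mult r B) a) B) b) B) c"

lemma val_Code [simp]: "val (Code B r a b c) e = code (val B e) (val r e) (val a e) (val b e) (val c e)"
  by (simp add: Code_def code_def)

lemma below_Code [simp]:
  "below d (Code B r a b c) \<longleftrightarrow> below d B \<and> below d r \<and> below d a \<and> below d b \<and> below d c"
  by (auto simp: Code_def)

lemma code_decode:
  assumes "a < B" "b < B" "c < B"
  shows "code B r a b c div B div B div B = r" "code B r a b c div B div B mod B = a"
    "code B r a b c div B mod B = b" "code B r a b c mod B = c"
  using assms by (auto simp: code_def)

lemma code_inject:
  assumes "a < B" "b < B" "c < B" "a' < B" "b' < B" "c' < B"
  shows "code B r a b c = code B r' a' b' c' \<longleftrightarrow> r = r' \<and> a = a' \<and> b = b' \<and> c = c'"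
  using code_decode[OF assms(1-3), of r] code_decode[OF assms(4-6), of r'] by metis

lemma code_less:
  assumes "r < R" "a < B" "b < B" "c < B"
  shows "code B r a b c < R * (B * (B * B))"
proof -
  have step: "x * B + y < X * B" if "x < X" "y < B" for x y X :: nat
  proof -
    have "x * B + y < Suc x * B" using that by simp
    also have "\<dots> \<le> X * B" using that by (intro mult_le_mono1) simp
    finally show ?thesis .
  qed
  have "code B r a b c < ((R * B) * B) * B"
    unfolding code_def by (intro step assms)
  then show ?thesis by (simp only: mult.assoc)
qed

text \<open>A schema \<open>(g, [(r, s, t), \<dots>])\<close> stands for the constraints on colourings of the triples
  \<open>(r, a, b)\<close> that arise from values of the variables \<open>5\<close>, \<open>6\<close>, \<open>7\<close> that satisfy the guard \<open>g\<close>.\<close>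

definition schema_env :: "bool list \<Rightarrow> nat \<Rightarrow> nat \<Rightarrow> nat \<Rightarrow> nat \<Rightarrow> nat" where
  "schema_env w x y z = (input_env w)(5 := x, 6 := y, 7 := z)"

abbreviation schema_vars :: "nat set" where
  "schema_vars \<equiv> {2, 5, 6, 7}"

abbreviation sees_color ::
    "(nat \<Rightarrow> nat \<Rightarrow> nat \<Rightarrow> nat) \<Rightarrow> (nat \<Rightarrow> nat) \<Rightarrow> (nat \<times> trm \<times> trm) list \<Rightarrow> nat \<Rightarrow> bool" where
  "sees_color col e ls c \<equiv> \<exists>(r, s, t)\<in>set ls. col r (val s e) (val t e) = c"

abbreviation clause_holds ::
    "('k \<Rightarrow> nat \<Rightarrow> nat \<Rightarrow> bool) \<Rightarrow> (nat \<Rightarrow> nat) \<Rightarrow> (bool \<times> 'k \<times> trm \<times> trm) list \<Rightarrow> bool" where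
  "clause_holds V e ls \<equiv> \<exists>(sg, K, s, t)\<in>set ls. V K (val s e) (val t e) = sg"

lemma val_schema_env:
  assumes "term_vars t \<subseteq> schema_vars"
  shows "val t ((input_env w)(3 := i, 5 := x, 6 := y, 7 := z)) = val t (schema_env w x y z)"
    and "val t ((input_env w)(3 := i, 4 := j, 5 := x, 6 := y, 7 := z)) = val t (schema_env w x y z)"
  using assms by (auto simp: schema_env_def input_env_def intro!: val_cong_vars)

lemma eval_schema_env:
  assumes "free_vars \<phi> \<subseteq> schema_vars"
  shows "eval \<phi> w ((input_env w)(3 := i, 5 := x, 6 := y, 7 := z)) = eval \<phi> w (schema_env w x y z)"
    and "eval \<phi> w ((input_env w)(3 := i, 4 := j, 5 := x, 6 := y, 7 := z)) = eval \<phi> w (schema_env w x y z)"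
  using assms by (auto simp: schema_env_def input_env_def intro!: eval_cong_vars)

lemma val_below_3:
  assumes "below 3 B"
  shows "val B ((input_env w)(3 := i)) = val B (input_env w)"
    "val B ((input_env w)(3 := i, 5 := x)) = val B (input_env w)"
    "val B ((input_env w)(3 := i, 5 := x, 6 := y)) = val B (input_env w)"
    "val B ((input_env w)(3 := i, 5 := x, 6 := y, 7 := z)) = val B (input_env w)"
    "val B ((input_env w)(3 := i, 4 := j)) = val B (input_env w)"
    "val B ((input_env w)(3 := i, 4 := j, 5 := x)) = val B (input_env w)"
    "val B ((input_env w)(3 := i, 4 := j, 5 := x, 6 := y)) = val B (input_env w)"
    "val B ((input_env w)(3 := i, 4 := j, 5 := x, 6 := y, 7 := z)) = val B (input_env w)"
    "val B (schema_env w x y z) = val B (input_env w)"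
  by (rule val_cong[OF assms]; simp add: schema_env_def)+

text \<open>The terminals are the codes \<open>(q, x, y, z)\<close> for which the guard of schema
  \<open>q\<close> holds. The coloured triples \<open>(r, a, b)\<close> become the codes
  \<open>(r, a, b, 0)\<close>; as \<open>length \<Sigma> \<le> r\<close>, they are never terminals.
  All other numbers are non-terminals to which \<open>inc\<close> relates no terminal, so their
  colours are irrelevant. The bound on the numbers is \<open>R\<close> times the cube of the
  base.\<close>

lemma reducible_of_coloring_schemas:
  fixes \<Sigma> :: "(fml \<times> (nat \<times> trm \<times> trm) list) list" and B :: trm
  defines "b \<equiv> \<lambda>w. val B (input_env w)"
  assumes B: "below 3 B" "\<And>w. 2 \<le> b w" and k: "0 < k"
    and guard: "\<And>g ls. (g, ls) \<in> set \<Sigma> \<Longrightarrow> scoped 8 g \<and> free_vars g \<subseteq> schema_vars"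
    and lits: "\<And>g ls r s t. (g, ls) \<in> set \<Sigma> \<Longrightarrow> (r, s, t) \<in> set ls \<Longrightarrow>
      length \<Sigma> \<le> r \<and> r < R \<and> term_vars s \<subseteq> schema_vars \<and> term_vars t \<subseteq> schema_vars"
    and range: "\<And>w g ls r s t x y z. (g, ls) \<in> set \<Sigma> \<Longrightarrow> (r, s, t) \<in> set ls \<Longrightarrow>
      x < b w \<Longrightarrow> y < b w \<Longrightarrow> z < b w \<Longrightarrow> eval g w (schema_env w x y z) \<Longrightarrow>
      val s (schema_env w x y z) < b w \<and> val t (schema_env w x y z) < b w"
    and triv: "(Truth, ls0) \<in> set \<Sigma>" and R: "length \<Sigma> \<le> R"
    and L: "\<And>w. w \<in> L \<longleftrightarrow> (\<exists>col :: nat \<Rightarrow> nat \<Rightarrow> nat \<Rightarrow> nat. \<forall>(g, ls)\<in>set \<Sigma>. \<forall>x<b w. \<forall>y<b w. \<forall>z<b w.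
      eval g w (schema_env w x y z) \<longrightarrow>
      (\<forall>c<k. sees_color col (schema_env w x y z) ls c))"
  shows "poly_reducible L (disjoint_trees_problem k)"
proof -
  let ?m = "length \<Sigma>"
  define ter where "ter w i \<longleftrightarrow> (\<exists>q<?m. \<exists>x<b w. \<exists>y<b w. \<exists>z<b w.
    eval (fst (\<Sigma> ! q)) w (schema_env w x y z) \<and> i = code (b w) q x y z)" for w i
  define inc where "inc w i j \<longleftrightarrow> (\<exists>q<?m. \<exists>x<b w. \<exists>y<b w. \<exists>z<b w.
    eval (fst (\<Sigma> ! q)) w (schema_env w x y z) \<and> i = code (b w) q x y z \<and>
    (\<exists>(r, s, t)\<in>set (snd (\<Sigma> ! q)).
       j = code (b w) r (val s (schema_env w x y z)) (val t (schema_env w x y z)) 0))" for w i j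
  define Ter where "Ter v = Disj (map (\<lambda>q. Ex 5 B (Ex 6 B (Ex 7 B (Conj (fst (\<Sigma> ! q))
    (Eq (Var v) (Code B (Const q) (Var 5) (Var 6) (Var 7))))))) [0..<?m])" for v
  define Inc where "Inc u v = Disj (map (\<lambda>q. Ex 5 B (Ex 6 B (Ex 7 B (Conj (fst (\<Sigma> ! q))
    (Conj (Eq (Var u) (Code B (Const q) (Var 5) (Var 6) (Var 7)))
      (Disj (map (\<lambda>(r, s, t). Eq (Var v) (Code B (Const r) s t (Const 0))) (snd (\<Sigma> ! q))))))))) [0..<?m])" for u v
  define \<phi> where "\<phi> = Conj (Neg (Eq (Var 3) (Var 4))) (Or (Conj (Neg (Ter 3)) (Neg (Ter 4)))
    (Or (Conj (Ter 3) (Conj (Neg (Ter 4)) (Inc 3 4))) (Conj (Ter 4) (Conj (Neg (Ter 3)) (Inc 4 3)))))"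
  define N where "N = Mult (Const R) (Mult B (Mult B B))"
  have mem: "(fst (\<Sigma> ! q), snd (\<Sigma> ! q)) \<in> set \<Sigma>" if "q < ?m" for q
    using that by simp
  have env: "b w = val B (input_env w)" for w
    by (simp add: b_def)
  have Bs: "below d B" if "3 \<le> d" for d
    using B(1) that by (rule below_mono)
  have below8: "below 8 t" if "term_vars t \<subseteq> schema_vars" for t
    using that by (intro below_if_vars) auto
  have ter3: "eval (Ter 3) w ((input_env w)(3 := i)) \<longleftrightarrow> ter w i" for w i
    unfolding Ter_def ter_def env
    by (simp add: val_below_3[OF B(1)] eval_schema_env(1)[OF guard[OF mem, THEN conjunct2]] Bex_def cong: conj_cong)
  have ter34: "eval (Ter 3) w ((input_env w)(3 := i, 4 := j)) \<longleftrightarrow> ter w i"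
    "eval (Ter 4) w ((input_env w)(3 := i, 4 := j)) \<longleftrightarrow> ter w j" for w i j
    unfolding Ter_def ter_def env
    by (simp_all add: val_below_3[OF B(1)] eval_schema_env(2)[OF guard[OF mem, THEN conjunct2]] Bex_def cong: conj_cong)
  have lit: "term_vars s \<subseteq> schema_vars" "term_vars t \<subseteq> schema_vars"
    if "q < ?m" "(r, s, t) \<in> set (snd (\<Sigma> ! q))" for q r s t
    using lits[OF mem[OF that(1)] that(2)] by auto
  have lit8: "below 8 s \<and> below 8 t" if "q < ?m" "(r, s, t) \<in> set (snd (\<Sigma> ! q))" for q r s t
    using lit[OF that] below8 by blast
  have inc34: "eval (Inc 3 4) w ((input_env w)(3 := i, 4 := j)) \<longleftrightarrow> inc w i j"
    "eval (Inc 4 3) w ((input_env w)(3 := i, 4 := j)) \<longleftrightarrow> inc w j i" for w i j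
    unfolding Inc_def inc_def env
    by (simp_all add: val_below_3[OF B(1)] eval_schema_env(2)[OF guard[OF mem, THEN conjunct2]]
        val_schema_env(2)[OF lit(1)] val_schema_env(2)[OF lit(2)] Bex_def split_def cong: conj_cong)
  show ?thesis
  proof (rule reducible_of_coloring[where N = N and \<phi> = \<phi> and \<psi> = "Ter 3" and ter = ter and inc = inc])
    show "below 3 N"
      using B(1) by (simp add: N_def)
    show "scoped 4 (Ter 3)"
      using Bs guard[OF mem] by (auto simp: Ter_def)
    have "scoped 5 (Ter v)" if "v < 5" for v
      using Bs guard[OF mem] that by (auto simp: Ter_def)
    moreover have "scoped 5 (Inc u v)" if "u < 5" "v < 5" for u v
      using Bs guard[OF mem] that lit8 by (auto simp: Inc_def)
    ultimately show "scoped 5 \<phi>"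
      by (simp add: \<phi>_def)
    show "0 < k" by (rule k)
    fix w
    define c where "c q x y z = code (b w) q x y z" for q x y z
    have n: "val N (input_env w) = R * (b w * (b w * b w))"
      by (simp add: N_def b_def)
    show "eval \<phi> w ((input_env w)(3 := i, 4 := j)) \<longleftrightarrow> i \<noteq> j \<and>
        (\<not> ter w i \<and> \<not> ter w j \<or> ter w i \<and> \<not> ter w j \<and> inc w i j \<or> ter w j \<and> \<not> ter w i \<and> inc w j i)" for i j
      by (simp add: \<phi>_def ter34 inc34)
    show "eval (Ter 3) w ((input_env w)(3 := i)) \<longleftrightarrow> ter w i" for i
      by (rule ter3)
    have b2: "0 < b w" "1 < b w"
      using B(2)[of w] by auto
    obtain q0 where q0: "q0 < ?m" "\<Sigma> ! q0 = (Truth, ls0)"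
      using triv by (auto simp: in_set_conv_nth)
    \<comment> \<open>The guard \<open>Truth\<close> holds for all values, so the last components 0
      and 1 give two different terminals.\<close>
    show "\<exists>i<val N (input_env w). \<exists>j<val N (input_env w). i \<noteq> j \<and> ter w i \<and> ter w j"
    proof (intro exI conjI)
      show "c q0 0 0 0 < val N (input_env w)" "c q0 0 0 1 < val N (input_env w)"
        unfolding n c_def using q0 R b2 by (intro code_less; simp)+
      show "c q0 0 0 0 \<noteq> c q0 0 0 1"
        unfolding c_def using b2 by (subst code_inject) auto
      show "ter w (c q0 0 0 0)" "ter w (c q0 0 0 1)"
        unfolding ter_def c_def using q0 b2
        by (intro exI[of _ q0] conjI exI[of _ 0] exI[of _ 1]; simp)+
    qed
    have nonter: "\<not> ter w (c r x y z)" if "?m \<le> r" "x < b w" "y < b w" "z < b w" for r x y z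
      using that by (auto simp: ter_def c_def code_inject)
    show "w \<in> L \<longleftrightarrow> (\<exists>col :: nat \<Rightarrow> nat. \<forall>i<val N (input_env w). ter w i \<longrightarrow>
      (\<forall>c<k. \<exists>j<val N (input_env w). \<not> ter w j \<and> inc w i j \<and> col j = c))"
    proof
      assume "w \<in> L"
      then obtain col :: "nat \<Rightarrow> nat \<Rightarrow> nat \<Rightarrow> nat" where col: "\<forall>(g, ls)\<in>set \<Sigma>. \<forall>x<b w. \<forall>y<b w. \<forall>z<b w.
        eval g w (schema_env w x y z) \<longrightarrow>
        (\<forall>c<k. sees_color col (schema_env w x y z) ls c)"
        unfolding L by blast
      define col' where "col' j = col (j div b w div b w div b w) (j div b w div b w mod b w) (j div b w mod b w)" for j
      have "\<exists>j<val N (input_env w). \<not> ter w j \<and> inc w i j \<and> col' j = a"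
        if ti: "ter w i" and ak: "a < k" for i a
      proof -
        obtain q x y z where q: "q < ?m" "x < b w" "y < b w" "z < b w"
          "eval (fst (\<Sigma> ! q)) w (schema_env w x y z)" "i = c q x y z"
          using ti unfolding ter_def c_def by blast
        have "sees_color col (schema_env w x y z) (snd (\<Sigma> ! q)) a"
          using bspec[OF col mem[OF q(1)]] q(2-5) ak by (simp add: split_def)
        then obtain r s t where r: "(r, s, t) \<in> set (snd (\<Sigma> ! q))"
          "col r (val s (schema_env w x y z)) (val t (schema_env w x y z)) = a"
          by blast
        note rg = range[OF mem[OF q(1)] r(1) q(2-5)]
        note lt = lits[OF mem[OF q(1)] r(1)]
        let ?j = "c r (val s (schema_env w x y z)) (val t (schema_env w x y z)) 0"
        have "?j < val N (input_env w)"
          unfolding n c_def using rg lt b2 by (intro code_less) auto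
        moreover have "\<not> ter w ?j"
          using rg lt b2 by (intro nonter) auto
        moreover have "\<exists>(r, s, t)\<in>set (snd (\<Sigma> ! q)).
            ?j = code (b w) r (val s (schema_env w x y z)) (val t (schema_env w x y z)) 0"
          using r(1) by (intro bexI[of _ "(r, s, t)"]) (auto simp: c_def)
        then have "inc w i ?j"
          unfolding inc_def using q unfolding c_def by blast
        moreover have "col' ?j = a"
          using rg b2 r(2) by (simp add: col'_def c_def code_decode)
        ultimately show ?thesis by blast
      qed
      then show "\<exists>col :: nat \<Rightarrow> nat. \<forall>i<val N (input_env w). ter w i \<longrightarrow>
        (\<forall>c<k. \<exists>j<val N (input_env w). \<not> ter w j \<and> inc w i j \<and> col j = c)"
        by blast
    next
      assume "\<exists>col :: nat \<Rightarrow> nat. \<forall>i<val N (input_env w). ter w i \<longrightarrow>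
        (\<forall>c<k. \<exists>j<val N (input_env w). \<not> ter w j \<and> inc w i j \<and> col j = c)"
      then obtain col :: "nat \<Rightarrow> nat" where col: "\<And>i c. i < val N (input_env w) \<Longrightarrow> ter w i \<Longrightarrow> c < k \<Longrightarrow>
        \<exists>j. inc w i j \<and> col j = c"
        by blast
      have "\<exists>(r, s, t)\<in>set ls. col (c r (val s (schema_env w x y z)) (val t (schema_env w x y z)) 0) = a"
        if g: "(g, ls) \<in> set \<Sigma>" and xyz: "x < b w" "y < b w" "z < b w"
          and ev: "eval g w (schema_env w x y z)" and ak: "a < k" for g ls x y z a
      proof -
        obtain q where q: "q < ?m" "\<Sigma> ! q = (g, ls)"
          using g by (auto simp: in_set_conv_nth)
        have "c q x y z < val N (input_env w)"
          unfolding n c_def using q R xyz by (intro code_less) auto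
        moreover have "ter w (c q x y z)"
          unfolding ter_def c_def using q xyz ev by (intro exI[of _ q] exI[of _ x] exI[of _ y] exI[of _ z]) auto
        ultimately obtain j where j: "inc w (c q x y z) j" "col j = a"
          using col ak by blast
        then obtain q' x' y' z' r s t where "x' < b w" "y' < b w" "z' < b w"
          "c q x y z = c q' x' y' z'" and r: "(r, s, t) \<in> set (snd (\<Sigma> ! q'))"
          "j = c r (val s (schema_env w x' y' z')) (val t (schema_env w x' y' z')) 0"
          unfolding inc_def c_def by blast
        then have "q' = q" "x' = x" "y' = y" "z' = z"
          using xyz by (auto simp: c_def code_inject)
        then show ?thesis
          using r q j(2) by (intro bexI[of _ "(r, s, t)"]) auto
      qed
      then show "w \<in> L"
        unfolding L by (intro exI[of _ "\<lambda>r x y. col (c r x y 0)"]) blast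
    qed
  qed
qed

section \<open>Clauses as constraints on colourings\<close>

lemma two_unused_colors:
  assumes "2 \<le> k"
  shows "\<exists>a<k. \<exists>b<k. a \<noteq> b \<and> (\<forall>u<k - 2. f u \<noteq> a \<and> f u \<noteq> (b :: nat))"
proof -
  let ?A = "{..<k} - f ` {..<k - 2}"
  have "card (f ` {..<k - 2}) \<le> k - 2"
    using card_image_le[of "{..<k - 2}" f] by simp
  moreover have "card {..<k} - card (f ` {..<k - 2}) \<le> card ?A"
    by (rule diff_card_le_card_Diff) simp
  ultimately have "2 \<le> card ?A"
    using assms by simp
  then obtain B where "B \<subseteq> ?A" "card B = 2"
    by (meson obtain_subset_with_card_n)
  then show ?thesis
    by (auto simp: card_2_iff)
qed

text \<open>The vertices are the literals, a vertex that plays the truth value \<open>False\<close>, and \<open>k - 2\<close>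
  universal vertices, which occur in all constraints and therefore leave only two colours to be
  distributed. A clause together with the vertex \<open>False\<close> must be non-monochromatic, and so must
  every pair of opposite literals.\<close>

lemma reducible_of_clauses:
  fixes \<Sigma> :: "(fml \<times> (bool \<times> 'k::countable \<times> trm \<times> trm) list) list" and B :: trm
  defines "b \<equiv> \<lambda>w. val B (input_env w)"
  assumes B: "below 3 B" "\<And>w. 2 \<le> b w" and k: "2 \<le> k"
    and guard: "\<And>g ls. (g, ls) \<in> set \<Sigma> \<Longrightarrow> scoped 8 g \<and> free_vars g \<subseteq> schema_vars"
    and lits: "\<And>g ls sg K s t. (g, ls) \<in> set \<Sigma> \<Longrightarrow> (sg, K, s, t) \<in> set ls \<Longrightarrow>
      term_vars s \<subseteq> schema_vars \<and> term_vars t \<subseteq> schema_vars"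
    and range: "\<And>w g ls sg K s t x y z. (g, ls) \<in> set \<Sigma> \<Longrightarrow> (sg, K, s, t) \<in> set ls \<Longrightarrow>
      x < b w \<Longrightarrow> y < b w \<Longrightarrow> z < b w \<Longrightarrow> eval g w (schema_env w x y z) \<Longrightarrow>
      val s (schema_env w x y z) < b w \<and> val t (schema_env w x y z) < b w"
    and L: "\<And>w. w \<in> L \<longleftrightarrow> (\<exists>V. \<forall>(g, ls)\<in>set \<Sigma>. \<forall>x<b w. \<forall>y<b w. \<forall>z<b w.
      eval g w (schema_env w x y z) \<longrightarrow>
      (clause_holds V (schema_env w x y z) ls))"
  shows "poly_reducible L (disjoint_trees_problem k)"
proof -
  define kinds where "kinds = (\<Union>(g, ls)\<in>set \<Sigma>. (\<lambda>(sg, K, s, t). to_nat K) ` set ls)"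
  have "finite kinds"
    by (auto simp: kinds_def)
  then obtain \<kappa>0 where "\<forall>i\<in>kinds. i < \<kappa>0"
    by (auto simp: finite_nat_set_iff_bounded)
  \<comment> \<open>A positive bound guarantees at least one schema for a pair of opposite literals.
    Its guard is \<open>Truth\<close>, as \<open>reducible_of_coloring_schemas\<close> requires of
    some schema.\<close>
  then obtain \<kappa> where \<kappa>: "\<forall>i\<in>kinds. i < \<kappa>" "0 < \<kappa>"
    by (metis less_SucI zero_less_Suc)
  have to_nat_less: "to_nat K < \<kappa>" if "(g, ls) \<in> set \<Sigma>" "(sg, K, s, t) \<in> set ls" for g ls sg K s t
    using \<kappa>(1) that by (force simp: kinds_def)
  \<comment> \<open>This will be the number of all schemas, including those for opposite literals.
    Smaller first components belong to terminals, so the roles of literals begin at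
    \<open>m\<close>.\<close>
  define m where "m = length \<Sigma> + \<kappa>"
  define role where "role sg i = m + 2 * i + of_bool sg" for sg and i :: nat
  define F where "F = m + 2 * \<kappa>"
  define univs where "univs = map (\<lambda>u. (F + 1 + u, Const 0, Const 0)) [0..<k - 2]"
  define clause where "clause ls = (F, Const 0, Const 0) # univs @
    map (\<lambda>(sg, K, s, t). (role sg (to_nat (K :: 'k)), s, t)) ls" for ls
  have mem_clause: "(r, s, t) \<in> set ((F, Const 0, Const 0) # univs) \<or>
      (\<exists>sg K. (sg, K, s, t) \<in> set ls \<and> r = role sg (to_nat K))" if "(r, s, t) \<in> set (clause ls)" for r s t ls
    using that by (auto simp: clause_def)
  define pair where "pair i = univs @ [(role False i, Var 5, Var 6), (role True i, Var 5, Var 6)]" for i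
  define \<Sigma>' where "\<Sigma>' = map (\<lambda>(g, ls). (g, clause ls)) \<Sigma> @ map (\<lambda>i. (Truth, pair i)) [0..<\<kappa>]"
  have len: "length \<Sigma>' = m"
    by (simp add: \<Sigma>'_def m_def)
  have mem: "(\<exists>ls. (g, ls) \<in> set \<Sigma> \<and> ls' = clause ls) \<or> (\<exists>i<\<kappa>. g = Truth \<and> ls' = pair i)"
    if "(g, ls') \<in> set \<Sigma>'" for g ls'
    using that by (auto simp: \<Sigma>'_def)
  show ?thesis
  proof (rule reducible_of_coloring_schemas[where \<Sigma> = \<Sigma>' and B = B and R = "F + 1 + (k - 2)"])
    show "below 3 B" "2 \<le> val B (input_env w)" for w
      using B by (simp_all add: b_def)
    show "0 < k"
      using k by simp
    show "scoped 8 g \<and> free_vars g \<subseteq> schema_vars" if "(g, ls) \<in> set \<Sigma>'" for g ls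
      using mem[OF that] guard by auto
    show "length \<Sigma>' \<le> r \<and> r < F + 1 + (k - 2) \<and> term_vars s \<subseteq> schema_vars \<and> term_vars t \<subseteq> schema_vars"
      if g: "(g, ls) \<in> set \<Sigma>'" and rst: "(r, s, t) \<in> set ls" for g ls r s t
      using mem[OF g]
    proof (elim disjE exE conjE)
      fix ls' assume ls': "(g, ls') \<in> set \<Sigma>" "ls = clause ls'"
      then consider "(r, s, t) \<in> set ((F, Const 0, Const 0) # univs)"
        | sg K where "(sg, K, s, t) \<in> set ls'" "r = role sg (to_nat K)"
        using mem_clause[OF rst[unfolded ls'(2)]] by blast
      then show ?thesis
      proof cases
        case 2
        then show ?thesis
          using to_nat_less[OF ls'(1) 2(1)] lits[OF ls'(1) 2(1)] by (auto simp: len role_def F_def)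
      qed (auto simp: univs_def len F_def)
    next
      fix i assume "i < \<kappa>" "ls = pair i"
      then show ?thesis
        using rst by (auto simp: pair_def univs_def len F_def role_def)
    qed
    show "val s (schema_env w x y z) < val B (input_env w) \<and> val t (schema_env w x y z) < val B (input_env w)"
      if g: "(g, ls) \<in> set \<Sigma>'" and rst: "(r, s, t) \<in> set ls"
        and xyz: "x < val B (input_env w)" "y < val B (input_env w)" "z < val B (input_env w)"
        and ev: "eval g w (schema_env w x y z)" for w g ls r s t x y z
      using mem[OF g]
    proof (elim disjE exE conjE)
      fix ls' assume ls': "(g, ls') \<in> set \<Sigma>" "ls = clause ls'"
      then consider "(r, s, t) \<in> set ((F, Const 0, Const 0) # univs)"
        | sg K where "(sg, K, s, t) \<in> set ls'" "r = role sg (to_nat K)"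
        using mem_clause[OF rst[unfolded ls'(2)]] by blast
      then show ?thesis
      proof cases
        case 2
        then show ?thesis
          using range[OF ls'(1) 2(1), of x w y z] xyz ev by (simp add: b_def)
      qed (use xyz(1) in \<open>auto simp: univs_def\<close>)
    next
      fix i assume "i < \<kappa>" "ls = pair i"
      then show ?thesis
        using rst xyz by (auto simp: pair_def univs_def schema_env_def)
    qed
    show "(Truth, pair 0) \<in> set \<Sigma>'"
      using \<kappa>(2) by (auto simp: \<Sigma>'_def)
    show "length \<Sigma>' \<le> F + 1 + (k - 2)"
      by (simp add: len F_def)
    fix w
    show "w \<in> L \<longleftrightarrow> (\<exists>col :: nat \<Rightarrow> nat \<Rightarrow> nat \<Rightarrow> nat. \<forall>(g, ls)\<in>set \<Sigma>'. \<forall>x<val B (input_env w).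
      \<forall>y<val B (input_env w). \<forall>z<val B (input_env w). eval g w (schema_env w x y z) \<longrightarrow>
      (\<forall>c<k. sees_color col (schema_env w x y z) ls c))"
      (is "_ \<longleftrightarrow> (\<exists>col. \<forall>(g, ls)\<in>set \<Sigma>'. ?P col g ls)")
    proof
      assume "w \<in> L"
      then obtain V where V0: "\<forall>(g, ls)\<in>set \<Sigma>. \<forall>x<b w. \<forall>y<b w. \<forall>z<b w.
        eval g w (schema_env w x y z) \<longrightarrow>
        (clause_holds V (schema_env w x y z) ls)"
        unfolding L by (rule exE)
      have V: "clause_holds V (schema_env w x y z) ls"
        if "(g, ls) \<in> set \<Sigma>" "x < b w" "y < b w" "z < b w" "eval g w (schema_env w x y z)" for g ls x y z
        using bspec[OF V0 that(1)] that(2-5) by simp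
      \<comment> \<open>The vertex \<open>F\<close> gets colour 0, a true literal 1, a false literal
        0, and the universal vertices get the colours from 2 on. The parity of \<open>r - m\<close>
        recovers the sign encoded by \<open>role\<close>.\<close>
      define col where "col r x y = (if F < r then r - F - 1 + 2 else if r = F then 0
        else of_bool (V (from_nat ((r - m) div 2) :: 'k) x y = odd (r - m)))" for r x y
      have col_role: "col (role sg i) x y = of_bool (V (from_nat i) x y = sg)" if "i < \<kappa>" for sg i x y
        using that by (auto simp: col_def role_def F_def)
      have univ: "sees_color col e univs c" if "2 \<le> c" "c < k" for c e
      proof -
        obtain u where u: "c = 2 + u"
          using \<open>2 \<le> c\<close> le_Suc_ex by blast
        have "(F + 1 + u, Const 0, Const 0) \<in> set univs"
          unfolding univs_def set_map set_upt using \<open>c < k\<close> u by (intro image_eqI[of _ _ u]) auto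
        moreover have "col (F + 1 + u) 0 0 = c"
          by (simp add: col_def u)
        ultimately show ?thesis
          by (intro bexI[of _ "(F + 1 + u, Const 0, Const 0)"]) auto
      qed
      have "?P col g ls'" if "(g, ls') \<in> set \<Sigma>'" for g ls'
        using mem[OF that]
      proof (elim disjE exE conjE)
        fix ls assume ls: "(g, ls) \<in> set \<Sigma>" "ls' = clause ls"
        show ?thesis
        proof (intro allI impI)
          fix x y z c assume xyz: "x < val B (input_env w)" "y < val B (input_env w)" "z < val B (input_env w)"
            and ev: "eval g w (schema_env w x y z)" and c: "c < k"
          let ?e = "schema_env w x y z"
          obtain sg K s t where lit: "(sg, K, s, t) \<in> set ls" "V K (val s ?e) (val t ?e) = sg"
            using V[OF ls(1) _ _ _ ev] xyz by (auto simp: b_def)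
          then have one: "col (role sg (to_nat K)) (val s ?e) (val t ?e) = 1"
            using to_nat_less[OF ls(1) lit(1)] by (simp add: col_role)
          have role: "(role sg (to_nat K), s, t) \<in> set ls'"
            using lit(1) by (force simp: ls(2) clause_def)
          consider "c = 0" | "c = 1" | "2 \<le> c"
            by linarith
          then show "sees_color col ?e ls' c"
          proof cases
            case 1
            then show ?thesis
              by (intro bexI[of _ "(F, Const 0, Const 0)"]) (simp_all add: ls(2) clause_def col_def)
          next
            case 2
            then show ?thesis
              using one by (intro bexI[OF _ role]) simp
          next
            case 3
            then show ?thesis
              using univ[OF 3 c, of ?e] by (auto simp: ls(2) clause_def)
          qed
        qed
      next
        fix i assume i: "i < \<kappa>" "ls' = pair i"
        show ?thesis
        proof (intro allI impI)
          fix x y z c assume c: "c < k"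
          let ?e = "schema_env w x y z"
          consider "2 \<le> c" | "c = of_bool (V (from_nat i) x y = True)" | "c = of_bool (V (from_nat i) x y = False)"
            by (cases "V (from_nat i) x y") (auto simp: of_bool_def, linarith+)
          then show "sees_color col ?e ls' c"
          proof cases
            case 1
            then show ?thesis
              using univ[of c ?e] c by (auto simp: i(2) pair_def)
          next
            case 2
            then show ?thesis
              by (intro bexI[of _ "(role True i, Var 5, Var 6)"]) (auto simp: i(2) pair_def col_role[OF i(1)] schema_env_def)
          next
            case 3
            then show ?thesis
              by (intro bexI[of _ "(role False i, Var 5, Var 6)"]) (auto simp: i(2) pair_def col_role[OF i(1)] schema_env_def)
          qed
        qed
      qed
      then show "\<exists>col. \<forall>(g, ls)\<in>set \<Sigma>'. ?P col g ls"
        by (intro exI[of _ col]) blast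
    next
      assume "\<exists>col. \<forall>(g, ls)\<in>set \<Sigma>'. ?P col g ls"
      then obtain col where col: "\<And>g ls. (g, ls) \<in> set \<Sigma>' \<Longrightarrow> ?P col g ls"
        by blast
      obtain c1 c2 where c12: "c1 < k" "c2 < k" "c1 \<noteq> c2"
        "\<And>u. u < k - 2 \<Longrightarrow> col (F + 1 + u) 0 0 \<noteq> c1 \<and> col (F + 1 + u) 0 0 \<noteq> c2"
        using two_unused_colors[OF k, of "\<lambda>u. col (F + 1 + u) 0 0"] by blast
      \<comment> \<open>This colour plays the truth value \<open>True\<close>: no universal vertex
        has it, and neither has \<open>F\<close>. A clause must see it, and only one of its literals
        can provide it.\<close>
      define c where "c = (if col F 0 0 = c1 then c2 else c1)"
      define V where "V K x y \<longleftrightarrow> col (role True (to_nat (K :: 'k))) x y = c" for K x y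
      have c: "c < k" "c \<noteq> col F 0 0" "c = c1 \<or> c = c2"
        using c12 by (auto simp: c_def)
      have no_univ: "col r (val s e) (val t e) \<noteq> a"
        if univ: "(r, s, t) \<in> set univs" and a: "a = c1 \<or> a = c2" for r s t e a
      proof -
        obtain u where "u < k - 2" "r = F + 1 + u" "s = Const 0" "t = Const 0"
          using univ by (auto simp: univs_def)
        then show ?thesis
          using c12(4)[of u] a by auto
      qed
      have pairs: "col (role False i) x y = a \<or> col (role True i) x y = a"
        if i: "i < \<kappa>" and xy: "x < b w" "y < b w" and a: "a = c1 \<or> a = c2" for i x y a
      proof -
        have "(Truth, pair i) \<in> set \<Sigma>'"
          using i by (auto simp: \<Sigma>'_def)
        then have "sees_color col (schema_env w x y 0) (pair i) a"
          using col[of Truth "pair i"] xy a c12(1,2) B(2)[of w] by (auto simp: b_def)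
        then show ?thesis
          using no_univ[OF _ a] by (auto simp: pair_def schema_env_def)
      qed
      have sat: "clause_holds V (schema_env w x y z) ls"
        if g: "(g, ls) \<in> set \<Sigma>" and xyz: "x < b w" "y < b w" "z < b w" and ev: "eval g w (schema_env w x y z)"
        for g ls x y z
      proof -
        let ?e = "schema_env w x y z"
        have "(g, clause ls) \<in> set \<Sigma>'"
          using g by (force simp: \<Sigma>'_def)
        then have "sees_color col ?e (clause ls) c"
          using col[of g "clause ls"] xyz ev c(1) by (auto simp: b_def)
        then obtain r s t where r: "(r, s, t) \<in> set (clause ls)" "col r (val s ?e) (val t ?e) = c"
          by blast
        then obtain sg K where lit: "(sg, K, s, t) \<in> set ls" "r = role sg (to_nat K)"
        proof -
          have "(r, s, t) \<notin> set ((F, Const 0, Const 0) # univs)"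
            using no_univ[OF _ c(3), of r s t ?e] r(2) c(2) by auto
          then show thesis
            using mem_clause[OF r(1)] that by blast
        qed
        have "V K (val s ?e) (val t ?e) = sg"
        proof (cases sg)
          case True
          then show ?thesis
            using r(2) lit(2) by (simp add: V_def)
        next
          case False
          \<comment> \<open>No universal vertex has colour \<open>c1\<close> or \<open>c2\<close>,
            so two opposite literals share these colours. If the negative one has colour
            \<open>c\<close>, the positive one has the other.\<close>
          have "col (role False (to_nat K)) (val s ?e) (val t ?e) = a \<or>
              col (role True (to_nat K)) (val s ?e) (val t ?e) = a" if "a = c1 \<or> a = c2" for a
            using range[OF g lit(1) xyz ev] to_nat_less[OF g lit(1)] that by (intro pairs) auto
          then have "col (role True (to_nat K)) (val s ?e) (val t ?e) \<noteq> c"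
            using r(2) lit(2) False c(3) c12(3) by metis
          then show ?thesis
            using False by (simp add: V_def)
        qed
        then show ?thesis
          using lit(1) by blast
      qed
      show "w \<in> L"
        unfolding L
      proof (intro exI[of _ V] ballI)
        fix gls assume gls: "gls \<in> set \<Sigma>"
        obtain g ls where "gls = (g, ls)"
          by fastforce
        then show "case gls of (g, ls) \<Rightarrow> \<forall>x<b w. \<forall>y<b w. \<forall>z<b w. eval g w (schema_env w x y z) \<longrightarrow>
            (clause_holds V (schema_env w x y z) ls)"
          using sat gls by simp
      qed
    qed
  qed
qed

section \<open>Computations as clauses\<close>

text \<open>This is Horner's scheme.\<close>

definition poly_term :: "nat poly \<Rightarrow> trm \<Rightarrow> trm" where
  "poly_term p t = foldr (\<lambda>a u. Add (Const a) (Mult t u)) (coeffs p) (Const 0)"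

lemma val_poly_term [simp]: "val (poly_term p t) e = poly p (val t e)"
proof -
  have "val (foldr (\<lambda>a u. Add (Const a) (Mult t u)) as (Const 0)) e =
      foldr (\<lambda>a b. a + val t e * b) as 0" for as
    by (induction as) auto
  moreover have "poly (Poly as) x = foldr (\<lambda>a b. a + x * b) as 0" for as and x :: nat
    by (induction as) auto
  ultimately show ?thesis
    unfolding poly_term_def by (metis Poly_coeffs)
qed

lemma vars_poly_term: "term_vars (poly_term p t) \<subseteq> term_vars t"
proof -
  have "term_vars (foldr (\<lambda>a u. Add (Const a) (Mult t u)) as (Const 0)) \<subseteq> term_vars t" for as
    by (induction as) auto
  then show ?thesis
    unfolding poly_term_def .
qed

lemma length_pair_word: "length (pair_word xs ys) = 2 * length xs + 1 + length ys"
  by (induction xs) (auto simp: pair_word_def)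

lemma nth_pair_word:
  "i < length xs \<Longrightarrow> pair_word xs ys ! (2 * i)"
  "i < length xs \<Longrightarrow> pair_word xs ys ! (2 * i + 1) = xs ! i"
  "\<not> pair_word xs ys ! (2 * length xs)"
  "pair_word xs ys ! (2 * length xs + 1 + i) = ys ! i"
proof -
  have Nil: "pair_word [] ys = False # ys"
    by (simp add: pair_word_def)
  have Cons: "pair_word (b # xs) ys = True # b # pair_word xs ys" for b xs
    by (simp add: pair_word_def)
  show "i < length xs \<Longrightarrow> pair_word xs ys ! (2 * i)"
  proof (induction xs arbitrary: i)
    case (Cons b xs)
    then show ?case by (cases i) (auto simp: \<open>\<And>b xs. pair_word (b # xs) ys = _\<close>)
  qed simp
  show "i < length xs \<Longrightarrow> pair_word xs ys ! (2 * i + 1) = xs ! i"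
  proof (induction xs arbitrary: i)
    case (Cons b xs)
    then show ?case by (cases i) (auto simp: \<open>\<And>b xs. pair_word (b # xs) ys = _\<close>)
  qed simp
  show "\<not> pair_word xs ys ! (2 * length xs)"
    by (induction xs) (auto simp: Cons Nil)
  show "pair_word xs ys ! (2 * length xs + 1 + i) = ys ! i"
    by (induction xs) (auto simp: Cons Nil)
qed

section \<open>Runs of a Turing machine\<close>

text \<open>The transition function is continued to the halting state by idling, so that a step is
  described in the same way before and after halting.\<close>

definition transition :: "tm \<Rightarrow> nat \<Rightarrow> nat list \<Rightarrow> nat \<times> (nat \<times> move) list" where
  "transition M q as = (if q < num_states M then delta M q as else (q, map (\<lambda>a. (a, Stay)) as))"

lemma map2_act_read: "map2 act (map (\<lambda>a. (a, Stay)) (map read ts)) ts = ts"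
  by (induction ts) (auto simp: act_id)

lemma step_transition:
  "step M (q, ts) = (fst (transition M q (map read ts)), map2 act (snd (transition M q (map read ts))) ts)"
proof (cases "q < num_states M")
  case True
  then show ?thesis by (simp add: step_def transition_def split_def)
next
  case False
  then show ?thesis
    using map2_act_read[of ts] by (simp add: step_def transition_def)
qed

lemma transition_bounds:
  assumes "turing_machine M" "q \<le> num_states M" "length as = num_tapes M" "set as \<subseteq> {..<num_syms M}"
  shows "fst (transition M q as) \<le> num_states M" "length (snd (transition M q as)) = num_tapes M"
    "j < num_tapes M \<Longrightarrow> fst (snd (transition M q as) ! j) < num_syms M"
proof -
  have "fst (transition M q as) \<le> num_states M \<and> length (snd (transition M q as)) = num_tapes M \<and>
      fst ` set (snd (transition M q as)) \<subseteq> {..<num_syms M}"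
  proof (cases "q < num_states M")
    case True
    then show ?thesis
      using assms by (auto simp: turing_machine_def transition_def split_def)
  next
    case False
    then show ?thesis
      using assms by (auto simp: transition_def)
  qed
  then show "fst (transition M q as) \<le> num_states M" "length (snd (transition M q as)) = num_tapes M"
    "j < num_tapes M \<Longrightarrow> fst (snd (transition M q as) ! j) < num_syms M"
    by (auto simp: image_subset_iff)
qed

lemma read_eq: "read t = fst t (snd t)"
  by (cases t) simp

definition valid_config :: "tm \<Rightarrow> config \<Rightarrow> bool" where
  "valid_config M c \<longleftrightarrow> fst c \<le> num_states M \<and> length (snd c) = num_tapes M \<and>
     (\<forall>j<num_tapes M. \<forall>i. fst (snd c ! j) i < num_syms M)"

lemma set_map_read:
  assumes "valid_config M c"
  shows "set (map read (snd c)) \<subseteq> {..<num_syms M}"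
proof
  fix a assume "a \<in> set (map read (snd c))"
  then obtain j where "j < num_tapes M" "a = read (snd c ! j)"
    using assms by (auto simp: in_set_conv_nth valid_config_def)
  then show "a \<in> {..<num_syms M}"
    using assms by (auto simp: valid_config_def read_eq)
qed

lemma step_nth:
  assumes "turing_machine M" "valid_config M c" "j < num_tapes M"
  shows "snd (step M c) ! j = act (snd (transition M (fst c) (map read (snd c))) ! j) (snd c ! j)"
proof -
  have "length (snd (transition M (fst c) (map read (snd c)))) = num_tapes M"
    using assms set_map_read[OF assms(2)] by (intro transition_bounds) (auto simp: valid_config_def)
  then show ?thesis
    using assms by (cases c) (auto simp: step_transition valid_config_def)
qed

lemma fst_step: "fst (step M c) = fst (transition M (fst c) (map read (snd c)))"
  by (cases c) (simp add: step_transition)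

lemma fst_act: "fst (act am t) = (fst t)(snd t := fst am)"
  by (cases am; cases t) simp

lemma snd_act: "snd (act am t) = snd t + offset (snd am)"
  by (cases am; cases t) simp

lemma valid_config_step:
  assumes M: "turing_machine M" and c: "valid_config M c"
  shows "valid_config M (step M c)"
proof -
  let ?tr = "transition M (fst c) (map read (snd c))"
  have tr: "fst ?tr \<le> num_states M" "length (snd ?tr) = num_tapes M"
    "\<And>j. j < num_tapes M \<Longrightarrow> fst (snd ?tr ! j) < num_syms M"
    using transition_bounds[OF M, of "fst c" "map read (snd c)"] set_map_read[OF c] c
    by (auto simp: valid_config_def)
  have "length (snd (step M c)) = num_tapes M"
    using tr(2) c by (cases c) (auto simp: step_transition valid_config_def)
  moreover have "fst (snd (step M c) ! j) i < num_syms M" if "j < num_tapes M" for i j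
    using tr(3)[OF that] c that by (auto simp: step_nth[OF M c that] fst_act valid_config_def)
  ultimately show ?thesis
    using tr(1) by (auto simp: valid_config_def fst_step)
qed

lemma valid_config_init:
  assumes "turing_machine M"
  shows "valid_config M (init_config M xs)"
  using assms
  by (auto simp: valid_config_def init_config_def turing_machine_def input_tape_def blank_tape_def
      bit_sym_def nth_Cons')

lemma valid_config_run:
  assumes "turing_machine M"
  shows "valid_config M ((step M ^^ t) (init_config M xs))"
  using assms by (induction t) (auto intro: valid_config_init valid_config_step)

text \<open>In \<open>T\<close> steps the heads stay between \<open>-T\<close> and \<open>T\<close>;
  a tableau with finitely many cells therefore suffices.\<close>

lemma head_bound:
  assumes "turing_machine M" "j < num_tapes M"
  shows "\<bar>snd (snd ((step M ^^ t) (init_config M xs)) ! j)\<bar> \<le> int t"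
proof (induction t)
  case 0
  then show ?case
    using assms by (auto simp: init_config_def input_tape_def blank_tape_def nth_Cons')
next
  case (Suc t)
  have off: "\<bar>offset m\<bar> \<le> 1" for m
    by (cases m) auto
  have "\<bar>a + offset m\<bar> \<le> 1 + int t" if "\<bar>a\<bar> \<le> int t" for a m
    using that off[of m] by linarith
  then show ?case
    using Suc step_nth[OF assms(1) valid_config_run[OF assms(1)] assms(2), of t xs]
    by (simp add: snd_act)
qed

lemma input_tape_int: "fst (input_tape w) (int i) = (if i < length w then bit_sym (w ! i) else 0)"
  by (simp add: input_tape_def)

text \<open>Cells of the tableau are natural numbers: cell \<open>p\<close> stands for the tape
  position \<open>p - T\<close>, where \<open>T\<close> is the time horizon.\<close>

lemma input_tape_pair_word:
  "fst (input_tape (pair_word xs ys)) (int p - int T) =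
    (if p < T then 0
     else if p - T < 2 * length xs then (if even (p - T) then 2 else bit_sym (xs ! ((p - T) div 2)))
     else if p - T = 2 * length xs then 1
     else if p - T < 2 * length xs + 1 + length ys then bit_sym (ys ! (p - T - (2 * length xs + 1)))
     else 0)"
proof (cases "p < T")
  case False
  define i where "i = p - T"
  have p: "int p - int T = int i"
    using False by (simp add: i_def)
  consider "i < 2 * length xs" "even i" | "i < 2 * length xs" "odd i" | "i = 2 * length xs"
    | "2 * length xs + 1 \<le> i"
    by linarith
  then show ?thesis
  proof cases
    case 1
    then obtain l where l: "i = 2 * l" by blast
    show ?thesis
      using 1 l False nth_pair_word(1)[of l xs ys]
      unfolding p i_def[symmetric] input_tape_int by (simp add: length_pair_word bit_sym_def)
  next
    case 2
    then obtain l where l: "i = 2 * l + 1" using oddE by blast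
    show ?thesis
      using 2 l False nth_pair_word(2)[of l xs ys]
      unfolding p i_def[symmetric] input_tape_int by (simp add: length_pair_word)
  next
    case 3
    then show ?thesis
      using False nth_pair_word(3)[of xs ys]
      unfolding p i_def[symmetric] input_tape_int by (simp add: length_pair_word bit_sym_def)
  next
    case 4
    then show ?thesis
      using False nth_pair_word(4)[of xs ys "i - (2 * length xs + 1)"]
      unfolding p i_def[symmetric] input_tape_int by (auto simp: length_pair_word)
  qed
qed (simp add: input_tape_def)

section \<open>The tableau and its clauses\<close>

text \<open>An atom takes a time and a cell as arguments. \<open>Read j a\<close> says that head
  \<open>j\<close> scans \<open>a\<close>, wherever the head is; its second argument is always 0.
  With such facts a transition clause can depend on the symbols under all heads without naming their
  positions.\<close>

datatype atom = State nat | Head nat | Cell nat nat | Read nat nat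

instance atom :: countable
  by countable_datatype

lemma schema_env_simps [simp]:
  "schema_env w x y z 2 = length w" "schema_env w x y z 5 = x"
  "schema_env w x y z 6 = y" "schema_env w x y z 7 = z"
  by (simp_all add: schema_env_def input_env_def)

type_synonym literal = "bool \<times> atom \<times> trm \<times> trm"

locale tableau =
  fixes M :: tm and p q :: "nat poly"
  assumes M: "turing_machine M"
begin

text \<open>\<open>X\<close> is a time and \<open>Y\<close> a cell. \<open>Z\<close> is a second
  cell, or an index into the word in some clauses about the input.\<close>

abbreviation X where "X \<equiv> Var 5"
abbreviation Y where "Y \<equiv> Var 6"
abbreviation Z where "Z \<equiv> Var 7"

text \<open>\<open>Tot\<close> bounds the length of the pair of word and certificate. The horizon
  adds it to the running time, so the window around position 0 also contains the whole input.
  \<open>Bound\<close> exceeds all times up to the horizon and all cells of the window, whose origin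
  is the cell numbered by the horizon.\<close>

definition Tot :: trm where
  "Tot = Add (Add (Mult (Const 2) (Var 2)) (Const 1)) (poly_term q (Var 2))"

definition Horizon :: trm where
  "Horizon = Add (poly_term p Tot) Tot"

definition Bound :: trm where
  "Bound = Add (Mult (Const 2) Horizon) (Const 2)"

definition tot :: "nat \<Rightarrow> nat" where
  "tot n = 2 * n + 1 + poly q n"

definition horizon :: "nat \<Rightarrow> nat" where
  "horizon n = poly p (tot n) + tot n"

definition bound :: "nat \<Rightarrow> nat" where
  "bound n = 2 * horizon n + 2"

lemma val_terms [simp]:
  "val Tot (schema_env w x y z) = tot (length w)"
  "val Horizon (schema_env w x y z) = horizon (length w)"
  "val Bound (schema_env w x y z) = bound (length w)"
  "val Bound (input_env w) = bound (length w)"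
  by (simp_all add: Tot_def Horizon_def Bound_def tot_def horizon_def bound_def input_env_def)

lemma vars_terms: "term_vars Tot \<subseteq> {2}" "term_vars Horizon \<subseteq> {2}" "term_vars Bound \<subseteq> {2}"
proof -
  show 1: "term_vars Tot \<subseteq> {2}"
    using vars_poly_term[of q "Var 2"] by (simp add: Tot_def)
  show "term_vars Horizon \<subseteq> {2}"
    using vars_poly_term[of p Tot] 1 by (auto simp: Horizon_def)
  then show "term_vars Bound \<subseteq> {2}"
    by (simp add: Bound_def)
qed

lemma below_terms: "2 < d \<Longrightarrow> below d Tot" "2 < d \<Longrightarrow> below d Horizon" "2 < d \<Longrightarrow> below d Bound"
  using vars_terms by (auto intro!: below_if_vars)

definition offset_guard :: "move \<Rightarrow> fml" where
  "offset_guard m = (case m of Left \<Rightarrow> Eq Y (Add Z (Const 1)) | Stay \<Rightarrow> Eq Z Y | Right \<Rightarrow> Eq Z (Add Y (Const 1)))"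

text \<open>This is the negated premise of a step: at time \<open>X\<close> the state is
  \<open>s\<close> and the heads scan \<open>as\<close>.\<close>

definition situation :: "nat \<Rightarrow> nat list \<Rightarrow> literal list" where
  "situation s as = (False, State s, X, Const 0) #
     map (\<lambda>j. (False, Read j (as ! j), X, Const 0)) [0..<num_tapes M]"

abbreviation Start :: fml where "Start \<equiv> Eq X (Const 0)"
abbreviation Running :: fml where "Running \<equiv> Less X Horizon"
abbreviation Next :: trm where "Next \<equiv> Add X (Const 1)"

definition initial_clauses :: "(fml \<times> literal list) set" where
  "initial_clauses =
    {(Start, [(True, State 0, X, Const 0)])} \<union>
    {(Conj Start (Eq Y Horizon), [(True, Head j, X, Y)]) |j. j < num_tapes M} \<union>
    {(Start, [(True, Cell j 0, X, Y)]) |j. 1 \<le> j \<and> j < num_tapes M}"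

text \<open>The bits of the certificate are not determined by the input: their cells contain \<open>1\<close> or \<open>2\<close>
  up to some position and are blank from there on.\<close>

definition input_clauses :: "(fml \<times> literal list) set" where
  "input_clauses =
    {(Conj Start (Less Y Horizon), [(True, Cell 0 0, X, Y)]),
     (Conj Start (Conj (Less Z (Var 2)) (Eq Y (Add Horizon (Mult (Const 2) Z)))), [(True, Cell 0 2, X, Y)]),
     (Conj Start (Conj (Less Z (Var 2)) (Conj (Bit Z) (Eq Y (Add Horizon (Add (Mult (Const 2) Z) (Const 1)))))),
        [(True, Cell 0 2, X, Y)]),
     (Conj Start (Conj (Less Z (Var 2)) (Conj (Neg (Bit Z)) (Eq Y (Add Horizon (Add (Mult (Const 2) Z) (Const 1)))))),
        [(True, Cell 0 1, X, Y)]),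
     (Conj Start (Eq Y (Add Horizon (Mult (Const 2) (Var 2)))), [(True, Cell 0 1, X, Y)]),
     (Conj Start (Conj (Less (Add Horizon (Mult (Const 2) (Var 2))) Y) (Less Y (Add Horizon Tot))),
        [(True, Cell 0 0, X, Y), (True, Cell 0 1, X, Y), (True, Cell 0 2, X, Y)]),
     (Conj Start (Conj (Less (Add Horizon (Mult (Const 2) (Var 2))) Y) (Eq Z (Add Y (Const 1)))),
        [(False, Cell 0 0, X, Y), (True, Cell 0 0, X, Z)]),
     (Conj Start (Neg (Less Y (Add Horizon Tot))), [(True, Cell 0 0, X, Y)])}"

definition read_clauses :: "(fml \<times> literal list) set" where
  "read_clauses =
    {(Truth, [(False, Head j, X, Y), (False, Cell j a, X, Y), (True, Read j a, X, Const 0)]) |j a.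
       j < num_tapes M \<and> a < num_syms M}"

definition symbol_vectors :: "nat list set" where
  "symbol_vectors = {as. length as = num_tapes M \<and> set as \<subseteq> {..<num_syms M}}"

definition step_clauses :: "(fml \<times> literal list) set" where
  "step_clauses =
    {(Running, situation s as @ [(True, State (fst (transition M s as)), Next, Const 0)]) |s as.
       s \<le> num_states M \<and> as \<in> symbol_vectors} \<union>
    {(Conj Running (offset_guard (snd (snd (transition M s as) ! j))),
        situation s as @ [(False, Head j, X, Y), (True, Head j, Next, Z)]) |s as j.
       s \<le> num_states M \<and> as \<in> symbol_vectors \<and> j < num_tapes M} \<union>
    {(Running, situation s as @
        [(False, Head j, X, Y), (True, Cell j (fst (snd (transition M s as) ! j)), Next, Y)]) |s as j.
       s \<le> num_states M \<and> as \<in> symbol_vectors \<and> j < num_tapes M} \<union>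
    {(Conj Running (Neg (Eq Y Z)),
        [(False, Head j, X, Z), (False, Cell j a, X, Y), (True, Cell j a, Next, Y)]) |j a.
       j < num_tapes M \<and> a < num_syms M}"

text \<open>Symbol 1 at position 0 of the output tape is the answer \<open>False\<close>. This is
  the only clause without a positive literal, so it alone can refute the facts of a run.\<close>

definition final_clauses :: "(fml \<times> literal list) set" where
  "final_clauses =
    {(Conj (Eq X Horizon) (Eq Y Horizon), [(False, Cell (num_tapes M - 1) 1, X, Y)])}"

definition clauses :: "(fml \<times> literal list) set" where
  "clauses = initial_clauses \<union> input_clauses \<union> read_clauses \<union> step_clauses \<union> final_clauses"

definition satisfies :: "bool list \<Rightarrow> (atom \<Rightarrow> nat \<Rightarrow> nat \<Rightarrow> bool) \<Rightarrow> fml \<times> literal list \<Rightarrow> bool" where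
  "satisfies w V = (\<lambda>(g, ls). \<forall>x<bound (length w). \<forall>y<bound (length w). \<forall>z<bound (length w).
     eval g w (schema_env w x y z) \<longrightarrow>
     (clause_holds V (schema_env w x y z) ls))"

text \<open>The schemas depend on the machine and the polynomials only. Being finitely many, they
  can be built into the formulas of the reduction.\<close>

lemma finite_clauses: "finite clauses"
proof -
  have fv: "finite symbol_vectors"
    unfolding symbol_vectors_def
    using finite_lists_length_eq[of "{..<num_syms M}" "num_tapes M"] by (simp add: conj_commute)
  have 1: "finite {f j |j. j < n \<and> P j}" for f :: "nat \<Rightarrow> 'b" and n P
    by (rule finite_subset[of _ "f ` {..<n}"]) auto
  have 2: "finite {f j a |j a. j < n \<and> a < m}" for f :: "nat \<Rightarrow> nat \<Rightarrow> 'b" and n m :: nat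
    by (rule finite_subset[of _ "(\<lambda>(j, a). f j a) ` ({..<n} \<times> {..<m})"]) auto
  have 3: "finite {f s as |s as. s \<le> n \<and> as \<in> symbol_vectors}" for f :: "nat \<Rightarrow> nat list \<Rightarrow> 'b" and n :: nat
    by (rule finite_subset[of _ "(\<lambda>(s, as). f s as) ` ({..n} \<times> symbol_vectors)"]) (use fv in auto)
  have 4: "finite {f s as j |s as j. s \<le> n \<and> as \<in> symbol_vectors \<and> j < m}"
    for f :: "nat \<Rightarrow> nat list \<Rightarrow> nat \<Rightarrow> 'b" and n m :: nat
    by (rule finite_subset[of _ "(\<lambda>(s, as, j). f s as j) ` ({..n} \<times> symbol_vectors \<times> {..<m})"]) (use fv in \<open>force+\<close>)
  have 5: "finite {f j |j. j < n}" for f :: "nat \<Rightarrow> 'b" and n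
    by (rule finite_subset[of _ "f ` {..<n}"]) auto
  have 6: "finite {f j |j. 1 \<le> j \<and> j < n}" for f :: "nat \<Rightarrow> 'b" and n
    by (rule finite_subset[of _ "f ` {..<n}"]) auto
  show ?thesis
    unfolding clauses_def initial_clauses_def input_clauses_def read_clauses_def step_clauses_def final_clauses_def
    by (intro finite_UnI finite_insert[THEN iffD2] finite.emptyI 2 3 4 5 6)
qed

lemma clauses_wf:
  assumes "(g, ls) \<in> clauses"
  shows "scoped 8 g \<and> free_vars g \<subseteq> schema_vars"
    and "(sg, K, s, t) \<in> set ls \<Longrightarrow> term_vars s \<subseteq> schema_vars \<and> term_vars t \<subseteq> schema_vars"
proof -
  have og: "scoped 8 (offset_guard m)" "free_vars (offset_guard m) \<subseteq> schema_vars" for m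
    by (cases m; simp add: offset_guard_def)+
  have og': "i = 2 \<or> i = 5 \<or> i = 6 \<or> i = 7" if "i \<in> free_vars (offset_guard m)" for i m
    using og(2)[of m] that by auto
  have tv': "i = 2" if "i \<in> term_vars Horizon" for i
    using vars_terms that by auto
  have tv: "term_vars Tot \<subseteq> schema_vars" "term_vars Horizon \<subseteq> schema_vars"
    using vars_terms by auto
  show "scoped 8 g \<and> free_vars g \<subseteq> schema_vars"
    using assms og(1) tv below_terms[of 8]
    unfolding clauses_def initial_clauses_def input_clauses_def read_clauses_def step_clauses_def final_clauses_def
    by (elim UnE; auto dest: og' tv')
  show "(sg, K, s, t) \<in> set ls \<Longrightarrow> term_vars s \<subseteq> schema_vars \<and> term_vars t \<subseteq> schema_vars"
    using assms
    unfolding clauses_def initial_clauses_def input_clauses_def read_clauses_def step_clauses_def final_clauses_def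
    by (elim UnE; auto simp: situation_def)
qed

text \<open>Only the argument \<open>Next\<close> could leave the range, and it occurs under the
  guard \<open>Running\<close>.\<close>

lemma clauses_range:
  assumes "(g, ls) \<in> clauses" "(sg, K, s, t) \<in> set ls"
    "x < bound (length w)" "y < bound (length w)" "z < bound (length w)" "eval g w (schema_env w x y z)"
  shows "val s (schema_env w x y z) < bound (length w) \<and> val t (schema_env w x y z) < bound (length w)"
proof -
  have b: "0 < bound n" "x < horizon n \<Longrightarrow> x + 1 < bound n" for n x
    by (auto simp: bound_def)
  show ?thesis
    using assms b
    unfolding clauses_def initial_clauses_def input_clauses_def read_clauses_def step_clauses_def final_clauses_def
    by (elim UnE; auto simp: situation_def)
qed

section \<open>A certificate from a satisfying assignment\<close>

lemma bounds:
  "tot n \<le> horizon n" "horizon n < bound n" "horizon n + tot n < bound n" "2 * n < tot n" "0 < bound n"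
  "2 * n + 1 + poly q n = tot n"
  by (auto simp: horizon_def bound_def tot_def)

lemma satisfiesD:
  assumes "\<forall>cl\<in>clauses. satisfies w V cl" "(g, ls) \<in> clauses"
    "x < bound (length w)" "y < bound (length w)" "z < bound (length w)" "eval g w (schema_env w x y z)"
  shows "clause_holds V (schema_env w x y z) ls"
  using bspec[OF assms(1,2)] assms(3-6) by (auto simp: satisfies_def)

lemma sat_initial:
  assumes sat: "\<forall>cl\<in>clauses. satisfies w V cl"
  shows "V (State 0) 0 0" "j < num_tapes M \<Longrightarrow> V (Head j) 0 (horizon (length w))"
    "1 \<le> j \<Longrightarrow> j < num_tapes M \<Longrightarrow> y < bound (length w) \<Longrightarrow> V (Cell j 0) 0 y"
proof -
  note b = bounds[of "length w"]
  have "(Start, [(True, State 0, X, Const 0)]) \<in> clauses"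
    by (simp add: clauses_def initial_clauses_def)
  from satisfiesD[OF sat this, of 0 0 0] show "V (State 0) 0 0"
    using b by simp
  show "V (Head j) 0 (horizon (length w))" if "j < num_tapes M"
  proof -
    have "(Conj Start (Eq Y Horizon), [(True, Head j, X, Y)]) \<in> clauses"
      using that by (simp add: clauses_def initial_clauses_def)
    from satisfiesD[OF sat this, of 0 "horizon (length w)" 0] show ?thesis
      using b by simp
  qed
  show "V (Cell j 0) 0 y" if "1 \<le> j" "j < num_tapes M" "y < bound (length w)"
  proof -
    have "(Start, [(True, Cell j 0, X, Y)]) \<in> clauses"
      using that by (simp add: clauses_def initial_clauses_def)
    from satisfiesD[OF sat this, of 0 y 0] show ?thesis
      using b that by simp
  qed
qed

lemma sat_input:
  assumes sat: "\<forall>cl\<in>clauses. satisfies w V cl"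
  defines "T \<equiv> horizon (length w)"
  shows "y < T \<Longrightarrow> V (Cell 0 0) 0 y"
    "z < length w \<Longrightarrow> V (Cell 0 2) 0 (T + 2 * z)"
    "z < length w \<Longrightarrow> V (Cell 0 (bit_sym (w ! z))) 0 (T + (2 * z + 1))"
    "V (Cell 0 1) 0 (T + 2 * length w)"
    "T + 2 * length w < y \<Longrightarrow> y < T + tot (length w) \<Longrightarrow>
       V (Cell 0 0) 0 y \<or> V (Cell 0 1) 0 y \<or> V (Cell 0 2) 0 y"
    "T + 2 * length w < y \<Longrightarrow> y + 1 < bound (length w) \<Longrightarrow> V (Cell 0 0) 0 y \<Longrightarrow> V (Cell 0 0) 0 (y + 1)"
    "T + tot (length w) \<le> y \<Longrightarrow> y < bound (length w) \<Longrightarrow> V (Cell 0 0) 0 y"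
proof -
  note b = bounds[of "length w", folded T_def]
  have sub: "input_clauses \<subseteq> clauses"
    by (auto simp: clauses_def)
  note D = satisfiesD[OF sat subsetD[OF sub]]
  show "y < T \<Longrightarrow> V (Cell 0 0) 0 y"
    using D[of "Conj Start (Less Y Horizon)" "[(True, Cell 0 0, X, Y)]" 0 y 0] b
    by (simp add: input_clauses_def T_def[symmetric])
  show "z < length w \<Longrightarrow> V (Cell 0 2) 0 (T + 2 * z)"
    using D[of "Conj Start (Conj (Less Z (Var 2)) (Eq Y (Add Horizon (Mult (Const 2) Z))))"
        "[(True, Cell 0 2, X, Y)]" 0 "T + 2 * z" z] b
    by (simp add: input_clauses_def T_def[symmetric])
  show "z < length w \<Longrightarrow> V (Cell 0 (bit_sym (w ! z))) 0 (T + (2 * z + 1))"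
    using D[of "Conj Start (Conj (Less Z (Var 2)) (Conj (Bit Z) (Eq Y (Add Horizon (Add (Mult (Const 2) Z) (Const 1))))))"
        "[(True, Cell 0 2, X, Y)]" 0 "T + (2 * z + 1)" z]
      D[of "Conj Start (Conj (Less Z (Var 2)) (Conj (Neg (Bit Z)) (Eq Y (Add Horizon (Add (Mult (Const 2) Z) (Const 1))))))"
        "[(True, Cell 0 1, X, Y)]" 0 "T + (2 * z + 1)" z] b
    by (cases "w ! z") (simp_all add: input_clauses_def T_def[symmetric] bit_sym_def)
  show "V (Cell 0 1) 0 (T + 2 * length w)"
    using D[of "Conj Start (Eq Y (Add Horizon (Mult (Const 2) (Var 2))))"
        "[(True, Cell 0 1, X, Y)]" 0 "T + 2 * length w" 0] b
    by (simp add: input_clauses_def T_def[symmetric])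
  show "T + 2 * length w < y \<Longrightarrow> y < T + tot (length w) \<Longrightarrow>
       V (Cell 0 0) 0 y \<or> V (Cell 0 1) 0 y \<or> V (Cell 0 2) 0 y"
    using D[of "Conj Start (Conj (Less (Add Horizon (Mult (Const 2) (Var 2))) Y) (Less Y (Add Horizon Tot)))"
        "[(True, Cell 0 0, X, Y), (True, Cell 0 1, X, Y), (True, Cell 0 2, X, Y)]" 0 y 0] b
    by (simp add: input_clauses_def T_def[symmetric])
  show "T + 2 * length w < y \<Longrightarrow> y + 1 < bound (length w) \<Longrightarrow> V (Cell 0 0) 0 y \<Longrightarrow> V (Cell 0 0) 0 (y + 1)"
    using D[of "Conj Start (Conj (Less (Add Horizon (Mult (Const 2) (Var 2))) Y) (Eq Z (Add Y (Const 1))))"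
        "[(False, Cell 0 0, X, Y), (True, Cell 0 0, X, Z)]" 0 y "y + 1"] b
    by (simp add: input_clauses_def T_def[symmetric])
  show "T + tot (length w) \<le> y \<Longrightarrow> y < bound (length w) \<Longrightarrow> V (Cell 0 0) 0 y"
    using D[of "Conj Start (Neg (Less Y (Add Horizon Tot)))" "[(True, Cell 0 0, X, Y)]" 0 y 0] b
    by (simp add: input_clauses_def T_def[symmetric])
qed

text \<open>When the premise of a step holds in \<open>V\<close>, the clause reduces to its
  conclusion.\<close>

lemma situation_false:
  assumes "V (State s) x 0" "\<And>j. j < num_tapes M \<Longrightarrow> V (Read j (as ! j)) x 0"
  shows "(clause_holds V (schema_env w x y z) (situation s as @ ls))
    \<longleftrightarrow> (clause_holds V (schema_env w x y z) ls)"
  using assms by (auto simp: situation_def)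

lemma sat_step:
  assumes sat: "\<forall>cl\<in>clauses. satisfies w V cl" and x: "x < horizon (length w)"
    and s: "s \<le> num_states M" "as \<in> symbol_vectors"
    and V: "V (State s) x 0" "\<And>j. j < num_tapes M \<Longrightarrow> V (Read j (as ! j)) x 0"
  shows "V (State (fst (transition M s as))) (x + 1) 0"
    "j < num_tapes M \<Longrightarrow> y < bound (length w) \<Longrightarrow> z < bound (length w) \<Longrightarrow> V (Head j) x y \<Longrightarrow>
       int z = int y + offset (snd (snd (transition M s as) ! j)) \<Longrightarrow> V (Head j) (x + 1) z"
    "j < num_tapes M \<Longrightarrow> y < bound (length w) \<Longrightarrow> V (Head j) x y \<Longrightarrow>
       V (Cell j (fst (snd (transition M s as) ! j))) (x + 1) y"
proof -
  note b = bounds[of "length w"]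
  have xb: "x < bound (length w)"
    using x b by simp
  have sub: "step_clauses \<subseteq> clauses"
    by (auto simp: clauses_def)
  note D = satisfiesD[OF sat subsetD[OF sub] xb]
  have "(Running, situation s as @ [(True, State (fst (transition M s as)), Next, Const 0)]) \<in> step_clauses"
    using s unfolding step_clauses_def by blast
  from D[OF this, of 0 0] show "V (State (fst (transition M s as))) (x + 1) 0"
    using b x by (simp add: situation_false[of V s x as, OF V] del: set_append)
  show "V (Head j) (x + 1) z"
    if "j < num_tapes M" "y < bound (length w)" "z < bound (length w)" "V (Head j) x y"
      "int z = int y + offset (snd (snd (transition M s as) ! j))"
  proof -
    have "(Conj Running (offset_guard (snd (snd (transition M s as) ! j))),
        situation s as @ [(False, Head j, X, Y), (True, Head j, Next, Z)]) \<in> step_clauses"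
      using s that(1) unfolding step_clauses_def by blast
    moreover have "eval (Conj Running (offset_guard (snd (snd (transition M s as) ! j)))) w (schema_env w x y z)"
      using that(5) x by (cases "snd (snd (transition M s as) ! j)") (simp_all add: offset_guard_def)
    ultimately have "clause_holds V (schema_env w x y z) (situation s as @ [(False, Head j, X, Y), (True, Head j, Next, Z)])"
      by (intro D[OF _ that(2,3)])
    then show ?thesis
      using that(4) by (simp add: situation_false[of V s x as, OF V] del: set_append; simp)
  qed
  show "V (Cell j (fst (snd (transition M s as) ! j))) (x + 1) y"
    if "j < num_tapes M" "y < bound (length w)" "V (Head j) x y"
  proof -
    have "(Running, situation s as @
        [(False, Head j, X, Y), (True, Cell j (fst (snd (transition M s as) ! j)), Next, Y)]) \<in> step_clauses"
      using s that(1) unfolding step_clauses_def by blast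
    from D[OF this that(2,2)] show ?thesis
      using x that(3) by (simp add: situation_false[of V s x as, OF V] del: set_append; simp)
  qed
qed

lemma sat_read_frame_final:
  assumes sat: "\<forall>cl\<in>clauses. satisfies w V cl"
  shows "j < num_tapes M \<Longrightarrow> a < num_syms M \<Longrightarrow> x < bound (length w) \<Longrightarrow> y < bound (length w) \<Longrightarrow>
      V (Head j) x y \<Longrightarrow> V (Cell j a) x y \<Longrightarrow> V (Read j a) x 0"
    "j < num_tapes M \<Longrightarrow> a < num_syms M \<Longrightarrow> x < horizon (length w) \<Longrightarrow> y < bound (length w) \<Longrightarrow>
      z < bound (length w) \<Longrightarrow> y \<noteq> z \<Longrightarrow> V (Head j) x z \<Longrightarrow> V (Cell j a) x y \<Longrightarrow> V (Cell j a) (x + 1) y"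
    "\<not> V (Cell (num_tapes M - 1) 1) (horizon (length w)) (horizon (length w))"
proof -
  note b = bounds[of "length w"]
  note D = satisfiesD[OF sat]
  show "V (Read j a) x 0" if "j < num_tapes M" "a < num_syms M" "x < bound (length w)" "y < bound (length w)"
    "V (Head j) x y" "V (Cell j a) x y"
  proof -
    have "(Truth, [(False, Head j, X, Y), (False, Cell j a, X, Y), (True, Read j a, X, Const 0)]) \<in> clauses"
      using that by (simp add: clauses_def read_clauses_def)
    from D[OF this that(3,4,4)] show ?thesis
      using that by simp
  qed
  show "V (Cell j a) (x + 1) y" if "j < num_tapes M" "a < num_syms M" "x < horizon (length w)"
    "y < bound (length w)" "z < bound (length w)" "y \<noteq> z" "V (Head j) x z" "V (Cell j a) x y"
  proof -
    have "(Conj Running (Neg (Eq Y Z)),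
        [(False, Head j, X, Z), (False, Cell j a, X, Y), (True, Cell j a, Next, Y)]) \<in> clauses"
      using that unfolding clauses_def step_clauses_def by blast
    from D[OF this _ that(4,5), of x] show ?thesis
      using that b by simp
  qed
  have "(Conj (Eq X Horizon) (Eq Y Horizon), [(False, Cell (num_tapes M - 1) 1, X, Y)]) \<in> clauses"
    by (simp add: clauses_def final_clauses_def)
  from D[OF this, of "horizon (length w)" "horizon (length w)" 0]
  show "\<not> V (Cell (num_tapes M - 1) 1) (horizon (length w)) (horizon (length w))"
    using b by simp
qed

text \<open>\<open>V\<close> may make more facts true than a run does, for instance two symbols in
  one cell. It suffices to choose one word \<open>ys\<close> that \<open>V\<close> admits as
  certificate: by induction on the time, \<open>V\<close> contains all facts of the run on this
  word, and the final clause rules out that the run rejects.\<close>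

lemma certificate_of_assignment:
  assumes sat: "\<forall>cl\<in>clauses. satisfies w V cl"
  defines "T \<equiv> horizon (length w)"
  shows "\<exists>ys. length ys \<le> poly q (length w) \<and>
    fst (snd ((step M ^^ T) (init_config M (pair_word w ys))) ! (num_tapes M - 1)) 0 \<noteq> 1"
proof -
  define n where "n = length w"
  define c0 where "c0 = T + (2 * n + 1)"
  note b = bounds[of n, folded T_def[folded n_def]]
  note I = sat_initial[OF sat, folded n_def] and J = sat_input[OF sat, folded n_def, folded T_def[folded n_def]]
  \<comment> \<open>The certificate ends before the first cell of its area that \<open>V\<close>
    calls blank, or fills the area if there is none. \<open>c0\<close> is the first cell after the
    doubled input and the separator.\<close>
  define l where "l = (LEAST i. i = poly q n \<or> V (Cell 0 0) 0 (c0 + i))"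
  have l: "l = poly q n \<or> V (Cell 0 0) 0 (c0 + l)" "l \<le> poly q n"
    unfolding l_def by (rule LeastI[of _ "poly q n"], simp) (rule Least_le, simp)
  have less_l: "\<not> V (Cell 0 0) 0 (c0 + i)" if "i < l" for i
    using not_less_Least[OF that[unfolded l_def]] by blast
  \<comment> \<open>Where \<open>V\<close> admits both symbols 1 and 2, the bit \<open>True\<close>
    is chosen. Where it does not admit 2, the clauses force 1, because the cell is not
    blank.\<close>
  define ys where "ys = map (\<lambda>i. V (Cell 0 2) 0 (c0 + i)) [0..<l]"
  have len: "length ys = l"
    by (simp add: ys_def)
  have blank: "V (Cell 0 0) 0 (c0 + i)" if "l \<le> i" "c0 + i < bound n" for i
    using that
  proof (induction i rule: dec_induct)
    case base
    then show ?case
      using l(1) J(7)[of "c0 + l"] b by (auto simp: c0_def)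
  next
    case (step i)
    then show ?case
      using J(6)[of "c0 + i"] by (simp add: c0_def)
  qed
  have bits: "V (Cell 0 (bit_sym (ys ! i))) 0 (c0 + i)" if "i < l" for i
  proof -
    have "V (Cell 0 0) 0 (c0 + i) \<or> V (Cell 0 1) 0 (c0 + i) \<or> V (Cell 0 2) 0 (c0 + i)"
      using that l(2) b by (intro J(5)) (auto simp: c0_def)
    then show ?thesis
      using less_l[OF that] that by (auto simp: ys_def bit_sym_def)
  qed
  define c where "c t = (step M ^^ t) (init_config M (pair_word w ys))" for t
  have c_Suc: "c (Suc t) = step M (c t)" for t
    by (simp add: c_def)
  have valid: "valid_config M (c t)" for t
    unfolding c_def by (rule valid_config_run[OF M])
  have head: "\<bar>snd (snd (c t) ! j)\<bar> \<le> int t" if "j < num_tapes M" for t j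
    unfolding c_def by (rule head_bound[OF M that])
  \<comment> \<open>Positions are shifted by \<open>T\<close>. The heads are at most
    \<open>t \<le> T\<close> away from 0, so \<open>nat\<close> does not truncate.\<close>
  have inv: "V (State (fst (c t))) t 0 \<and> (\<forall>j<num_tapes M. V (Head j) t (nat (snd (snd (c t) ! j) + int T)) \<and>
      (\<forall>y<bound n. V (Cell j (fst (snd (c t) ! j) (int y - int T))) t y))" if "t \<le> T" for t
    using that
  proof (induction t)
    case 0
    have zero: "snd (c 0) ! 0 = input_tape (pair_word w ys)"
      "\<And>j. 1 \<le> j \<Longrightarrow> j < num_tapes M \<Longrightarrow> snd (c 0) ! j = blank_tape" "fst (c 0) = 0"
      by (auto simp: c_def init_config_def nth_Cons')
    have "V (Cell 0 (fst (input_tape (pair_word w ys)) (int y - int T))) 0 y" if "y < bound n" for y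
    proof -
      have "y < T \<or> (\<exists>i. y = T + i \<and> i < 2 * n) \<or> y = T + 2 * n \<or> (\<exists>i. y = c0 + i)"
        unfolding c0_def by presburger
      then consider "y < T" | i where "y = T + i" "i < 2 * n" | "y = T + 2 * n" | i where "y = c0 + i"
        by blast
      then show ?thesis
      proof cases
        case 1
        then show ?thesis
          unfolding input_tape_pair_word using J(1) by simp
      next
        case (2 i)
        show ?thesis
        proof (cases "even i")
          case True
          then obtain z where "i = 2 * z" by blast
          then show ?thesis
            unfolding input_tape_pair_word using 2 J(2)[of z] by (simp add: n_def)
        next
          case False
          then obtain z where "i = 2 * z + 1" using oddE by blast
          then show ?thesis
            unfolding input_tape_pair_word using 2 J(3)[of z] by (simp add: n_def)
        qed
      next
        case 3
        then show ?thesis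
          unfolding input_tape_pair_word using J(4) by (simp add: n_def)
      next
        case (4 i)
        then show ?thesis
          unfolding input_tape_pair_word using bits[of i] blank[of i] that
          by (cases "i < l") (simp_all add: n_def c0_def len)
      qed
    qed
    moreover have "V (Head j) 0 (nat (snd (snd (c 0) ! j) + int T))" if "j < num_tapes M" for j
      using I(2)[OF that] head[OF that, of 0] by (simp add: T_def n_def)
    ultimately show ?case
      using I(1,3) zero by (auto simp: blank_tape_def Suc_le_eq) (metis One_nat_def Suc_leI blank_tape_def fst_conv gr0I)
  next
    case (Suc t)
    then have t: "t < T" and IS: "V (State (fst (c t))) t 0"
      and IH: "\<And>j. j < num_tapes M \<Longrightarrow> V (Head j) t (nat (snd (snd (c t) ! j) + int T))"
      and IC: "\<And>j y. j < num_tapes M \<Longrightarrow> y < bound n \<Longrightarrow> V (Cell j (fst (snd (c t) ! j) (int y - int T))) t y"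
      by auto
    define as where "as = map read (snd (c t))"
    have len_as: "length as = num_tapes M" "length (snd (c t)) = num_tapes M"
      using valid[of t] by (auto simp: as_def valid_config_def)
    have as: "fst (c t) \<le> num_states M" "as \<in> symbol_vectors"
      using valid[of t] set_map_read[OF valid, of t] by (auto simp: as_def valid_config_def symbol_vectors_def)
    have t': "t < horizon (length w)"
      using t by (simp add: T_def)
    define h where "h j = nat (snd (snd (c t) ! j) + int T)" for j
    have h: "int (h j) = snd (snd (c t) ! j) + int T" "h j < bound n" if "j < num_tapes M" for j
      using head[OF that, of t] t b by (auto simp: h_def bound_def T_def n_def)
    have syms: "fst (snd (c t) ! j) i < num_syms M" if "j < num_tapes M" for i j
      using valid[of t] that by (auto simp: valid_config_def)
    have R: "V (Read j (as ! j)) t 0" if "j < num_tapes M" for j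
    proof -
      have "fst (snd (c t) ! j) (int (h j) - int T) = as ! j"
        using that h(1)[OF that] len_as by (simp add: as_def read_eq)
      then have "V (Cell j (as ! j)) t (h j)" "as ! j < num_syms M"
        using IC[OF that h(2)[OF that]] syms[OF that] by metis+
      then show ?thesis
        using sat_read_frame_final(1)[OF sat that, of "as ! j" t "h j"] h(2)[OF that] IH[OF that] t b
        by (simp add: h_def n_def)
    qed
    have S1: "V (State (fst (transition M (fst (c t)) as))) (t + 1) 0"
      by (rule sat_step(1)[OF sat t' as IS]) (rule R)
    have S2: "V (Head j) (t + 1) z" if "j < num_tapes M" "y < bound n" "z < bound n" "V (Head j) t y"
      "int z = int y + offset (snd (snd (transition M (fst (c t)) as) ! j))" for j y z
      by (rule sat_step(2)[OF sat t' as IS _ that(1) _ _ that(4,5)]) (use R that in \<open>auto simp: n_def\<close>)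
    have S3: "V (Cell j (fst (snd (transition M (fst (c t)) as) ! j))) (t + 1) y"
      if "j < num_tapes M" "y < bound n" "V (Head j) t y" for j y
      by (rule sat_step(3)[OF sat t' as IS _ that(1) _ that(3)]) (use R that in \<open>auto simp: n_def\<close>)
    have nth: "snd (c (Suc t)) ! j = act (snd (transition M (fst (c t)) as) ! j) (snd (c t) ! j)" if "j < num_tapes M" for j
      unfolding c_Suc as_def by (rule step_nth[OF M valid that])
    have "V (State (fst (c (Suc t)))) (Suc t) 0"
      using S1 by (simp add: c_Suc fst_step as_def)
    moreover have "V (Head j) (Suc t) (nat (snd (snd (c (Suc t)) ! j) + int T))" if j: "j < num_tapes M" for j
    proof -
      let ?z = "nat (snd (snd (c (Suc t)) ! j) + int T)"
      have "\<bar>snd (snd (c (Suc t)) ! j)\<bar> \<le> int (Suc t)"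
        by (rule head[OF j])
      then have z: "int ?z = snd (snd (c (Suc t)) ! j) + int T" "?z < bound n"
        using t b by (auto simp: bound_def T_def n_def)
      then show ?thesis
        using S2[OF j, of "h j" ?z] h[OF j] IH[OF j] by (simp add: n_def h_def[symmetric] nth[OF j] snd_act)
    qed
    moreover have "V (Cell j (fst (snd (c (Suc t)) ! j) (int y - int T))) (Suc t) y"
      if j: "j < num_tapes M" and y: "y < bound n" for j y
    proof (cases "y = h j")
      case True
      then have "int y - int T = snd (snd (c t) ! j)"
        using h(1)[OF j] by simp
      then show ?thesis
        using S3[OF j, of y] IH[OF j] y True by (simp add: nth[OF j] fst_act n_def h_def)
    next
      case False
      then have "int y - int T \<noteq> snd (snd (c t) ! j)"
        using h(1)[OF j] by auto
      then show ?thesis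
        using sat_read_frame_final(2)[OF sat j syms[OF j] t' _ _ False, of "int y - int T"] h(2)[OF j] y
          IH[OF j] IC[OF j y] by (simp add: nth[OF j] fst_act n_def h_def)
    qed
    ultimately show ?case by blast
  qed
  have N: "num_tapes M - 1 < num_tapes M"
    using M by (simp add: turing_machine_def)
  have "V (Cell (num_tapes M - 1) (fst (snd (c T) ! (num_tapes M - 1)) (int T - int T))) T T"
    using inv[of T] N b by blast
  then have "fst (snd (c T) ! (num_tapes M - 1)) 0 \<noteq> 1"
    using sat_read_frame_final(3)[OF sat] by (auto simp: T_def)
  then show ?thesis
    using l(2) len by (auto simp: c_def n_def)
qed

end

section \<open>A satisfying assignment from an accepting run\<close>

context tableau
begin

lemma satisfiesI:
  assumes "\<And>x y z. x < bound (length w) \<Longrightarrow> y < bound (length w) \<Longrightarrow> z < bound (length w) \<Longrightarrow>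
    eval g w (schema_env w x y z) \<Longrightarrow>
    clause_holds V (schema_env w x y z) ls"
  shows "satisfies w V (g, ls)"
  using assms by (simp add: satisfies_def)

text \<open>The assignment consists of exactly the facts of the run on the pair of word and
  certificate. The implications describe its beginning and its steps, and \<open>accept\<close> is
  the final clause.\<close>

lemma assignment_of_certificate:
  assumes ys: "length ys \<le> poly q (length w)"
  defines "T \<equiv> horizon (length w)"
  assumes accept: "fst (snd ((step M ^^ T) (init_config M (pair_word w ys))) ! (num_tapes M - 1)) 0 \<noteq> 1"
  shows "\<exists>V. \<forall>cl\<in>clauses. satisfies w V cl"
proof -
  define n where "n = length w"
  define c where "c t = (step M ^^ t) (init_config M (pair_word w ys))" for t
  have c_Suc: "c (Suc t) = step M (c t)" for t
    by (simp add: c_def)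
  have valid: "valid_config M (c t)" for t
    unfolding c_def by (rule valid_config_run[OF M])
  have nth: "snd (c (Suc t)) ! j = act (snd (transition M (fst (c t)) (map read (snd (c t)))) ! j) (snd (c t) ! j)"
    if "j < num_tapes M" for t j
    unfolding c_Suc by (rule step_nth[OF M valid that])
  define V where "V K x y = (case K of State s \<Rightarrow> fst (c x) = s
    | Head j \<Rightarrow> snd (snd (c x) ! j) + int T = int y
    | Cell j a \<Rightarrow> fst (snd (c x) ! j) (int y - int T) = a
    | Read j a \<Rightarrow> read (snd (c x) ! j) = a)" for K and x y :: nat
  have V: "V (State s) x y \<longleftrightarrow> fst (c x) = s" "V (Head j) x y \<longleftrightarrow> snd (snd (c x) ! j) + int T = int y"
    "V (Cell j a) x y \<longleftrightarrow> fst (snd (c x) ! j) (int y - int T) = a"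
    "V (Read j a) x y \<longleftrightarrow> read (snd (c x) ! j) = a" for s j a x y
    by (simp_all add: V_def)
  have zero: "snd (c 0) ! 0 = input_tape (pair_word w ys)"
    "\<And>j. 1 \<le> j \<Longrightarrow> j < num_tapes M \<Longrightarrow> snd (c 0) ! j = blank_tape" "fst (c 0) = 0"
    by (auto simp: c_def init_config_def nth_Cons')
  have head0: "snd (snd (c 0) ! j) = 0" if "j < num_tapes M" for j
    using zero(1) zero(2)[of j] that by (cases "j = 0") (simp_all add: input_tape_def blank_tape_def)
  have initial: "\<forall>cl\<in>initial_clauses. satisfies w V cl"
    using zero head0 by (auto simp: initial_clauses_def satisfies_def V T_def blank_tape_def)
  define F where "F y = fst (input_tape (pair_word w ys)) (int y - int T)" for y
  have F: "y < T \<Longrightarrow> F y = 0" "z < n \<Longrightarrow> F (T + 2 * z) = 2" "z < n \<Longrightarrow> F (T + (2 * z + 1)) = bit_sym (w ! z)"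
    "F (T + 2 * n) = 1" "T + 2 * n < y \<Longrightarrow> F y = (if y < T + (2 * n + 1 + length ys) then bit_sym (ys ! (y - T - (2 * n + 1))) else 0)"
    for y z
    unfolding F_def input_tape_pair_word by (auto simp: n_def)
  have VF: "V (Cell 0 a) 0 y \<longleftrightarrow> F y = a" for a y
    by (simp add: V zero F_def)
  have tot: "2 * n + 1 + length ys \<le> tot n"
    using ys by (simp add: tot_def n_def)
  have pos: "bit_sym b \<noteq> 0" "bit_sym b \<noteq> 2 \<Longrightarrow> bit_sym b = 1" for b
    by (auto simp: bit_sym_def split: if_splits)
  have input: "\<forall>cl\<in>input_clauses. satisfies w V cl"
    unfolding input_clauses_def ball_simps
  proof (intro conjI satisfiesI TrueI)
    fix x y z assume "eval (Conj Start (Less Y Horizon)) w (schema_env w x y z)"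
    then show "clause_holds V (schema_env w x y z) [(True, Cell 0 0, X, Y)]"
      using F(1)[of y] by (simp add: VF T_def)
  next
    fix x y z assume "eval (Conj Start (Conj (Less Z (Var 2)) (Eq Y (Add Horizon (Mult (Const 2) Z))))) w (schema_env w x y z)"
    then show "clause_holds V (schema_env w x y z) [(True, Cell 0 2, X, Y)]"
      using F(2)[of z] by (simp add: VF T_def n_def)
  next
    fix x y z assume "eval (Conj Start (Conj (Less Z (Var 2)) (Conj (Bit Z) (Eq Y (Add Horizon (Add (Mult (Const 2) Z) (Const 1))))))) w (schema_env w x y z)"
    then show "clause_holds V (schema_env w x y z) [(True, Cell 0 2, X, Y)]"
      using F(3)[of z] by (simp add: VF T_def n_def bit_sym_def)
  next
    fix x y z assume "eval (Conj Start (Conj (Less Z (Var 2)) (Conj (Neg (Bit Z)) (Eq Y (Add Horizon (Add (Mult (Const 2) Z) (Const 1))))))) w (schema_env w x y z)"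
    then show "clause_holds V (schema_env w x y z) [(True, Cell 0 1, X, Y)]"
      using F(3)[of z] by (simp add: VF T_def n_def bit_sym_def)
  next
    fix x y z assume "eval (Conj Start (Eq Y (Add Horizon (Mult (Const 2) (Var 2))))) w (schema_env w x y z)"
    then show "clause_holds V (schema_env w x y z) [(True, Cell 0 1, X, Y)]"
      using F(4) by (simp add: VF T_def n_def)
  next
    fix x y z assume "eval (Conj Start (Conj (Less (Add Horizon (Mult (Const 2) (Var 2))) Y) (Less Y (Add Horizon Tot)))) w (schema_env w x y z)"
    then show "clause_holds V (schema_env w x y z) [(True, Cell 0 0, X, Y), (True, Cell 0 1, X, Y), (True, Cell 0 2, X, Y)]"
      using F(5)[of y] pos(2) by (auto simp: VF T_def n_def)
  next
    fix x y z assume "eval (Conj Start (Conj (Less (Add Horizon (Mult (Const 2) (Var 2))) Y) (Eq Z (Add Y (Const 1))))) w (schema_env w x y z)"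
    then show "clause_holds V (schema_env w x y z) [(False, Cell 0 0, X, Y), (True, Cell 0 0, X, Z)]"
      using F(5)[of y] F(5)[of "Suc y"] pos(1) by (auto simp: VF T_def n_def)
  next
    fix x y z assume "eval (Conj Start (Neg (Less Y (Add Horizon Tot)))) w (schema_env w x y z)"
    then show "clause_holds V (schema_env w x y z) [(True, Cell 0 0, X, Y)]"
      using F(5)[of y] tot bounds(4)[of n] by (auto simp: VF T_def n_def)
  qed
  have reads: "V (Read j a) x 0" if "V (Head j) x y" "V (Cell j a) x y" for j a x y
  proof -
    have "int y - int T = snd (snd (c x) ! j)"
      using that(1) by (simp add: V)
    then show ?thesis
      using that(2) by (simp add: V read_eq)
  qed
  have read: "\<forall>cl\<in>read_clauses. satisfies w V cl"
    unfolding read_clauses_def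
  proof clarify
    fix j a
    show "satisfies w V (Truth, [(False, Head j, X, Y), (False, Cell j a, X, Y), (True, Read j a, X, Const 0)])"
      by (rule satisfiesI) (use reads in auto)
  qed
  \<comment> \<open>Either a negated premise is true, or \<open>s\<close> and \<open>as\<close> are
    the state and the scanned symbols of the run; only then is the conclusion \<open>ls\<close> to
    be shown.\<close>
  have situation: "clause_holds V (schema_env w x y z) (situation s as @ ls)"
    if len: "as \<in> symbol_vectors" and ls: "fst (c x) = s \<Longrightarrow> as = map read (snd (c x)) \<Longrightarrow>
      clause_holds V (schema_env w x y z) ls"
    for s as ls x y z
  proof (cases "fst (c x) = s \<and> (\<forall>j<num_tapes M. read (snd (c x) ! j) = as ! j)")
    case True
    then have "as = map read (snd (c x))"
      using len valid[of x] by (intro nth_equalityI) (auto simp: symbol_vectors_def valid_config_def)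
    then show ?thesis
      using ls True by auto
  next
    case False
    then consider "fst (c x) \<noteq> s" | j where "j < num_tapes M" "read (snd (c x) ! j) \<noteq> as ! j"
      by blast
    then show ?thesis
    proof cases
      case 1
      then show ?thesis
        by (intro bexI[of _ "(False, State s, X, Const 0)"]) (simp_all add: situation_def V)
    next
      case (2 j)
      then show ?thesis
        by (intro bexI[of _ "(False, Read j (as ! j), X, Const 0)"]) (simp_all add: situation_def V)
    qed
  qed
  have step: "\<forall>cl\<in>step_clauses. satisfies w V cl"
    unfolding step_clauses_def
  proof (intro ballI, elim UnE; clarify)
    fix s as assume as: "as \<in> symbol_vectors"
    show "satisfies w V (Running, situation s as @ [(True, State (fst (transition M s as)), Next, Const 0)])"
      by (intro satisfiesI situation[OF as]) (simp add: V c_Suc fst_step)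
  next
    fix s as j assume as: "as \<in> symbol_vectors" and j: "j < num_tapes M"
    show "satisfies w V (Conj Running (offset_guard (snd (snd (transition M s as) ! j))),
        situation s as @ [(False, Head j, X, Y), (True, Head j, Next, Z)])"
    proof (intro satisfiesI situation[OF as])
      fix x y z
      assume ev: "eval (Conj Running (offset_guard (snd (snd (transition M s as) ! j)))) w (schema_env w x y z)"
        and s: "fst (c x) = s" "as = map read (snd (c x))"
      have "int z = int y + offset (snd (snd (transition M s as) ! j))"
        using ev by (cases "snd (snd (transition M s as) ! j)") (auto simp: offset_guard_def)
      then show "clause_holds V (schema_env w x y z) [(False, Head j, X, Y), (True, Head j, Next, Z)]"
        using s by (auto simp: V nth[OF j] snd_act)
    qed
  next
    fix s as j assume as: "as \<in> symbol_vectors" and j: "j < num_tapes M"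
    show "satisfies w V (Running, situation s as @
        [(False, Head j, X, Y), (True, Cell j (fst (snd (transition M s as) ! j)), Next, Y)])"
    proof (intro satisfiesI situation[OF as])
      fix x y z
      assume s: "fst (c x) = s" "as = map read (snd (c x))"
      have "int y - int T = snd (snd (c x) ! j)" if "snd (snd (c x) ! j) + int T = int y"
        using that by simp
      then show "clause_holds V (schema_env w x y z) [(False, Head j, X, Y), (True, Cell j (fst (snd (transition M s as) ! j)), Next, Y)]"
        using s by (auto simp: V nth[OF j] fst_act)
    qed
  next
    fix j a assume j: "j < num_tapes M"
    show "satisfies w V (Conj Running (Neg (Eq Y Z)),
        [(False, Head j, X, Z), (False, Cell j a, X, Y), (True, Cell j a, Next, Y)])"
    proof (rule satisfiesI)
      fix x y z
      assume "eval (Conj Running (Neg (Eq Y Z))) w (schema_env w x y z)"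
      then have "int y - int T \<noteq> snd (snd (c x) ! j)" if "snd (snd (c x) ! j) + int T = int z"
        using that by auto
      then show "clause_holds V (schema_env w x y z) [(False, Head j, X, Z), (False, Cell j a, X, Y), (True, Cell j a, Next, Y)]"
        by (auto simp: V nth[OF j] fst_act)
    qed
  qed
  have final: "\<forall>cl\<in>final_clauses. satisfies w V cl"
    using accept by (auto simp: final_clauses_def satisfies_def V T_def c_def)
  show ?thesis
    using initial input read step final unfolding clauses_def by blast
qed

end

section \<open>Hardness for an arbitrary verifier\<close>

lemma NP_hard:
  assumes k: "2 \<le> k" and L: "L \<in> class_NP"
  shows "poly_reducible L (disjoint_trees_problem k)"
proof -
  obtain R and q :: "nat poly" where R: "R \<in> class_P"
    and q: "\<And>xs. xs \<in> L \<longleftrightarrow> (\<exists>ys. length ys \<le> poly q (length xs) \<and> pair_word xs ys \<in> R)"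
    using L by (auto simp: class_NP_def)
  obtain M and p :: "nat poly" where M: "turing_machine M"
    and p: "\<And>xs. computes_within M xs [xs \<in> R] (poly p (length xs))"
    using R by (auto simp: class_P_def poly_time_computable_def)
  interpret tableau M p q
    by unfold_locales (rule M)
  obtain cs where cs: "set cs = clauses"
    using finite_clauses finite_list by blast
  \<comment> \<open>The running time varies with the certificate. As the machine idles after
    halting, its answer can be inspected at a time that depends only on the length of
    \<open>w\<close>. The answer is one bit, so any symbol other than 1 means acceptance.\<close>
  have accept: "fst (snd ((step M ^^ horizon (length w)) (init_config M (pair_word w ys))) ! (num_tapes M - 1)) 0 \<noteq> 1 \<longleftrightarrow>
      pair_word w ys \<in> R" if "length ys \<le> poly q (length w)" for w ys
  proof -
    let ?x = "pair_word w ys"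
    obtain ts where ts: "(step M ^^ poly p (length ?x)) (init_config M ?x) = (num_states M, ts)"
      "output_is (last ts) [?x \<in> R]"
      using p[of ?x] by (auto simp: computes_within_def)
    have "poly p (length ?x) \<le> poly p (tot (length w))"
      using that by (intro poly_nat_mono) (simp add: length_pair_word tot_def)
    also have "\<dots> \<le> horizon (length w)"
      by (simp add: horizon_def)
    finally have eq: "(step M ^^ horizon (length w)) (init_config M ?x) = (num_states M, ts)"
      by (rule funpow_step_halted_mono[OF ts(1)])
    have "length ts = num_tapes M"
      using valid_config_run[OF M, of "horizon (length w)" ?x] unfolding eq by (simp add: valid_config_def)
    moreover have "1 \<le> num_tapes M"
      using M by (simp add: turing_machine_def)
    ultimately have "last ts = ts ! (num_tapes M - 1)"
      by (subst last_conv_nth) auto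
    then show ?thesis
      using ts(2) unfolding eq by (auto simp: output_is_def bit_sym_def split: if_splits)
  qed
  show ?thesis
  proof (rule reducible_of_clauses[where \<Sigma> = cs and B = Bound])
    show "below 3 Bound"
      by (rule below_terms) simp
    show "2 \<le> val Bound (input_env w)" for w
      by (simp add: bound_def)
    show "w \<in> L \<longleftrightarrow> (\<exists>V. \<forall>(g, ls)\<in>set cs. \<forall>x<val Bound (input_env w). \<forall>y<val Bound (input_env w).
        \<forall>z<val Bound (input_env w). eval g w (schema_env w x y z) \<longrightarrow>
        (clause_holds V (schema_env w x y z) ls))" for w
    proof -
      have "w \<in> L \<longleftrightarrow> (\<exists>V. \<forall>cl\<in>clauses. satisfies w V cl)"
      proof
        assume "w \<in> L"
        then obtain ys where "length ys \<le> poly q (length w)" "pair_word w ys \<in> R"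
          using q by blast
        then show "\<exists>V. \<forall>cl\<in>clauses. satisfies w V cl"
          using assignment_of_certificate accept by blast
      next
        assume "\<exists>V. \<forall>cl\<in>clauses. satisfies w V cl"
        then show "w \<in> L"
          using certificate_of_assignment accept q by blast
      qed
      then show ?thesis
        by (simp only: satisfies_def cs val_terms)
    qed
  qed (use k clauses_wf clauses_range in \<open>simp_all add: cs\<close>)
qed

section \<open>Membership in NP\<close>

definition All :: "nat \<Rightarrow> trm \<Rightarrow> fml \<Rightarrow> fml" where
  "All x t \<phi> = Neg (Ex x t (Neg \<phi>))"

definition Imp :: "fml \<Rightarrow> fml \<Rightarrow> fml" where
  "Imp \<phi> \<psi> = Neg (Conj \<phi> (Neg \<psi>))"

lemma eval_All_Imp [simp]:
  "eval (All x t \<phi>) w e \<longleftrightarrow> (\<forall>v<val t e. eval \<phi> w (e(x := v)))"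
  "eval (Imp \<phi> \<psi>) w e \<longleftrightarrow> (eval \<phi> w e \<longrightarrow> eval \<psi> w e)"
  by (auto simp: All_def Imp_def)

lemma scoped_All_Imp [simp]:
  "scoped d (All x t \<phi>) \<longleftrightarrow> d \<le> x \<and> below d t \<and> scoped (Suc x) \<phi>"
  "scoped d (Imp \<phi> \<psi>) \<longleftrightarrow> scoped d \<phi> \<and> scoped d \<psi>"
  by (auto simp: All_def Imp_def)

definition bit_at :: "bool list \<Rightarrow> nat \<Rightarrow> bool" where
  "bit_at w i \<longleftrightarrow> i < length w \<and> w ! i"

lemma certificate_cong:
  assumes "\<And>u v. u < n \<Longrightarrow> v < n \<Longrightarrow> A u v \<longleftrightarrow> A' u v" "\<And>v. v < n \<Longrightarrow> S v \<longleftrightarrow> S' v"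
    "\<And>c u v. c < k \<Longrightarrow> u < n \<Longrightarrow> v < n \<Longrightarrow> E c u v \<longleftrightarrow> E' c u v"
    "\<And>c v r. c < k \<Longrightarrow> v < n \<Longrightarrow> r < Suc (n * n) \<Longrightarrow> R c v r \<longleftrightarrow> R' c v r"
  shows "certificate k n A S E R \<longleftrightarrow> certificate k n A' S' E' R'"
  unfolding certificate_def using assms by (simp cong: conj_cong)

section \<open>Words that encode instances\<close>

lemma row_index_less: "i < m \<Longrightarrow> j < n \<Longrightarrow> i * n + j < m * (n :: nat)"
proof -
  assume "i < m" "j < n"
  then have "i * n + j < Suc i * n" by simp
  also have "\<dots> \<le> m * n" using \<open>i < m\<close> by (intro mult_le_mono1) simp
  finally show ?thesis .
qed

lemma length_rows: "length (concat (map (\<lambda>i. map (f i) [0..<n]) [0..<m])) = m * n"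
  by (induction m) auto

lemma nth_rows:
  assumes "i < m" "j < n"
  shows "concat (map (\<lambda>i. map (f i) [0..<n]) [0..<m]) ! (i * n + j) = f i j"
  using assms(1)
proof (induction m)
  case (Suc m)
  then show ?case
    using assms(2) row_index_less[of i m j n]
    by (cases "i = m") (auto simp: nth_append length_rows)
qed simp

lemma length_encode: "verts G = {..<n} \<Longrightarrow> length (encode G S) = n + 1 + n * n + n"
  by (simp add: encode_def length_rows Let_def)

lemma nth_encode:
  assumes "verts G = {..<n}"
  shows "i < n \<Longrightarrow> encode G S ! i" "\<not> encode G S ! n"
    "i < n \<Longrightarrow> j < n \<Longrightarrow> encode G S ! (n + 1 + (i * n + j)) \<longleftrightarrow> {i, j} \<in> edges G"
    "i < n \<Longrightarrow> encode G S ! (n + 1 + n * n + i) \<longleftrightarrow> i \<in> S"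
proof -
  have e: "encode G S = replicate n True @ False #
      (concat (map (\<lambda>i. map (\<lambda>j. {i, j} \<in> edges G) [0..<n]) [0..<n]) @ map (\<lambda>i. i \<in> S) [0..<n])"
    using assms by (simp add: encode_def Let_def)
  show "i < n \<Longrightarrow> encode G S ! i" "\<not> encode G S ! n"
    by (simp_all add: e nth_append)
  show "encode G S ! (n + 1 + (i * n + j)) \<longleftrightarrow> {i, j} \<in> edges G" if "i < n" "j < n"
    using nth_rows[OF that, of "\<lambda>i j. {i, j} \<in> edges G"] row_index_less[OF that]
    by (simp add: e nth_append length_rows)
  show "encode G S ! (n + 1 + n * n + i) \<longleftrightarrow> i \<in> S" if "i < n"
    using that by (simp add: e nth_append length_rows)
qed

text \<open>These are the words \<open>encode G S\<close> with \<open>n\<close> vertices, described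
  bit by bit so that a formula can test them. Symmetry and a zero diagonal of the matrix make the
  graph simple and undirected.\<close>

definition graph_word :: "nat \<Rightarrow> bool list \<Rightarrow> bool" where
  "graph_word n xs \<longleftrightarrow> length xs = n + 1 + n * n + n \<and> (\<forall>i<n. xs ! i) \<and> \<not> xs ! n \<and>
     (\<forall>u<n. \<forall>v<n. xs ! (n + 1 + (u * n + v)) \<longrightarrow> xs ! (n + 1 + (v * n + u))) \<and>
     (\<forall>u<n. \<not> xs ! (n + 1 + (u * n + u)))"

lemma graph_word_encode:
  assumes "instance_of G S" "verts G = {..<n}"
  shows "graph_word n (encode G S)"
proof -
  have "{u} \<notin> edges G" for u
  proof
    assume "{u} \<in> edges G"
    then have "card {u} = 2"
      using assms(1) by (auto simp: instance_of_def simple_graph_def simp del: card_insert_disjoint)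
    then show False by simp
  qed
  then show ?thesis
    using assms(2) by (auto simp: graph_word_def length_encode nth_encode insert_commute simp del: One_nat_def add_Suc_right add_Suc)
qed

lemma graph_word_decode:
  assumes "graph_word n xs"
  shows "\<exists>G S. instance_of G S \<and> verts G = {..<n} \<and> xs = encode G S"
proof -
  define adjacent where "adjacent u v \<longleftrightarrow> xs ! (n + 1 + (u * n + v))" for u v
  define G where "G = ({..<n}, {{u, v} |u v. u < n \<and> v < n \<and> adjacent u v})"
  define S where "S = {v. v < n \<and> xs ! (n + 1 + n * n + v)}"
  have sym: "adjacent u v \<longleftrightarrow> adjacent v u" and irr: "\<not> adjacent u u" if "u < n" "v < n" for u v
    using assms that by (auto simp: graph_word_def adjacent_def)
  have V: "verts G = {..<n}"
    by (simp add: G_def)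
  have edge: "{u, v} \<in> edges G \<longleftrightarrow> adjacent u v" if "u < n" "v < n" for u v
    using that sym by (auto simp: G_def doubleton_eq_iff)
  have "card {u, v} = 2" if "u < n" "v < n" "adjacent u v" for u v
    using irr[OF that(1,2)] that(3) by (cases "u = v") auto
  then have "instance_of G S"
    by (auto simp: instance_of_def simple_graph_def G_def S_def)
  moreover have "xs = encode G S"
  proof (rule nth_equalityI)
    show len: "length xs = length (encode G S)"
      using assms by (simp add: length_encode[OF V] graph_word_def)
    fix i assume "i < length xs"
    then have i: "i < n + 1 + n * n + n"
      using assms by (simp add: graph_word_def)
    consider "i < n" | "i = n" | l where "i = n + 1 + l" "l < n * n" | l where "i = n + 1 + n * n + l" "l < n"
    proof -
      have "i < n \<or> i = n \<or> (\<exists>l<n * n. i = n + 1 + l) \<or> (\<exists>l<n. i = n + 1 + n * n + l)"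
      proof (cases "i < n + 1 + n * n")
        case True
        then show ?thesis
          by (cases "i \<le> n") (auto intro: exI[of _ "i - (n + 1)"])
      next
        case False
        then have "i = n + 1 + n * n + (i - (n + 1 + n * n))" "i - (n + 1 + n * n) < n"
          using i by auto
        then show ?thesis by blast
      qed
      then show thesis
        using that by blast
    qed
    then show "xs ! i = encode G S ! i"
    proof cases
      case 1
      then show ?thesis
        using assms nth_encode(1)[OF V] by (simp add: graph_word_def)
    next
      case 2
      then show ?thesis
        using assms nth_encode(2)[OF V] by (simp add: graph_word_def)
    next
      case (3 l)
      have l: "l = l div n * n + l mod n" by simp
      have "l div n < n" "l mod n < n"
        using 3(2) by (auto simp: less_mult_imp_div_less intro!: mod_less_divisor gr0I)
      then show ?thesis
        using nth_encode(3)[OF V, of "l div n" "l mod n" S] edge[of "l div n" "l mod n"] l 3(1)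
        by (simp add: adjacent_def del: mod_div_trivial)
    next
      case (4 l)
      then show ?thesis
        using nth_encode(4)[OF V, of l S] by (simp add: S_def)
    qed
  qed
  ultimately show ?thesis
    using V by blast
qed

lemma trees_iff_certificate:
  assumes "instance_of G S" "verts G = {..<n}" "0 < k"
  shows "(\<exists>\<T>. internally_disjoint_trees G S \<T> \<and> card \<T> = k) \<longleftrightarrow>
    (\<exists>E R. certificate k n (\<lambda>u v. encode G S ! (n + 1 + (u * n + v))) (\<lambda>v. encode G S ! (n + 1 + n * n + v)) E R)"
proof -
  have "certificate k n (\<lambda>u v. encode G S ! (n + 1 + (u * n + v))) (\<lambda>v. encode G S ! (n + 1 + n * n + v)) E R \<longleftrightarrow>
      certificate k n (\<lambda>u v. {u, v} \<in> edges G) (\<lambda>v. v \<in> S) E R" for E R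
    by (rule certificate_cong) (simp_all only: nth_encode[OF assms(2)])
  moreover have "simple_graph G" "S \<subseteq> verts G"
    using assms(1) by (auto simp: instance_of_def)
  ultimately show ?thesis
    using certificate_imp_trees[of G n S k] trees_imp_certificate[of G n S _ k] assms(2,3) by blast
qed

lemma in_language_iff:
  assumes "0 < k"
  shows "xs \<in> disjoint_trees_problem k \<longleftrightarrow>
    (\<exists>n. graph_word n xs \<and>
      (\<exists>E R. certificate k n (\<lambda>u v. xs ! (n + 1 + (u * n + v))) (\<lambda>v. xs ! (n + 1 + n * n + v)) E R))"
    (is "xs \<in> ?L \<longleftrightarrow> ?rhs")
proof
  assume "xs \<in> ?L"
  then obtain G S where G: "xs = encode G S" "instance_of G S"
    "\<exists>\<T>. internally_disjoint_trees G S \<T> \<and> card \<T> = k"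
    by blast
  then obtain n where "verts G = {..<n}"
    by (auto simp: instance_of_def)
  then show ?rhs
    using G graph_word_encode trees_iff_certificate[OF G(2) _ assms] by blast
next
  assume ?rhs
  then obtain n where n: "graph_word n xs"
    "\<exists>E R. certificate k n (\<lambda>u v. xs ! (n + 1 + (u * n + v))) (\<lambda>v. xs ! (n + 1 + n * n + v)) E R"
    by blast
  then obtain G S where G: "instance_of G S" "verts G = {..<n}" "xs = encode G S"
    using graph_word_decode by blast
  then show "xs \<in> ?L"
    using n(2) trees_iff_certificate[OF G(1,2) assms] by blast
qed

section \<open>Certificates as words\<close>

text \<open>The certificate starts with \<open>k\<close> matrices of size \<open>n\<close> by
  \<open>n\<close> for the edges. The \<open>k * n * n\<close> bits of this part are followed by a
  row of \<open>n * n + 1\<close> rank bits for each pair of a subgraph and a vertex.\<close>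

abbreviation edge_index :: "nat \<Rightarrow> nat \<Rightarrow> nat \<Rightarrow> nat \<Rightarrow> nat" where
  "edge_index n c u v \<equiv> (c * n + u) * n + v"

abbreviation rank_index :: "nat \<Rightarrow> nat \<Rightarrow> nat \<Rightarrow> nat \<Rightarrow> nat \<Rightarrow> nat" where
  "rank_index k n c v r \<equiv> k * n * n + ((c * n + v) * Suc (n * n) + r)"

text \<open>Arbitrary relations are tabulated: row \<open>i\<close> belongs to subgraph or vertex
  data split off by division by \<open>n\<close>, that is, to the pair
  \<open>(i div n, i mod n)\<close>.\<close>

lemma certificate_word:
  "\<exists>ys. length ys = k * n * n + k * n * Suc (n * n) \<and>
    (\<forall>c<k. \<forall>u<n. \<forall>v<n. bit_at ys (edge_index n c u v) \<longleftrightarrow> E c u v) \<and>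
    (\<forall>c<k. \<forall>v<n. \<forall>r<Suc (n * n). bit_at ys (rank_index k n c v r) \<longleftrightarrow> R c v r)"
proof -
  define Es where "Es = concat (map (\<lambda>i. map (E (i div n) (i mod n)) [0..<n]) [0..<k * n])"
  define Rs where "Rs = concat (map (\<lambda>i. map (R (i div n) (i mod n)) [0..<Suc (n * n)]) [0..<k * n])"
  have len: "length Es = k * n * n" "length Rs = k * n * Suc (n * n)"
    unfolding Es_def Rs_def by (rule length_rows)+
  have 1: "bit_at (Es @ Rs) (edge_index n c u v) \<longleftrightarrow> E c u v" if "c < k" "u < n" "v < n" for c u v
  proof -
    have "edge_index n c u v < length Es"
      unfolding len by (intro row_index_less that)
    then show ?thesis
      using nth_rows[of "c * n + u" "k * n" v n "\<lambda>i. E (i div n) (i mod n)"] row_index_less[OF that(1,2)] that(2,3)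
      by (simp add: bit_at_def nth_append Es_def[symmetric])
  qed
  have 2: "bit_at (Es @ Rs) (rank_index k n c v r) \<longleftrightarrow> R c v r" if "c < k" "v < n" "r < Suc (n * n)" for c v r
  proof -
    have "(c * n + v) * Suc (n * n) + r < length Rs"
      unfolding len by (intro row_index_less that)
    then show ?thesis
      using nth_rows[of "c * n + v" "k * n" r "Suc (n * n)" "\<lambda>i. R (i div n) (i mod n)"] row_index_less[OF that(1,2)] that(2,3)
      by (simp add: bit_at_def nth_append Rs_def[symmetric] len(1) del: mult_Suc_right upt_Suc)
  qed
  show ?thesis
    using len 1 2 by (intro exI[of _ "Es @ Rs"]) auto
qed

section \<open>The verifier as a formula\<close>

abbreviation Size :: trm where "Size \<equiv> Var 4"

text \<open>In a pair word the bits of the instance occupy odd positions. The separator is at twice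
  the length of the instance, and that length is kept in variable 3; \<open>Cert_Bit\<close>
  therefore starts one position after it.\<close>

definition In_Bit :: "trm \<Rightarrow> fml" where
  "In_Bit t = Bit (Add (Mult (Const 2) t) (Const 1))"

definition Cert_Bit :: "trm \<Rightarrow> fml" where
  "Cert_Bit t = Bit (Add (Add (Mult (Const 2) (Var 3)) (Const 1)) t)"

definition Adj :: "nat \<Rightarrow> nat \<Rightarrow> fml" where
  "Adj u v = In_Bit (Add (Add Size (Const 1)) (Add (Mult (Var u) Size) (Var v)))"

definition Terminal :: "nat \<Rightarrow> fml" where
  "Terminal v = In_Bit (Add (Add (Add Size (Const 1)) (Mult Size Size)) (Var v))"

definition Edge :: "nat \<Rightarrow> nat \<Rightarrow> nat \<Rightarrow> fml" where
  "Edge c u v = Cert_Bit (Add (Mult (Add (Mult (Var c) Size) (Var u)) Size) (Var v))"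

definition Rank_Bound :: trm where
  "Rank_Bound = Add (Mult Size Size) (Const 1)"

definition Rank :: "nat \<Rightarrow> nat \<Rightarrow> nat \<Rightarrow> trm \<Rightarrow> fml" where
  "Rank k c v r = Cert_Bit (Add (Mult (Mult (Const k) Size) Size)
     (Add (Mult (Add (Mult (Var c) Size) (Var v)) Rank_Bound) r))"

definition In_Tree :: "nat \<Rightarrow> nat \<Rightarrow> nat \<Rightarrow> nat \<Rightarrow> fml" where
  "In_Tree k c v x = Ex x Rank_Bound (Rank k c v (Var x))"

definition In_Either :: "nat \<Rightarrow> nat \<Rightarrow> nat \<Rightarrow> nat \<Rightarrow> nat \<Rightarrow> fml" where
  "In_Either k c d v x = Ex x Rank_Bound (Or (Rank k c v (Var x)) (Rank k d v (Var x)))"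

text \<open>The second and third conjuncts say that the first \<open>False\<close> at an even
  position is at twice \<open>Var 3\<close>; hence \<open>Var 3\<close> is the length of the
  instance. The others spell out \<open>graph_word\<close>.\<close>

definition Well_Formed :: fml where
  "Well_Formed = Conj (Eq (Var 3) (Add (Add (Add Size (Const 1)) (Mult Size Size)) Size))
     (Conj (Neg (Bit (Mult (Const 2) (Var 3))))
     (Conj (All 5 (Var 3) (Bit (Mult (Const 2) (Var 5))))
     (Conj (All 5 Size (In_Bit (Var 5)))
     (Conj (Neg (In_Bit Size))
     (Conj (All 5 Size (All 6 Size (Imp (Adj 5 6) (Adj 6 5))))
       (All 5 Size (Neg (Adj 5 5))))))))"

text \<open>This transcribes \<open>certificate\<close>, with an equivalence written as two
  implications. The last argument of \<open>In_Tree\<close> and \<open>In_Either\<close> is the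
  first variable number not yet in use, as \<open>scoped\<close> demands.\<close>

definition Certified :: "nat \<Rightarrow> fml" where
  "Certified k = All 5 (Const k)
     (Conj (All 6 Size (All 7 Size (Imp (Edge 5 6 7) (Conj (Adj 6 7) (Conj (Edge 5 7 6) (In_Tree k 5 6 8))))))
     (Conj (All 6 Size (Imp (Terminal 6) (In_Tree k 5 6 7)))
     (Conj (Ex 6 Size (All 7 Size (Conj (Imp (Rank k 5 7 (Const 0)) (Eq (Var 7) (Var 6)))
        (Imp (Eq (Var 7) (Var 6)) (Rank k 5 7 (Const 0))))))
     (Conj (All 6 Size (All 7 (Mult Size Size) (Imp (Rank k 5 6 (Add (Var 7) (Const 1)))
        (Or (Rank k 5 6 (Var 7)) (Ex 8 Size (Conj (Rank k 5 8 (Var 7)) (Edge 5 8 6)))))))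
     (All 6 (Const k) (Imp (Neg (Eq (Var 5) (Var 6)))
       (Conj (All 7 Size (All 8 Size (Neg (Conj (Edge 5 7 8) (Edge 6 7 8)))))
       (Conj (All 7 Size (Imp (Conj (In_Tree k 5 7 8) (In_Tree k 6 7 8)) (Terminal 7)))
         (Ex 7 Size (Ex 8 Size (Conj (Neg (Eq (Var 7) (Var 8)))
           (Conj (In_Either k 5 6 7 9) (In_Either k 5 6 8 9)))))))))))))"

text \<open>The length of the instance and its number of vertices are guessed. The length of the
  whole word is a sufficient bound: a pair word is longer than its first component, which has more
  bits than the graph has vertices.\<close>

definition Verify :: "nat \<Rightarrow> fml" where
  "Verify k = Ex 3 (Var 2) (Ex 4 (Var 2) (Conj Well_Formed (Certified k)))"

lemmas verify_defs = Verify_def Certified_def Well_Formed_def In_Tree_def In_Either_def Rank_def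
  Rank_Bound_def Edge_def Terminal_def Adj_def In_Bit_def Cert_Bit_def

lemma scoped_Verify: "scoped 3 (Verify k)"
  by (simp add: verify_defs)

lemma eval_Certified:
  "eval (Certified k) w ((input_env w)(3 := m, 4 := n)) \<longleftrightarrow>
   certificate k n (\<lambda>u v. bit_at w (2 * (n + 1 + (u * n + v)) + 1)) (\<lambda>v. bit_at w (2 * (n + 1 + n * n + v) + 1))
     (\<lambda>c u v. bit_at w (2 * m + 1 + edge_index n c u v)) (\<lambda>c v r. bit_at w (2 * m + 1 + rank_index k n c v r))"
proof -
  have Suc: "Suc r = r + 1" for r :: nat by simp
  have iff: "((a \<longrightarrow> b) \<and> (b \<longrightarrow> a)) \<longleftrightarrow> (a \<longleftrightarrow> b)" for a b by blast
  show ?thesis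
    unfolding certificate_def bit_at_def verify_defs
    by (simp only: Suc eval.simps eval_All_Imp eval_Eq eval_Or val.simps fun_upd_apply numeral_eq_iff
        num.distinct num.inject if_True if_False simp_thms rel_simps iff)
qed

lemma eval_Well_Formed:
  "eval Well_Formed w ((input_env w)(3 := m, 4 := n)) \<longleftrightarrow>
   m = n + 1 + n * n + n \<and> \<not> bit_at w (2 * m) \<and> (\<forall>i<m. bit_at w (2 * i)) \<and>
   (\<forall>i<n. bit_at w (2 * i + 1)) \<and> \<not> bit_at w (2 * n + 1) \<and>
   (\<forall>u<n. \<forall>v<n. bit_at w (2 * (n + 1 + (u * n + v)) + 1) \<longrightarrow> bit_at w (2 * (n + 1 + (v * n + u)) + 1)) \<and>
   (\<forall>u<n. \<not> bit_at w (2 * (n + 1 + (u * n + u)) + 1))"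
  unfolding bit_at_def verify_defs
  by (simp only: eval.simps eval_All_Imp eval_Eq eval_Or val.simps fun_upd_apply numeral_eq_iff
        num.distinct num.inject if_True if_False simp_thms rel_simps)

lemma eval_Verify:
  "eval (Verify k) w (input_env w) \<longleftrightarrow> (\<exists>m<length w. \<exists>n<length w.
     eval Well_Formed w ((input_env w)(3 := m, 4 := n)) \<and> eval (Certified k) w ((input_env w)(3 := m, 4 := n)))"
  by (simp add: Verify_def input_env_def)

lemma bit_at_pair_word:
  "i < length xs \<Longrightarrow> bit_at (pair_word xs ys) (2 * i)"
  "i < length xs \<Longrightarrow> bit_at (pair_word xs ys) (2 * i + 1) \<longleftrightarrow> xs ! i"
  "\<not> bit_at (pair_word xs ys) (2 * length xs)"
  "bit_at (pair_word xs ys) (2 * length xs + 1 + i) \<longleftrightarrow> bit_at ys i"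
  using nth_pair_word(1,2)[of i xs ys] nth_pair_word(3)[of xs ys] nth_pair_word(4)[of xs ys i]
  by (auto simp: bit_at_def length_pair_word simp del: One_nat_def add_Suc_right add_Suc)

lemma row_index_less_square: "u < n \<Longrightarrow> v < n \<Longrightarrow> u * n + v < n * (n :: nat)"
  by (rule row_index_less)

lemma eval_Well_Formed_pair_word:
  "eval Well_Formed (pair_word xs ys) ((input_env (pair_word xs ys))(3 := m, 4 := n)) \<longleftrightarrow>
   m = length xs \<and> graph_word n xs"
proof
  let ?w = "pair_word xs ys"
  assume "eval Well_Formed ?w ((input_env ?w)(3 := m, 4 := n))"
  then have m: "m = n + 1 + n * n + n" "\<not> bit_at ?w (2 * m)" "\<And>i. i < m \<Longrightarrow> bit_at ?w (2 * i)"
    and n: "\<And>i. i < n \<Longrightarrow> bit_at ?w (2 * i + 1)" "\<not> bit_at ?w (2 * n + 1)"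
    and adj: "\<And>u v. u < n \<Longrightarrow> v < n \<Longrightarrow> bit_at ?w (2 * (n + 1 + (u * n + v)) + 1) \<Longrightarrow> bit_at ?w (2 * (n + 1 + (v * n + u)) + 1)"
      "\<And>u. u < n \<Longrightarrow> \<not> bit_at ?w (2 * (n + 1 + (u * n + u)) + 1)"
    unfolding eval_Well_Formed by blast+
  have len: "m = length xs"
    using m(2,3) bit_at_pair_word(1)[of m xs ys] bit_at_pair_word(3)[of xs ys]
    by (metis linorder_neqE_nat)
  have b: "bit_at ?w (2 * i + 1) \<longleftrightarrow> xs ! i" if "i < n + 1 + n * n + n" for i
    using that len m(1) by (intro bit_at_pair_word(2)) simp
  have "graph_word n xs"
    unfolding graph_word_def
  proof (intro conjI allI impI)
    show "length xs = n + 1 + n * n + n"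
      using len m(1) by simp
    show "xs ! i" if "i < n" for i
      using n(1)[OF that] b[of i] that by simp
    show "\<not> xs ! n"
      using n(2) b[of n] by simp
    show "xs ! (n + 1 + (v * n + u))" if "u < n" "v < n" "xs ! (n + 1 + (u * n + v))" for u v
      using adj(1)[OF that(1,2)] b[of "n + 1 + (u * n + v)"] b[of "n + 1 + (v * n + u)"] that
        row_index_less_square[OF that(1,2)] row_index_less_square[OF that(2,1)] by linarith
    show "\<not> xs ! (n + 1 + (u * n + u))" if "u < n" for u
      using adj(2)[OF that] b[of "n + 1 + (u * n + u)"] row_index_less_square[OF that that] by linarith
  qed
  then show "m = length xs \<and> graph_word n xs"
    using len by blast
next
  let ?w = "pair_word xs ys"
  assume a: "m = length xs \<and> graph_word n xs"
  have b: "bit_at ?w (2 * i + 1) \<longleftrightarrow> xs ! i" if "i < n + 1 + n * n + n" for i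
    using that a by (intro bit_at_pair_word(2)) (simp add: graph_word_def)
  have adj: "bit_at ?w (2 * (n + 1 + (u * n + v)) + 1) \<longleftrightarrow> xs ! (n + 1 + (u * n + v))" if "u < n" "v < n" for u v
    using row_index_less_square[OF that] by (intro b) simp
  show "eval Well_Formed ?w ((input_env ?w)(3 := m, 4 := n))"
    unfolding eval_Well_Formed
    using a b adj bit_at_pair_word(1)[of _ xs ys] bit_at_pair_word(3)[of xs ys]
    by (auto simp: graph_word_def simp del: One_nat_def add_Suc_right add_Suc mult_Suc_right)
qed

lemma eval_Certified_pair_word:
  assumes "graph_word n xs"
  shows "eval (Certified k) (pair_word xs ys) ((input_env (pair_word xs ys))(3 := length xs, 4 := n)) \<longleftrightarrow>
    certificate k n (\<lambda>u v. xs ! (n + 1 + (u * n + v))) (\<lambda>v. xs ! (n + 1 + n * n + v))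
      (\<lambda>c u v. bit_at ys (edge_index n c u v)) (\<lambda>c v r. bit_at ys (rank_index k n c v r))"
  unfolding eval_Certified
proof (rule certificate_cong)
  have len: "length xs = n + 1 + n * n + n"
    using assms by (simp add: graph_word_def)
  show "bit_at (pair_word xs ys) (2 * (n + 1 + (u * n + v)) + 1) = xs ! (n + 1 + (u * n + v))" if "u < n" "v < n" for u v
    using row_index_less_square[OF that] len by (intro bit_at_pair_word(2)) simp
  show "bit_at (pair_word xs ys) (2 * (n + 1 + n * n + v) + 1) = xs ! (n + 1 + n * n + v)" if "v < n" for v
    using that len by (intro bit_at_pair_word(2)) simp
qed (rule bit_at_pair_word(4))+

lemma in_NP:
  fixes k :: nat
  assumes k: "0 < k"
  shows "disjoint_trees_problem k \<in> class_NP"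
    (is "?L \<in> _")
proof -
  let ?R = "{w. eval (Verify k) w (input_env w)}"
  have "?R \<in> class_P"
    by (rule definable_in_P[OF scoped_Verify])
  \<comment> \<open>The coefficients are those of the length
    \<open>k * n + k * n * n + k * n * n * n\<close> of the certificate word, and \<open>n\<close>
    is at most the length of \<open>xs\<close>.\<close>
  moreover have "xs \<in> ?L \<longleftrightarrow> (\<exists>ys. length ys \<le> poly [:0, k, k, k:] (length xs) \<and> pair_word xs ys \<in> ?R)" for xs
  proof
    assume "xs \<in> ?L"
    then obtain n E R where n: "graph_word n xs"
      "certificate k n (\<lambda>u v. xs ! (n + 1 + (u * n + v))) (\<lambda>v. xs ! (n + 1 + n * n + v)) E R"
      unfolding in_language_iff[OF k] by blast
    obtain ys where ys: "length ys = k * n * n + k * n * Suc (n * n)"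
      "\<And>c u v. c < k \<Longrightarrow> u < n \<Longrightarrow> v < n \<Longrightarrow> bit_at ys (edge_index n c u v) \<longleftrightarrow> E c u v"
      "\<And>c v r. c < k \<Longrightarrow> v < n \<Longrightarrow> r < Suc (n * n) \<Longrightarrow> bit_at ys (rank_index k n c v r) \<longleftrightarrow> R c v r"
      using certificate_word[of k n E R] by blast
    have nl: "n \<le> length xs"
      using n(1) by (simp add: graph_word_def)
    have "length ys = k * n + k * (n * n) + k * (n * (n * n))"
      by (simp add: ys(1) algebra_simps)
    also have "\<dots> \<le> k * length xs + k * (length xs * length xs) + k * (length xs * (length xs * length xs))"
      using nl by (intro add_mono mult_le_mono order_refl)
    also have "\<dots> = poly [:0, k, k, k:] (length xs)"
      by (simp add: algebra_simps)
    finally have "length ys \<le> poly [:0, k, k, k:] (length xs)" .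
    moreover have "certificate k n (\<lambda>u v. xs ! (n + 1 + (u * n + v))) (\<lambda>v. xs ! (n + 1 + n * n + v))
        (\<lambda>c u v. bit_at ys (edge_index n c u v)) (\<lambda>c v r. bit_at ys (rank_index k n c v r))"
      using certificate_cong[OF refl refl ys(2,3)] n(2) by simp
    then have "eval (Certified k) (pair_word xs ys) ((input_env (pair_word xs ys))(3 := length xs, 4 := n))"
      unfolding eval_Certified_pair_word[OF n(1)] .
    moreover have "eval Well_Formed (pair_word xs ys) ((input_env (pair_word xs ys))(3 := length xs, 4 := n))"
      unfolding eval_Well_Formed_pair_word using n(1) by simp
    moreover have "length xs < length (pair_word xs ys)" "n < length (pair_word xs ys)"
      using nl by (simp_all add: length_pair_word)
    ultimately show "\<exists>ys. length ys \<le> poly [:0, k, k, k:] (length xs) \<and> pair_word xs ys \<in> ?R"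
      unfolding mem_Collect_eq eval_Verify by blast
  next
    assume "\<exists>ys. length ys \<le> poly [:0, k, k, k:] (length xs) \<and> pair_word xs ys \<in> ?R"
    then obtain ys m n where w: "eval Well_Formed (pair_word xs ys) ((input_env (pair_word xs ys))(3 := m, 4 := n))"
      "eval (Certified k) (pair_word xs ys) ((input_env (pair_word xs ys))(3 := m, 4 := n))"
      unfolding mem_Collect_eq eval_Verify by blast
    then have m: "m = length xs" "graph_word n xs"
      unfolding eval_Well_Formed_pair_word by blast+
    then show "xs \<in> ?L"
      using w(2) unfolding in_language_iff[OF k] m(1) eval_Certified_pair_word[OF m(2)] by blast
  qed
  ultimately show ?thesis
    unfolding class_NP_def by blast
qed

theorem theorem2:
  fixes k :: nat
  assumes "2 \<le> k"
  shows "NP_complete {encode G S |G S. instance_of G S \<and>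
           (\<exists>\<T>. internally_disjoint_trees G S \<T> \<and> card \<T> = k)}"
  using assms in_NP[of k] NP_hard[OF assms] by (simp add: NP_complete_def)

end
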